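(* Let $\mathbb{K}$ be a field, let $G_0$ be the graph on the vertex set $\{1,\ldots,17\}$ whose maximal cliques are the integer intervals $[1,3]$, $[2,5]$, $[3,9]$, $[4,14]$, $[9,15]$ and $[10,17]$. Let $S=\mathbb{K}[x_1,\ldots,x_{17},y_1,\ldots,y_{17}]$, let $J_{G_0}\subset S$ be the binomial edge ideal of $G_0$, and let $p=\mathrm{proj\,dim}(S/J_{G_0})$. Then $\beta_{p,p+5}(S/J_{G_0})=0$. In particular, $S/J_{G_0}$ does not have a unique extremal Betti number.
   Context: For integers $a<b$, $[a,b]=\{s\in\mathbb{Z} : a\le s\le b\}$. Thus $\{i,j\}$ with $i\neq j$ is an edge of $G_0$ if and only if $i$ and $j$ both lie in one of the listed intervals. The binomial edge ideal of a graph $G$ on $\{1,\ldots,n\}$ is $J_G=(x_iy_j-x_jy_i : i<j,\ \{i,j\}\in E(G))\subset \mathbb{K}[x_1,\ldots,x_n,y_1,\ldots,y_n]$. $\beta_{i,j}(S/J)$ denotes the $(i,j)$-th graded Betti number of $S/J$, i.e. the minimal $\mathbb{Z}$-graded free resolution of $S/J$ over $S$ (all variables of degree $1$) has $i$-th module $\bigoplus_j S(-j)^{\beta_{i,j}(S/J)}$, and $\mathrm{proj\,dim}$ is the length of this resolution. A nonzero Betti number $\beta_{i,j}(S/J)$ is called extremal if $\beta_{k,\ell}(S/J)=0$ for all $k\ge i$ and $\ell\ge j$ with $(k,\ell)\ne(i,j)$.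
   Formalization: Extremality is taken by Betti-table rows: β_{i,i+j} is extremal if β_{k,k+l}=0 for all other k≥i, l≥j. With internal degrees compared literally, β_{25,29} would be the unique extremal Betti number, so the final claim would be false. *)

theory Defs
  imports
    "HOL-Library.Poly_Mapping"
    "HOL-Algebra.Ideal"
    "Jordan_Normal_Form.Matrix"
begin

section \<open>Polynomial rings\<close>

type_synonym ('v, 'k) mpoly = "('v \<Rightarrow>\<^sub>0 nat) \<Rightarrow>\<^sub>0 'k"

text \<open>
  The polynomial ring over the field \<^typ>\<open>'k\<close> whose variables are the elements of \<^term>\<open>V\<close>.
  Its operations are those of the type class, so matrices over it can be multiplied with the
  operations of the matrix library.
\<close>

definition mpoly_ring :: "'v set \<Rightarrow> ('v, 'k::field) mpoly ring" where
  "mpoly_ring V =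
    \<lparr>carrier = {f. \<forall>m\<in>Poly_Mapping.keys f. Poly_Mapping.keys m \<subseteq> V},
     monoid.mult = (*), one = 1, zero = 0, add = (+)\<rparr>"

definition Var :: "'v \<Rightarrow> ('v, 'k::field) mpoly" where
  "Var v = Poly_Mapping.single (Poly_Mapping.single v 1) 1"

definition mon_degree :: "('v \<Rightarrow>\<^sub>0 nat) \<Rightarrow> nat" where
  "mon_degree m = (\<Sum>v\<in>Poly_Mapping.keys m. Poly_Mapping.lookup m v)"

text \<open>The zero polynomial is homogeneous of every degree, and it is the only one of negative degree.\<close>

definition homogeneous :: "int \<Rightarrow> ('v, 'k::field) mpoly \<Rightarrow> bool" where
  "homogeneous d f \<longleftrightarrow> (\<forall>m\<in>Poly_Mapping.keys f. int (mon_degree m) = d)"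

definition irrelevant_ideal :: "'v set \<Rightarrow> ('v, 'k::field) mpoly set" where
  "irrelevant_ideal V = Idl\<^bsub>mpoly_ring V\<^esub> (Var ` V)"

lemma mpoly_ring_cring: "cring (mpoly_ring V :: ('v, 'k::field) mpoly ring)"
proof -
  define C where "C = {f :: ('v, 'k) mpoly. \<forall>m\<in>Poly_Mapping.keys f. Poly_Mapping.keys m \<subseteq> V}"
  have R: "mpoly_ring V = \<lparr>carrier = C, monoid.mult = (*), one = 1, zero = 0, add = (+)\<rparr>"
    by (simp add: mpoly_ring_def C_def)
  have zero: "0 \<in> C" and one: "1 \<in> C"
    by (simp_all add: C_def)
  have add: "f + g \<in> C" if "f \<in> C" "g \<in> C" for f g
    using that Poly_Mapping.keys_add[of f g] unfolding C_def by blast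
  have mult: "f * g \<in> C" if "f \<in> C" "g \<in> C" for f g
  proof -
    have "Poly_Mapping.keys m \<subseteq> V" if m: "m \<in> Poly_Mapping.keys (f * g)" for m
    proof -
      obtain a b where "m = a + b" "a \<in> Poly_Mapping.keys f" "b \<in> Poly_Mapping.keys g"
        using m keys_mult[of f g] by blast
      then show ?thesis
        using Poly_Mapping.keys_add[of a b] \<open>f \<in> C\<close> \<open>g \<in> C\<close> unfolding C_def by blast
    qed
    then show ?thesis unfolding C_def by blast
  qed
  have neg: "- f \<in> C" if "f \<in> C" for f
    using that by (simp add: C_def)
  have "abelian_group \<lparr>carrier = C, monoid.mult = (*), one = 1, zero = 0, add = (+)\<rparr>"
  proof (rule abelian_groupI, goal_cases)
    case (6 x)
    then have "\<exists>y\<in>C. y + x = 0"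
      using neg by (intro bexI[of _ "- x"]) simp_all
    then show ?case by simp
  qed (simp_all add: zero add add.assoc add.commute)
  moreover have "Group.comm_monoid \<lparr>carrier = C, monoid.mult = (*), one = 1, zero = 0, add = (+)\<rparr>"
    by (rule comm_monoidI) (simp_all add: one mult mult.assoc mult.commute)
  ultimately show ?thesis
    unfolding R by (rule cringI) (simp add: distrib_right)
qed


section \<open>Minimal graded free resolutions\<close>

text \<open>
  Let \<^term>\<open>S = mpoly_ring V\<close>.  A list \<^term>\<open>a\<close> of integers stands for the graded free module
  \<open>\<Oplus>\<^sub>c S(-a ! c)\<close>, whose \<open>c\<close>-th basis element has degree \<open>a ! c\<close>.
\<close>

definition free_module :: "'v set \<Rightarrow> int list \<Rightarrow> ('v, 'k::field) mpoly vec set" where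
  "free_module V a = {v \<in> carrier_vec (length a). \<forall>c<length a. v $ c \<in> carrier (mpoly_ring V)}"

text \<open>Matrices of the degree-preserving homomorphisms \<open>\<Oplus>\<^sub>c S(-a ! c) \<rightarrow> \<Oplus>\<^sub>r S(-b ! r)\<close>.\<close>

definition graded_hom :: "'v set \<Rightarrow> int list \<Rightarrow> int list \<Rightarrow> ('v, 'k::field) mpoly mat set" where
  "graded_hom V a b = {A \<in> carrier_mat (length b) (length a).
     \<forall>r<length b. \<forall>c<length a.
       A $$ (r, c) \<in> carrier (mpoly_ring V) \<and> homogeneous (a ! c - b ! r) (A $$ (r, c))}"

text \<open>
  \<^term>\<open>D i\<close> lists the degrees of the generators of the \<open>i\<close>-th free module \<open>F\<^sub>i\<close>, and \<^term>\<open>d i\<close>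
  is the matrix of \<open>F\<^sub>i \<rightarrow> F\<^bsub>i-1\<^esub>\<close> for \<open>i \<ge> 1\<close> (\<^term>\<open>d 0\<close> is not used).  The augmentation
  \<open>F\<^sub>0 \<rightarrow> S/J\<close> is given by homogeneous representatives \<^term>\<open>e $ c\<close> in \<open>S\<close> of the images of the
  basis elements, that is, \<open>v \<mapsto> (e \<bullet> v) + J\<close>.
\<close>

definition graded_free_resolution ::
  "'v set \<Rightarrow> ('v, 'k::field) mpoly set \<Rightarrow> (nat \<Rightarrow> int list) \<Rightarrow>
   ('v, 'k) mpoly vec \<Rightarrow> (nat \<Rightarrow> ('v, 'k) mpoly mat) \<Rightarrow> bool" where
  "graded_free_resolution V J D e d \<longleftrightarrow>
     e \<in> free_module V (D 0) \<and>
     (\<forall>c<length (D 0). homogeneous (D 0 ! c) (e $ c)) \<and>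
     (\<forall>i\<ge>1. d i \<in> graded_hom V (D i) (D (i - 1))) \<and>
     (\<forall>f\<in>carrier (mpoly_ring V). \<exists>v\<in>free_module V (D 0). f - e \<bullet> v \<in> J) \<and>
     {v \<in> free_module V (D 0). e \<bullet> v \<in> J} = (\<lambda>w. d 1 *\<^sub>v w) ` free_module V (D 1) \<and>
     (\<forall>i\<ge>1. {v \<in> free_module V (D i). d i *\<^sub>v v = 0\<^sub>v (length (D (i - 1)))} =
              (\<lambda>w. d (i + 1) *\<^sub>v w) ` free_module V (D (i + 1)))"

definition minimal_graded_free_resolution ::
  "'v set \<Rightarrow> ('v, 'k::field) mpoly set \<Rightarrow> (nat \<Rightarrow> int list) \<Rightarrow>
   ('v, 'k) mpoly vec \<Rightarrow> (nat \<Rightarrow> ('v, 'k) mpoly mat) \<Rightarrow> bool" where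
  "minimal_graded_free_resolution V J D e d \<longleftrightarrow>
     graded_free_resolution V J D e d \<and>
     (\<forall>i\<ge>1. elements_mat (d i) \<subseteq> irrelevant_ideal V)"

text \<open>
  For a finite set \<^term>\<open>V\<close> and a homogeneous ideal \<^term>\<open>J\<close> of \<open>S\<close> a minimal graded free resolution
  of \<open>S/J\<close> exists, is finite, and is unique up to isomorphism; hence the numbers below do not depend
  on the resolution that is chosen.
\<close>

definition resolution_degrees :: "'v set \<Rightarrow> ('v, 'k::field) mpoly set \<Rightarrow> nat \<Rightarrow> int list" where
  "resolution_degrees V J = (SOME D. \<exists>e d. minimal_graded_free_resolution V J D e d)"

text \<open>\<open>\<beta>\<^bsub>i,j\<^esub>(S/J)\<close>, with \<open>j\<close> the internal degree.\<close>

definition graded_betti :: "'v set \<Rightarrow> ('v, 'k::field) mpoly set \<Rightarrow> nat \<Rightarrow> int \<Rightarrow> nat" where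
  "graded_betti V J i j = count_list (resolution_degrees V J i) j"

definition proj_dim :: "'v set \<Rightarrow> ('v, 'k::field) mpoly set \<Rightarrow> nat" where
  "proj_dim V J = (GREATEST i. resolution_degrees V J i \<noteq> [])"

text \<open>
  Extremality refers to positions \<open>(i, j)\<close> in the Betti table, where \<open>j\<close> is the row: the Betti number
  at this position is \<open>\<beta>\<^bsub>i,i+j\<^esub>\<close>.  This is the definition of Bayer, Charalambous and Popescu; under it
  \<open>S/J\<close> has a unique extremal Betti number if and only if \<open>\<beta>\<^bsub>p,p+r\<^esub>(S/J) \<noteq> 0\<close> for the projective
  dimension \<open>p\<close> and the regularity \<open>r\<close>.  Comparing internal degrees instead of rows would be a
  different notion.
\<close>

definition extremal_betti :: "'v set \<Rightarrow> ('v, 'k::field) mpoly set \<Rightarrow> nat \<Rightarrow> int \<Rightarrow> bool" where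
  "extremal_betti V J i j \<longleftrightarrow>
     graded_betti V J i (int i + j) \<noteq> 0 \<and>
     (\<forall>k\<ge>i. \<forall>l\<ge>j. (k, l) \<noteq> (i, j) \<longrightarrow> graded_betti V J k (int k + l) = 0)"

definition has_unique_extremal_betti :: "'v set \<Rightarrow> ('v, 'k::field) mpoly set \<Rightarrow> bool" where
  "has_unique_extremal_betti V J \<longleftrightarrow> (\<exists>!ij. extremal_betti V J (fst ij) (snd ij))"


section \<open>Binomial edge ideals\<close>

datatype xy_var = XV nat | YV nat

definition xy_vars :: "nat \<Rightarrow> xy_var set" where
  "xy_vars n = XV ` {1..n} \<union> YV ` {1..n}"

text \<open>A graph on \<open>{1, \<dots>, n}\<close> is given by its set of edges, which are two-element sets.\<close>

definition binomial_edge_ideal :: "nat \<Rightarrow> nat set set \<Rightarrow> (xy_var, 'k::field) mpoly set" where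
  "binomial_edge_ideal n E = Idl\<^bsub>mpoly_ring (xy_vars n)\<^esub>
     {Var (XV i) * Var (YV j) - Var (XV j) * Var (YV i) |i j.
        i \<in> {1..n} \<and> j \<in> {1..n} \<and> i < j \<and> {i, j} \<in> E}"

definition is_maximal_clique :: "nat set \<Rightarrow> nat set set \<Rightarrow> nat set \<Rightarrow> bool" where
  "is_maximal_clique W E C \<longleftrightarrow>
     C \<subseteq> W \<and> (\<forall>i\<in>C. \<forall>j\<in>C. i \<noteq> j \<longrightarrow> {i, j} \<in> E) \<and>
     (\<forall>C'. C \<subset> C' \<and> C' \<subseteq> W \<longrightarrow> \<not> (\<forall>i\<in>C'. \<forall>j\<in>C'. i \<noteq> j \<longrightarrow> {i, j} \<in> E))"

definition G0_cliques :: "nat set set" where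
  "G0_cliques = {{1..3}, {2..5}, {3..9}, {4..14}, {9..15}, {10..17}}"

definition G0 :: "nat set set" where
  "G0 = {{i, j} |i j. i \<noteq> j \<and> (\<exists>C\<in>G0_cliques. i \<in> C \<and> j \<in> C)}"

lemma G0_edge_iff: "i \<noteq> j \<Longrightarrow> {i, j} \<in> G0 \<longleftrightarrow> (\<exists>C\<in>G0_cliques. i \<in> C \<and> j \<in> C)"
  unfolding G0_def by (auto simp: doubleton_eq_iff)

lemma G0_cliques_cover: "i \<in> {1..17} \<Longrightarrow> \<exists>C\<in>G0_cliques. i \<in> C"
  unfolding G0_cliques_def by simp linarith

lemma G0_cliques_interval: "I \<in> G0_cliques \<Longrightarrow> a \<in> I \<Longrightarrow> b \<in> I \<Longrightarrow> {a..b} \<subseteq> I"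
  unfolding G0_cliques_def by (elim insertE emptyE) simp_all

lemma G0_cliques_subset: "I \<in> G0_cliques \<Longrightarrow> I \<subseteq> {1..17}"
  unfolding G0_cliques_def by (elim insertE emptyE) simp_all

lemma G0_cliques_antichain: "I \<in> G0_cliques \<Longrightarrow> I' \<in> G0_cliques \<Longrightarrow> I \<subseteq> I' \<Longrightarrow> I = I'"
  unfolding G0_cliques_def by (elim insertE emptyE) simp_all

lemma G0_cliques_clique: "I \<in> G0_cliques \<Longrightarrow> \<forall>i\<in>I. \<forall>j\<in>I. i \<noteq> j \<longrightarrow> {i, j} \<in> G0"
  using G0_edge_iff by blast

lemma G0_clique_subset:
  assumes C: "C \<subseteq> {1..17}" and clique: "\<forall>i\<in>C. \<forall>j\<in>C. i \<noteq> j \<longrightarrow> {i, j} \<in> G0"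
  shows "\<exists>I\<in>G0_cliques. C \<subseteq> I"
proof (cases "C = {}")
  case True
  then show ?thesis using G0_cliques_cover[of 1] by auto
next
  case False
  have fin: "finite C" using C finite_subset by blast
  have mem: "Min C \<in> C" "Max C \<in> C" using fin False by simp_all
  have "\<exists>I\<in>G0_cliques. Min C \<in> I \<and> Max C \<in> I"
  proof (cases "Min C = Max C")
    case True
    have "Min C \<in> {1..17}" using mem C by blast
    then show ?thesis using G0_cliques_cover True by metis
  next
    case False
    then have "{Min C, Max C} \<in> G0" using clique mem by blast
    then show ?thesis using G0_edge_iff[OF False] by blast
  qed
  then obtain I where I: "I \<in> G0_cliques" "Min C \<in> I" "Max C \<in> I" by blast
  have "C \<subseteq> {Min C..Max C}" using fin by (simp add: subset_iff)
  also have "\<dots> \<subseteq> I" by (rule G0_cliques_interval[OF I])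
  finally show ?thesis using I(1) by blast
qed

lemma G0_maximal_cliques: "{C. is_maximal_clique {1..17} G0 C} = G0_cliques"
proof (intro equalityI subsetI)
  fix C assume "C \<in> {C. is_maximal_clique {1..17} G0 C}"
  then have sub: "C \<subseteq> {1..17}" and clique: "\<forall>i\<in>C. \<forall>j\<in>C. i \<noteq> j \<longrightarrow> {i, j} \<in> G0"
    and max: "\<And>C'. C \<subset> C' \<Longrightarrow> C' \<subseteq> {1..17} \<Longrightarrow>
                \<not> (\<forall>i\<in>C'. \<forall>j\<in>C'. i \<noteq> j \<longrightarrow> {i, j} \<in> G0)"
    unfolding is_maximal_clique_def mem_Collect_eq by simp_all
  obtain I where I: "I \<in> G0_cliques" "C \<subseteq> I"
    using G0_clique_subset[OF sub clique] by blast
  have "\<not> C \<subset> I"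
    using max[of I] G0_cliques_subset[OF I(1)] G0_cliques_clique[OF I(1)] by argo
  then have "C = I" using I(2) by blast
  then show "C \<in> G0_cliques" using I(1) by simp
next
  fix I assume I: "I \<in> G0_cliques"
  have "\<not> (\<forall>i\<in>C'. \<forall>j\<in>C'. i \<noteq> j \<longrightarrow> {i, j} \<in> G0)" if C': "I \<subset> C' \<and> C' \<subseteq> {1..17}" for C'
  proof
    assume "\<forall>i\<in>C'. \<forall>j\<in>C'. i \<noteq> j \<longrightarrow> {i, j} \<in> G0"
    then obtain I' where I': "I' \<in> G0_cliques" "C' \<subseteq> I'"
      using G0_clique_subset C' by metis
    then have "I \<subseteq> I'" using C' by blast
    then have "I = I'" by (rule G0_cliques_antichain[OF I I'(1)])
    then show False using C' I'(2) by blast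
  qed
  then show "I \<in> {C. is_maximal_clique {1..17} G0 C}"
    unfolding is_maximal_clique_def mem_Collect_eq
    using G0_cliques_subset[OF I] G0_cliques_clique[OF I] by blast
qed

end

theory Submission
  imports Defs "HOL-Library.Function_Algebras" "HOL-Library.Confluence"
begin

text \<open>
  The graded Betti numbers of \<open>S/J\<close> are read off from its Koszul homology.  The terms of smallest
  weight, where \<open>x\<^sub>i\<close> has weight \<open>i\<close> and \<open>y\<^sub>i\<close> weight \<open>0\<close>, degenerate \<open>J\<close> to the edge ideal \<open>I\<close> of a
  bipartite graph.  The Koszul homology of \<open>S/I\<close> in a squarefree degree is the cohomology of an
  independence complex, and folding dominated vertices shows that a class in row \<open>r\<close> comes from a
  sequence of \<open>r\<close> corners of that graph, which bounds its column.  For \<open>G\<^sub>0\<close> the column is at most \<open>25\<close>,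
  there is no row beyond \<open>5\<close>, and in row \<open>5\<close> the column is at most \<open>23\<close>; these vanishing results carry
  over to \<open>S/J\<close>.  Conversely a class of \<open>S/I\<close> lifts to \<open>S/J\<close> if the adjacent Koszul homology vanishes
  in the same vertex degree.  This gives nonzero Betti numbers in column \<open>25\<close> and row \<open>4\<close>, and, from
  the induced path \<open>1, 2, 4, 9, 15, 16\<close>, in row \<open>5\<close>.  Hence the projective dimension is \<open>25\<close>, and it
  is not attained in row \<open>5\<close>.
\<close>

section \<open>Koszul homology of subquotients\<close>

text \<open>Betti numbers are read from a chosen minimal resolution, so one has to exist before any
  can be computed. Finite generation of the syzygy modules is drawn from the vanishing bounds
  themselves: for each \<open>i\<close>, Tor vanishes in large degrees, and this property passes
  from a module to its syzygies. Only the set of generator degrees in each step is matched with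
  Koszul homology.

  Homology appears only through predicates saying that it vanishes, and long exact sequences only as
  implications between them. Hence a class of \<open>S/I\<close> lifts when both adjacent exterior
  degrees vanish: the lower one holds the obstruction to lifting, the upper one could kill the lift.
  In column 25 both vanish throughout degree 29; in row 5 they are controlled in the vertex degree
  of the path.

  The constants are sums of \<open>far0 a - a\<close> over the corners. Corners starting at 1, 3, 4,
  10 give 2 + 6 + 10 + 7 = 25. Five corners must start at 1, 2, some value from 4 to 8, 9, and some
  value from 15 on, which leaves at most 2 + 3 + 10 + 6 + 2 = 23.\<close>

definition odd_below :: "'v::linorder \<Rightarrow> 'v set \<Rightarrow> bool" where
  "odd_below v A \<longleftrightarrow> odd (card {u \<in> A. u < v})"

lemma odd_below_insert:
  assumes "finite A" "u \<notin> A" "u \<noteq> v"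
  shows "odd_below v (insert u A) \<longleftrightarrow> (odd_below v A \<noteq> (u < v))"
proof -
  have "{w \<in> insert u A. w < v} = (if u < v then insert u {w \<in> A. w < v} else {w \<in> A. w < v})"
    by auto
  then show ?thesis using assms unfolding odd_below_def by simp
qed

text \<open>Signs act by negation on any abelian group, so that one calculus serves polynomials,
  vectors of polynomials and scalars.\<close>

definition ksgn :: "'v::linorder \<Rightarrow> 'v set \<Rightarrow> 'm::ab_group_add \<Rightarrow> 'm" where
  "ksgn v A x = (if odd_below v A then - x else x)"

lemma ksgn_simps [simp]:
  "ksgn v A (x + y) = ksgn v A x + ksgn v A y"
  "ksgn v A (x - y) = ksgn v A x - ksgn v A y"
  "ksgn v A (- x) = - ksgn v A x"
  "ksgn v A 0 = 0"
  "ksgn v A (ksgn v A x) = x"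
  by (simp_all add: ksgn_def)

lemma ksgn_sum: "ksgn v A (sum f B) = (\<Sum>b\<in>B. ksgn v A (f b))"
  by (simp add: ksgn_def sum_negf)

lemma ksgn_eq_0_iff [simp]: "ksgn v A x = 0 \<longleftrightarrow> x = 0"
  by (simp add: ksgn_def)

text \<open>Exactly one of \<open>u\<close> and \<open>v\<close> precedes the other, so exactly one
  of the two signs changes; this makes the differential square to zero.\<close>

lemma ksgn_swap:
  assumes "finite A" "u \<notin> A" "v \<notin> A" "u \<noteq> v"
  shows "ksgn u A (ksgn v (insert u A) x) = - ksgn v A (ksgn u (insert v A) x)"
  using assms odd_below_insert[of A u v] odd_below_insert[of A v u]
  by (cases "u < v") (auto simp: ksgn_def)

lemma ksgn_swap':
  assumes "finite A" "u \<notin> A" "v \<notin> A" "u \<noteq> v"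
  shows "ksgn u (insert v A) (ksgn v (insert u A) x) = - ksgn v A (ksgn u A x)"
  using assms odd_below_insert[of A u v] odd_below_insert[of A v u]
  by (cases "u < v") (auto simp: ksgn_def)

lemma sum_antisymmetric:
  fixes f :: "'a \<Rightarrow> 'a \<Rightarrow> 'm::ab_group_add"
  assumes "finite S" "\<And>u v. u \<in> S \<Longrightarrow> v \<in> S \<Longrightarrow> u \<noteq> v \<Longrightarrow> f u v = - f v u"
  shows "(\<Sum>u\<in>S. \<Sum>v\<in>S - {u}. f u v) = 0"
  using assms
proof (induction S rule: finite_induct)
  case (insert a S)
  have "(\<Sum>v\<in>insert a S - {u}. f u v) = f u a + (\<Sum>v\<in>S - {u}. f u v)" if "u \<in> S" for u
  proof -
    have "insert a S - {u} = insert a (S - {u})" using that insert.hyps by auto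
    then show ?thesis using insert.hyps by simp
  qed
  moreover have "insert a S - {a} = S" using insert.hyps by auto
  ultimately have "(\<Sum>u\<in>insert a S. \<Sum>v\<in>insert a S - {u}. f u v)
      = (\<Sum>v\<in>S. f a v + f v a) + (\<Sum>u\<in>S. \<Sum>v\<in>S - {u}. f u v)"
    using insert.hyps by (simp add: sum.distrib algebra_simps)
  moreover have "f a v + f v a = 0" if "v \<in> S" for v
  proof -
    have "f a v = - f v a" using that insert.hyps by (intro insert.prems) auto
    then show ?thesis by (simp only: left_minus)
  qed
  moreover have "(\<Sum>u\<in>S. \<Sum>v\<in>S - {u}. f u v) = 0"
    by (rule insert.IH, rule insert.prems) simp_all
  ultimately show ?case by simp
qed simp

section \<open>Koszul complexes of commuting operators and their subquotients\<close>

locale koszul =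
  fixes V :: "'v::linorder set" and act :: "'v \<Rightarrow> 'm::ab_group_add \<Rightarrow> 'm"
  assumes fin: "finite V"
    and act_add: "act v (x + y) = act v x + act v y"
    and act_comm: "act u (act v x) = act v (act u x)"
begin

lemma act_0 [simp]: "act v 0 = 0"
  using act_add[of v 0 0] by simp

lemma act_minus: "act v (- x) = - act v x"
  using act_add[of v x "- x"] by (simp add: eq_neg_iff_add_eq_0 add.commute)

lemma act_diff: "act v (x - y) = act v x - act v y"
  using act_add[of v x "- y"] by (simp add: act_minus)

lemma act_sum: "act v (sum f B) = (\<Sum>b\<in>B. act v (f b))"
  by (induction B rule: infinite_finite_induct) (auto simp: act_add)

lemma act_ksgn: "act v (ksgn u A x) = ksgn u A (act v x)"
  by (simp add: ksgn_def act_minus)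

text \<open>The value of a chain at \<open>A\<close> is the coefficient of the exterior monomial of
  \<open>A\<close>. Chains are total functions; which exterior degree and which coefficients count
  is decided by \<open>van\<close>.\<close>

definition kd :: "('v set \<Rightarrow> 'm) \<Rightarrow> 'v set \<Rightarrow> 'm" where
  "kd z A = (\<Sum>v\<in>V - A. ksgn v A (act v (z (insert v A))))"

lemma kd_add: "kd (\<lambda>A. z A + w A) A = kd z A + kd w A"
  by (simp add: kd_def act_add sum.distrib)

lemma kd_diff: "kd (\<lambda>A. z A - w A) A = kd z A - kd w A"
  by (simp add: kd_def act_diff sum_subtractf)

lemma kd_kd:
  assumes "A \<subseteq> V" shows "kd (kd z) A = 0"
proof -
  have A: "finite A" using assms fin finite_subset by blast
  define f where "f u v = ksgn u A (ksgn v (insert u A) (act u (act v (z (insert v (insert u A))))))" for u v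
  have eq: "V - insert u A = (V - A) - {u}" for u by blast
  have "kd (kd z) A = (\<Sum>u\<in>V - A. \<Sum>v\<in>(V - A) - {u}. f u v)"
    unfolding kd_def f_def act_sum ksgn_sum act_ksgn eq ..
  also have "\<dots> = 0"
  proof (rule sum_antisymmetric)
    fix u v assume *: "u \<in> V - A" "v \<in> V - A" "u \<noteq> v"
    show "f u v = - f v u"
      unfolding f_def act_comm[of u v] insert_commute[of v u]
      using * by (intro ksgn_swap A) auto
  qed (use fin in auto)
  finally show ?thesis .
qed

text \<open>A subcomplex whose coefficient group may vary with \<open>A\<close>. This admits graded
  pieces, where the coefficients at \<open>A\<close> have degree \<open>d - card A\<close>.\<close>

definition csys :: "('v set \<Rightarrow> 'm set) \<Rightarrow> bool" where
  "csys M \<longleftrightarrow> (\<forall>A\<subseteq>V. 0 \<in> M A \<and> (\<forall>x\<in>M A. \<forall>y\<in>M A. x + y \<in> M A \<and> - x \<in> M A)) \<and>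
     (\<forall>A\<subseteq>V. \<forall>v\<in>V - A. \<forall>x\<in>M (insert v A). act v x \<in> M A)"

text \<open>The homology of \<open>M / N\<close> in exterior degree \<open>i\<close> is zero. For
  \<open>i = 0\<close> the cycle condition is vacuous.\<close>

definition van :: "('v set \<Rightarrow> 'm set) \<Rightarrow> ('v set \<Rightarrow> 'm set) \<Rightarrow> nat \<Rightarrow> bool" where
  "van M N i \<longleftrightarrow> (\<forall>z. (\<forall>A\<subseteq>V. card A = i \<longrightarrow> z A \<in> M A) \<longrightarrow>
      (\<forall>A\<subseteq>V. Suc (card A) = i \<longrightarrow> kd z A \<in> N A) \<longrightarrow>
      (\<exists>w. (\<forall>A\<subseteq>V. card A = Suc i \<longrightarrow> w A \<in> M A) \<and>
           (\<forall>A\<subseteq>V. card A = i \<longrightarrow> z A - kd w A \<in> N A)))"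

lemma vanI:
  assumes "\<And>z. \<lbrakk>\<And>A. A \<subseteq> V \<Longrightarrow> card A = i \<Longrightarrow> z A \<in> M A;
      \<And>A. A \<subseteq> V \<Longrightarrow> Suc (card A) = i \<Longrightarrow> kd z A \<in> N A\<rbrakk> \<Longrightarrow>
      \<exists>w. (\<forall>A\<subseteq>V. card A = Suc i \<longrightarrow> w A \<in> M A) \<and>
           (\<forall>A\<subseteq>V. card A = i \<longrightarrow> z A - kd w A \<in> N A)"
  shows "van M N i"
  using assms unfolding van_def by blast

lemma vanE:
  assumes "van M N i" "\<And>A. A \<subseteq> V \<Longrightarrow> card A = i \<Longrightarrow> z A \<in> M A"
    "\<And>A. A \<subseteq> V \<Longrightarrow> Suc (card A) = i \<Longrightarrow> kd z A \<in> N A"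
  obtains w where "\<And>A. A \<subseteq> V \<Longrightarrow> card A = Suc i \<Longrightarrow> w A \<in> M A"
    "\<And>A. A \<subseteq> V \<Longrightarrow> card A = i \<Longrightarrow> z A - kd w A \<in> N A"
proof -
  have "\<exists>w. (\<forall>A\<subseteq>V. card A = Suc i \<longrightarrow> w A \<in> M A) \<and>
           (\<forall>A\<subseteq>V. card A = i \<longrightarrow> z A - kd w A \<in> N A)"
    using assms(1) unfolding van_def by (elim allE[of _ z] impE) (use assms(2,3) in auto)
  then show ?thesis by (elim exE conjE, intro that) blast+
qed

lemma csys_0: "csys M \<Longrightarrow> A \<subseteq> V \<Longrightarrow> 0 \<in> M A"
  unfolding csys_def by blast

lemma csys_add: "csys M \<Longrightarrow> A \<subseteq> V \<Longrightarrow> x \<in> M A \<Longrightarrow> y \<in> M A \<Longrightarrow> x + y \<in> M A"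
  unfolding csys_def by blast

lemma csys_neg: "csys M \<Longrightarrow> A \<subseteq> V \<Longrightarrow> x \<in> M A \<Longrightarrow> - x \<in> M A"
  unfolding csys_def by blast

lemma csys_diff: "csys M \<Longrightarrow> A \<subseteq> V \<Longrightarrow> x \<in> M A \<Longrightarrow> y \<in> M A \<Longrightarrow> x - y \<in> M A"
  using csys_add[of M A x "- y"] csys_neg[of M A y] by simp

lemma csys_sum: "csys M \<Longrightarrow> A \<subseteq> V \<Longrightarrow> (\<And>b. b \<in> B \<Longrightarrow> f b \<in> M A) \<Longrightarrow> sum f B \<in> M A"
  by (induction B rule: infinite_finite_induct) (auto simp: csys_0 csys_add)

lemma csys_act: "csys M \<Longrightarrow> insert v A \<subseteq> V \<Longrightarrow> v \<notin> A \<Longrightarrow> x \<in> M (insert v A) \<Longrightarrow> act v x \<in> M A"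
  unfolding csys_def by blast

lemma csys_ksgn: "csys M \<Longrightarrow> A \<subseteq> V \<Longrightarrow> x \<in> M A \<Longrightarrow> ksgn v B x \<in> M A"
  by (simp add: ksgn_def csys_neg)

lemma kd_in:
  assumes M: "csys M" and z: "\<And>A. A \<subseteq> V \<Longrightarrow> card A = Suc i \<Longrightarrow> z A \<in> M A"
    and A: "A \<subseteq> V" "card A = i"
  shows "kd z A \<in> M A"
  unfolding kd_def
proof (rule csys_sum[OF M A(1)])
  fix v assume v: "v \<in> V - A"
  have "card (insert v A) = Suc i"
    using v A finite_subset[OF A(1) fin] by auto
  then have "z (insert v A) \<in> M (insert v A)" using v A by (intro z) auto
  then show "ksgn v A (act v (z (insert v A))) \<in> M A"
    using v A by (intro csys_ksgn csys_act M) auto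
qed

text \<open>Exactness of the long exact sequence at the homology of \<open>L / N\<close>: a cycle is
  first bounded modulo \<open>M\<close>, and the remainder is a cycle of
  \<open>M / N\<close>.\<close>

lemma van_extend:
  assumes "csys L" "csys M" and sub: "\<And>A. A \<subseteq> V \<Longrightarrow> N A \<subseteq> M A" "\<And>A. A \<subseteq> V \<Longrightarrow> M A \<subseteq> L A"
    and vans: "van M N i" "van L M i"
  shows "van L N i"
proof (rule vanI)
  fix z assume z: "\<And>A. A \<subseteq> V \<Longrightarrow> card A = i \<Longrightarrow> z A \<in> L A"
    and dz: "\<And>A. A \<subseteq> V \<Longrightarrow> Suc (card A) = i \<Longrightarrow> kd z A \<in> N A"
  obtain w where w: "\<And>A. A \<subseteq> V \<Longrightarrow> card A = Suc i \<Longrightarrow> w A \<in> L A"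
    and zw: "\<And>A. A \<subseteq> V \<Longrightarrow> card A = i \<Longrightarrow> z A - kd w A \<in> M A"
    by (rule vanE[OF vans(2) z]) (use dz sub in blast)+
  have "kd (\<lambda>A. z A - kd w A) A \<in> N A" if "A \<subseteq> V" "Suc (card A) = i" for A
    using dz[OF that] kd_kd[OF that(1)] by (simp add: kd_diff)
  note dz' = this
  obtain u where u: "\<And>A. A \<subseteq> V \<Longrightarrow> card A = Suc i \<Longrightarrow> u A \<in> M A"
    and zu: "\<And>A. A \<subseteq> V \<Longrightarrow> card A = i \<Longrightarrow> (z A - kd w A) - kd u A \<in> N A"
    by (rule vanE[OF vans(1) zw dz']) blast+
  show "\<exists>w. (\<forall>A\<subseteq>V. card A = Suc i \<longrightarrow> w A \<in> L A) \<and>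
           (\<forall>A\<subseteq>V. card A = i \<longrightarrow> z A - kd w A \<in> N A)"
  proof (intro exI[of _ "\<lambda>A. w A + u A"] conjI allI impI)
    fix A assume A: "A \<subseteq> V"
    show "w A + u A \<in> L A" if "card A = Suc i"
      using w u sub(2) A that by (intro csys_add assms) auto
    show "z A - kd (\<lambda>A. w A + u A) A \<in> N A" if "card A = i"
      using zu[OF A that] by (simp add: kd_add diff_diff_eq)
  qed
qed

text \<open>Exactness at the homology of \<open>L / M\<close>: the differential of a cycle
  represents its image under the connecting map. Bounding this image by \<open>w\<close> turns
  \<open>z - w\<close> into a cycle of \<open>L / N\<close>.\<close>

lemma van_quotient:
  assumes "csys L" "csys M" and sub: "\<And>A. A \<subseteq> V \<Longrightarrow> N A \<subseteq> M A" "\<And>A. A \<subseteq> V \<Longrightarrow> M A \<subseteq> L A"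
    and "csys N" and vans: "van L N (Suc i)" "van M N i"
  shows "van L M (Suc i)"
proof (rule vanI)
  fix z assume z: "\<And>A. A \<subseteq> V \<Longrightarrow> card A = Suc i \<Longrightarrow> z A \<in> L A"
    and dz: "\<And>A. A \<subseteq> V \<Longrightarrow> Suc (card A) = Suc i \<Longrightarrow> kd z A \<in> M A"
  obtain w where w: "\<And>A. A \<subseteq> V \<Longrightarrow> card A = Suc i \<Longrightarrow> w A \<in> M A"
    and zw: "\<And>A. A \<subseteq> V \<Longrightarrow> card A = i \<Longrightarrow> kd z A - kd w A \<in> N A"
    by (rule vanE[OF vans(2), of "kd z"]) (use dz kd_kd csys_0[OF \<open>csys N\<close>] in auto)
  obtain u where u: "\<And>A. A \<subseteq> V \<Longrightarrow> card A = Suc (Suc i) \<Longrightarrow> u A \<in> L A"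
    and zu: "\<And>A. A \<subseteq> V \<Longrightarrow> card A = Suc i \<Longrightarrow> (z A - w A) - kd u A \<in> N A"
  proof (rule vanE[OF vans(1), of "\<lambda>A. z A - w A"])
    fix A assume A: "A \<subseteq> V"
    show "z A - w A \<in> L A" if "card A = Suc i"
      using z w sub(2) A that by (intro csys_diff assms) auto
    show "kd (\<lambda>A. z A - w A) A \<in> N A" if "Suc (card A) = Suc i"
      using zw A that by (simp add: kd_diff)
  qed blast
  show "\<exists>w. (\<forall>A\<subseteq>V. card A = Suc (Suc i) \<longrightarrow> w A \<in> L A) \<and>
           (\<forall>A\<subseteq>V. card A = Suc i \<longrightarrow> z A - kd w A \<in> M A)"
  proof (intro exI[of _ u] conjI allI impI)
    fix A assume A: "A \<subseteq> V"
    show "u A \<in> L A" if "card A = Suc (Suc i)" using u A that .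
    assume "card A = Suc i"
    then have "(z A - w A - kd u A) + w A \<in> M A"
      using zu w sub A by (intro csys_add assms) auto
    then show "z A - kd u A \<in> M A" by simp
  qed
qed

text \<open>Exactness at the homology of \<open>M / N\<close>: if \<open>w\<close> bounds a cycle in
  \<open>L / N\<close>, then \<open>w\<close> is a cycle of \<open>L / M\<close>. Subtracting a
  boundary moves \<open>w\<close> into \<open>M\<close> and leaves its differential
  unchanged.\<close>

lemma van_sub:
  assumes "csys L" "csys M" and sub: "\<And>A. A \<subseteq> V \<Longrightarrow> N A \<subseteq> M A" "\<And>A. A \<subseteq> V \<Longrightarrow> M A \<subseteq> L A"
    and vans: "van L M (Suc i)" "van L N i"
  shows "van M N i"
proof (rule vanI)
  fix z assume z: "\<And>A. A \<subseteq> V \<Longrightarrow> card A = i \<Longrightarrow> z A \<in> M A"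
    and dz: "\<And>A. A \<subseteq> V \<Longrightarrow> Suc (card A) = i \<Longrightarrow> kd z A \<in> N A"
  obtain w where w: "\<And>A. A \<subseteq> V \<Longrightarrow> card A = Suc i \<Longrightarrow> w A \<in> L A"
    and zw: "\<And>A. A \<subseteq> V \<Longrightarrow> card A = i \<Longrightarrow> z A - kd w A \<in> N A"
    by (rule vanE[OF vans(2) subsetD[OF sub(2) z] dz]) blast+
  have "kd w A \<in> M A" if A: "A \<subseteq> V" and c: "Suc (card A) = Suc i" for A
  proof -
    have "z A \<in> M A" "z A - kd w A \<in> M A"
      using z[of A] zw[of A] sub[OF A] A c by auto
    then have "z A - (z A - kd w A) \<in> M A"
      by (rule csys_diff[OF assms(2) A])
    then show "kd w A \<in> M A" by simp
  qed
  note dw = this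
  obtain u where u: "\<And>A. A \<subseteq> V \<Longrightarrow> card A = Suc (Suc i) \<Longrightarrow> u A \<in> L A"
    and wu: "\<And>A. A \<subseteq> V \<Longrightarrow> card A = Suc i \<Longrightarrow> w A - kd u A \<in> M A"
    by (rule vanE[OF vans(1) w dw]) blast+
  show "\<exists>w. (\<forall>A\<subseteq>V. card A = Suc i \<longrightarrow> w A \<in> M A) \<and>
           (\<forall>A\<subseteq>V. card A = i \<longrightarrow> z A - kd w A \<in> N A)"
  proof (intro exI[of _ "\<lambda>A. w A - kd u A"] conjI allI impI)
    show "z A - kd (\<lambda>A. w A - kd u A) A \<in> N A" if "A \<subseteq> V" "card A = i" for A
      using zw[OF that] by (simp add: kd_diff kd_kd[OF that(1)])
  qed (rule wu)
qed

end

text \<open>The last three conditions say that \<open>f\<close> induces an isomorphism of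
  \<open>M A / N A\<close> with \<open>M' A / N' A\<close> for each \<open>A\<close>. Since
  \<open>f\<close> itself may fail to be injective or surjective, cycles and bounding chains are
  lifted only modulo \<open>N'\<close>.\<close>

lemma van_iso:
  assumes "koszul V act" "koszul V act'"
    and f_add: "\<And>x y. f (x + y) = f x + f y"
    and f_act: "\<And>v x. f (act v x) = act' v (f x)"
    and sys: "koszul.csys V act M" "koszul.csys V act' N'"
    and into: "\<And>A x. A \<subseteq> V \<Longrightarrow> x \<in> M A \<Longrightarrow> f x \<in> M' A"
    and onto: "\<And>A y. A \<subseteq> V \<Longrightarrow> y \<in> M' A \<Longrightarrow> \<exists>x\<in>M A. y - f x \<in> N' A"
    and ker: "\<And>A x. A \<subseteq> V \<Longrightarrow> x \<in> M A \<Longrightarrow> f x \<in> N' A \<longleftrightarrow> x \<in> N A"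
  shows "koszul.van V act M N i \<longleftrightarrow> koszul.van V act' M' N' i"
proof -
  interpret a: koszul V act by fact
  interpret b: koszul V act' by fact
  have f_0 [simp]: "f 0 = 0" using f_add[of 0 0] by simp
  have f_neg: "f (- x) = - f x" for x
    using f_add[of x "- x"] by (simp add: eq_neg_iff_add_eq_0 add.commute)
  have f_diff: "f (x - y) = f x - f y" for x y
    using f_add[of x "- y"] by (simp add: f_neg)
  have f_sum: "f (sum g B) = (\<Sum>b\<in>B. f (g b))" for g and B :: "'a set"
    by (induction B rule: infinite_finite_induct) (auto simp: f_add)
  have f_ksgn: "f (ksgn v A x) = ksgn v A (f x)" for v x and A :: "'a set"
    by (simp add: ksgn_def f_neg)
  have f_kd: "f (a.kd z A) = b.kd (\<lambda>A. f (z A)) A" for z A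
    by (simp add: a.kd_def b.kd_def f_sum f_ksgn f_act)
  have N'_diff: "x \<in> N' A \<longleftrightarrow> y \<in> N' A" if "x - y \<in> N' A" "A \<subseteq> V" for x y A
  proof
    assume "x \<in> N' A"
    then have "x - (x - y) \<in> N' A" by (rule b.csys_diff[OF sys(2) that(2) _ that(1)])
    moreover have "x - (x - y) = y" by simp
    ultimately show "y \<in> N' A" by metis
  next
    assume "y \<in> N' A"
    then have "(x - y) + y \<in> N' A" by (rule b.csys_add[OF sys(2) that(2) that(1)])
    then show "x \<in> N' A" by simp
  qed
  show ?thesis
  proof
    assume van: "a.van M N i"
    show "b.van M' N' i"
    proof (rule b.vanI)
      fix z' assume z': "\<And>A. A \<subseteq> V \<Longrightarrow> card A = i \<Longrightarrow> z' A \<in> M' A"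
        and dz': "\<And>A. A \<subseteq> V \<Longrightarrow> Suc (card A) = i \<Longrightarrow> b.kd z' A \<in> N' A"
      have "\<exists>z. \<forall>A. A \<subseteq> V \<and> card A = i \<longrightarrow> z A \<in> M A \<and> z' A - f (z A) \<in> N' A"
        using onto z' by (intro choice) metis
      then obtain z where z: "\<And>A. A \<subseteq> V \<Longrightarrow> card A = i \<Longrightarrow> z A \<in> M A"
        and zz': "\<And>A. A \<subseteq> V \<Longrightarrow> card A = i \<Longrightarrow> z' A - f (z A) \<in> N' A" by blast
      have dz: "a.kd z A \<in> N A" if A: "A \<subseteq> V" "Suc (card A) = i" for A
      proof -
        have "b.kd (\<lambda>A. z' A - f (z A)) A \<in> N' A"
          using A zz' by (intro b.kd_in[of _ "card A"] sys) auto
        then have "f (a.kd z A) \<in> N' A"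
          using dz'[OF A] N'_diff[OF _ A(1)] by (simp add: b.kd_diff f_kd)
        moreover have "a.kd z A \<in> M A"
          using A z by (intro a.kd_in[of _ "card A"] sys) auto
        ultimately show ?thesis using ker[OF A(1)] by simp
      qed
      obtain w where w: "\<And>A. A \<subseteq> V \<Longrightarrow> card A = Suc i \<Longrightarrow> w A \<in> M A"
        and zw: "\<And>A. A \<subseteq> V \<Longrightarrow> card A = i \<Longrightarrow> z A - a.kd w A \<in> N A"
        by (rule a.vanE[OF van z dz]) blast+
      show "\<exists>w. (\<forall>A\<subseteq>V. card A = Suc i \<longrightarrow> w A \<in> M' A) \<and>
           (\<forall>A\<subseteq>V. card A = i \<longrightarrow> z' A - b.kd w A \<in> N' A)"
      proof (intro exI[of _ "\<lambda>A. f (w A)"] conjI allI impI)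
        fix A assume A: "A \<subseteq> V"
        show "f (w A) \<in> M' A" if "card A = Suc i" using into w A that by blast
        assume c: "card A = i"
        have "a.kd w A \<in> M A" using w A c by (intro a.kd_in[of _ i] sys)
        then have "z A - a.kd w A \<in> M A" using z A c by (intro a.csys_diff sys) auto
        then have "f (z A - a.kd w A) \<in> N' A" using ker zw A c by blast
        moreover have "z' A - f (z A) \<in> N' A" using zz' A c .
        ultimately have "(z' A - f (z A)) + f (z A - a.kd w A) \<in> N' A"
          by (intro b.csys_add sys A)
        then show "z' A - b.kd (\<lambda>A. f (w A)) A \<in> N' A" by (simp add: f_diff f_kd)
      qed
    qed
  next
    assume van: "b.van M' N' i"
    show "a.van M N i"
    proof (rule a.vanI)
      fix z assume z: "\<And>A. A \<subseteq> V \<Longrightarrow> card A = i \<Longrightarrow> z A \<in> M A"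
        and dz: "\<And>A. A \<subseteq> V \<Longrightarrow> Suc (card A) = i \<Longrightarrow> a.kd z A \<in> N A"
      obtain w' where w': "\<And>A. A \<subseteq> V \<Longrightarrow> card A = Suc i \<Longrightarrow> w' A \<in> M' A"
        and zw': "\<And>A. A \<subseteq> V \<Longrightarrow> card A = i \<Longrightarrow> f (z A) - b.kd w' A \<in> N' A"
      proof (rule b.vanE[OF van, of "\<lambda>A. f (z A)"])
        fix A assume A: "A \<subseteq> V"
        show "f (z A) \<in> M' A" if "card A = i" using into z A that by blast
        assume c: "Suc (card A) = i"
        have "a.kd z A \<in> M A" using z A c by (intro a.kd_in[of _ "card A"] sys) auto
        then show "b.kd (\<lambda>A. f (z A)) A \<in> N' A"
          using ker[OF A] dz[OF A c] by (simp flip: f_kd)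
      qed blast
      have "\<exists>w. \<forall>A. A \<subseteq> V \<and> card A = Suc i \<longrightarrow> w A \<in> M A \<and> w' A - f (w A) \<in> N' A"
        using onto w' by (intro choice) metis
      then obtain w where w: "\<And>A. A \<subseteq> V \<Longrightarrow> card A = Suc i \<Longrightarrow> w A \<in> M A"
        and ww': "\<And>A. A \<subseteq> V \<Longrightarrow> card A = Suc i \<Longrightarrow> w' A - f (w A) \<in> N' A" by blast
      show "\<exists>w. (\<forall>A\<subseteq>V. card A = Suc i \<longrightarrow> w A \<in> M A) \<and>
           (\<forall>A\<subseteq>V. card A = i \<longrightarrow> z A - a.kd w A \<in> N A)"
      proof (intro exI[of _ w] conjI allI impI w)
        fix A assume A: "A \<subseteq> V" and c: "card A = i"
        have "b.kd (\<lambda>A. w' A - f (w A)) A \<in> N' A"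
          using A c ww' by (intro b.kd_in[of _ i] sys) auto
        then have "(f (z A) - b.kd w' A) + b.kd (\<lambda>A. w' A - f (w A)) A \<in> N' A"
          by (intro b.csys_add sys A zw' c)
        then have "f (z A - a.kd w A) \<in> N' A" by (simp add: b.kd_diff f_diff f_kd)
        moreover have "a.kd w A \<in> M A" using w A c by (intro a.kd_in[of _ i] sys)
        then have "z A - a.kd w A \<in> M A" using z A c by (intro a.csys_diff sys) auto
        ultimately show "z A - a.kd w A \<in> N A" using ker[OF A] by blast
      qed auto
    qed
  qed
qed

section \<open>Independence complexes\<close>

text \<open>The Koszul differential with multiplication by variables suppressed: within one fine
  degree the coefficient monomial is determined by \<open>A\<close>.\<close>

definition bd :: "'v::linorder set \<Rightarrow> ('v set \<Rightarrow> 'k::field) \<Rightarrow> 'v set \<Rightarrow> 'k" where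
  "bd W c A = (\<Sum>v\<in>W - A. ksgn v A (c (insert v A)))"

lemma bd_add: "bd W (\<lambda>A. c A + b A) A = bd W c A + bd W b A"
  by (simp add: bd_def sum.distrib)

lemma bd_minus: "bd W (\<lambda>A. - c A) A = - bd W c A"
  by (simp add: bd_def sum_negf)

lemma bd_0 [simp]: "bd W (\<lambda>_. 0) A = 0"
  by (simp add: bd_def)

text \<open>
  In squarefree degree \<open>W\<close> the Koszul complex of a Stanley--Reisner ring has as basis the
  sets \<open>A \<subseteq> W\<close> of exterior variables whose complement \<open>W - A\<close>, the support of the
  coefficient monomial, is a face; \<open>R A\<close> expresses the latter.
\<close>

definition exact_at :: "'k::field itself \<Rightarrow> 'v::linorder set \<Rightarrow> ('v set \<Rightarrow> bool) \<Rightarrow> nat \<Rightarrow> bool" where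
  "exact_at _ W R i \<longleftrightarrow> (\<forall>c :: 'v set \<Rightarrow> 'k.
     (\<forall>A\<subseteq>W. Suc (card A) = i \<longrightarrow> R A \<longrightarrow> bd W c A = 0) \<longrightarrow>
     (\<exists>b. \<forall>A\<subseteq>W. card A = i \<longrightarrow> R A \<longrightarrow> c A = bd W b A))"

lemma exact_atI:
  assumes "\<And>c :: 'v set \<Rightarrow> 'k. (\<And>A. A \<subseteq> W \<Longrightarrow> Suc (card A) = i \<Longrightarrow> R A \<Longrightarrow> bd W c A = 0) \<Longrightarrow>
     \<exists>b. \<forall>A\<subseteq>W. card A = i \<longrightarrow> R A \<longrightarrow> c A = bd W b A"
  shows "exact_at TYPE('k::field) (W :: 'v::linorder set) R i"
  using assms unfolding exact_at_def by blast

lemma exact_atE: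
  assumes "exact_at TYPE('k::field) (W :: 'v::linorder set) R i"
    and "\<And>A. A \<subseteq> W \<Longrightarrow> Suc (card A) = i \<Longrightarrow> R A \<Longrightarrow> bd W (c :: 'v set \<Rightarrow> 'k) A = 0"
  obtains b where "\<And>A. A \<subseteq> W \<Longrightarrow> card A = i \<Longrightarrow> R A \<Longrightarrow> c A = bd W b A"
proof -
  have "\<exists>b. \<forall>A\<subseteq>W. card A = i \<longrightarrow> R A \<longrightarrow> c A = bd W b A"
    using assms(1) unfolding exact_at_def by (elim allE[of _ c] impE) (use assms(2) in auto)
  then show ?thesis by (elim exE, intro that) blast
qed

lemma exact_at_cong:
  assumes "\<And>A. A \<subseteq> W \<Longrightarrow> R A \<longleftrightarrow> R' A"
  shows "exact_at TYPE('k::field) W R i \<longleftrightarrow> exact_at TYPE('k) W R' i"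
  unfolding exact_at_def using assms by simp

lemma exact_at_none:
  assumes "\<And>A. A \<subseteq> W \<Longrightarrow> \<not> R A" shows "exact_at TYPE('k::field) W R i"
  unfolding exact_at_def using assms by simp

text \<open>In exterior degree 0 the only set is the empty one, and a chain supported on one
  singleton attains any prescribed value there.\<close>

lemma exact_at_0:
  assumes "finite W" "W \<noteq> {}" shows "exact_at TYPE('k::field) (W::'v::linorder set) R 0"
proof (rule exact_atI)
  fix c :: "'v set \<Rightarrow> 'k"
  obtain v where v: "v \<in> W" using assms by blast
  have "c {} = bd W (\<lambda>A. if A = {v} then ksgn v {} (c {}) else 0) {}"
  proof -
    have "bd W (\<lambda>A. if A = {v} then ksgn v {} (c {}) else 0) {}
        = (\<Sum>w\<in>W. if w = v then c {} else 0)"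
      unfolding bd_def by (rule sum.cong) auto
    then show ?thesis using v assms by simp
  qed
  moreover have "A = {}" if "A \<subseteq> W" "card A = 0" for A
    using that assms finite_subset by fastforce
  ultimately show "\<exists>b. \<forall>A\<subseteq>W. card A = 0 \<longrightarrow> R A \<longrightarrow> c A = bd W b A"
    by blast
qed

context
  fixes W :: "'v::linorder set" and v :: 'v and R :: "'v set \<Rightarrow> bool"
  assumes W: "finite W" "v \<in> W"
begin

text \<open>Splits the complex along \<open>v\<close>. As faces are complements, sets avoiding
  \<open>v\<close> carry the link of \<open>v\<close> and sets containing \<open>v\<close> carry its
  deletion; the extra term is the map connecting the two.\<close>

lemma bd_del:
  fixes c :: "'v set \<Rightarrow> 'k::field"
  assumes "A \<subseteq> W - {v}"
  shows "bd W c A = bd (W - {v}) c A + ksgn v A (c (insert v A))"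
proof -
  have "W - A = insert v (W - {v} - A)" using W assms by auto
  then show ?thesis using W by (simp add: bd_def)
qed

lemma bd_ins:
  fixes c :: "'v set \<Rightarrow> 'k::field"
  assumes "A \<subseteq> W - {v}"
  shows "bd W c (insert v A) = - ksgn v A (bd (W - {v}) (\<lambda>A. ksgn v A (c (insert v A))) A)"
proof -
  have fin: "finite A" using W assms finite_subset by blast
  have eq: "W - insert v A = W - {v} - A" by blast
  have "ksgn u (insert v A) (c (insert u (insert v A)))
      = - ksgn v A (ksgn u A (ksgn v (insert u A) (c (insert v (insert u A)))))"
    if u: "u \<in> W - {v} - A" for u
    using ksgn_swap'[OF fin, of u v "ksgn v (insert u A) (c (insert v (insert u A)))"] u assms
    by (auto simp: insert_commute)
  then show ?thesis unfolding bd_def eq ksgn_sum sum_negf[symmetric] by (intro sum.cong) auto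
qed

text \<open>The bounding chain is assembled from \<open>b0\<close> on sets avoiding \<open>v\<close>
  and \<open>b1\<close> on sets containing \<open>v\<close>; the two hypotheses are the two
  components of \<open>c = bd W b\<close>.\<close>

lemma exact_at_glue:
  fixes c :: "'v set \<Rightarrow> 'k::field"
  assumes "\<And>A. A \<subseteq> W - {v} \<Longrightarrow> card A = i \<Longrightarrow> R A \<Longrightarrow> c A = bd (W - {v}) b0 A + b1 A"
    and "\<And>A. A \<subseteq> W - {v} \<Longrightarrow> Suc (card A) = i \<Longrightarrow> R (insert v A) \<Longrightarrow>
           ksgn v A (c (insert v A)) = - bd (W - {v}) b1 A"
  shows "\<exists>b. \<forall>A\<subseteq>W. card A = i \<longrightarrow> R A \<longrightarrow> c A = bd W b A"
proof -
  define b where "b A = (if v \<in> A then ksgn v (A - {v}) (b1 (A - {v})) else b0 A)" for A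
  have b1: "ksgn v A (b (insert v A)) = b1 A" if "v \<notin> A" for A
    using that by (simp add: b_def insert_Diff_if)
  have cong: "bd (W - {v}) f A = bd (W - {v}) g A"
    if "A \<subseteq> W - {v}" "\<And>B. v \<notin> B \<Longrightarrow> f B = g B" for f g :: "'v set \<Rightarrow> 'k" and A
  proof -
    have "f (insert x A) = g (insert x A)" if "x \<in> W - {v} - A" for x
      using that \<open>A \<subseteq> W - {v}\<close> by (intro \<open>\<And>B. v \<notin> B \<Longrightarrow> f B = g B\<close>) auto
    then show ?thesis unfolding bd_def by (intro sum.cong) auto
  qed
  have "c A = bd W b A" if A: "A \<subseteq> W" "card A = i" "R A" for A
  proof (cases "v \<in> A")
    case False
    then have A': "A \<subseteq> W - {v}" using A by auto
    have "bd (W - {v}) b A = bd (W - {v}) b0 A"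
      by (rule cong[OF A']) (simp add: b_def)
    then show ?thesis using assms(1)[OF A'] A b1[OF False] bd_del[OF A', of b] by simp
  next
    case True
    define B where "B = A - {v}"
    have B: "B \<subseteq> W - {v}" "insert v B = A" "Suc (card B) = i"
      using True A W finite_subset[OF A(1)] card_Suc_Diff1[of A v] by (auto simp: B_def)
    have "bd (W - {v}) (\<lambda>A. ksgn v A (b (insert v A))) B = bd (W - {v}) b1 B"
      by (rule cong[OF B(1)]) (rule b1)
    then have "bd W b A = - ksgn v B (bd (W - {v}) b1 B)"
      using bd_ins[OF B(1), of b] B by simp
    also have "\<dots> = ksgn v B (ksgn v B (c (insert v B)))"
      using assms(2)[OF B(1) B(3)] B(2) A(3) by simp
    finally show ?thesis using B by simp
  qed
  then show ?thesis by blast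
qed

context
  assumes up: "\<And>A. A \<subseteq> W - {v} \<Longrightarrow> R A \<Longrightarrow> R (insert v A)"
begin

lemma cycle_parts:
  fixes c :: "'v set \<Rightarrow> 'k::field"
  assumes cyc: "\<And>A. A \<subseteq> W \<Longrightarrow> Suc (card A) = i \<Longrightarrow> R A \<Longrightarrow> bd W c A = 0"
    and A: "A \<subseteq> W - {v}"
  shows "Suc (card A) = i \<Longrightarrow> R A \<Longrightarrow> bd (W - {v}) c A = - ksgn v A (c (insert v A))"
    and "Suc (Suc (card A)) = i \<Longrightarrow> R (insert v A) \<Longrightarrow>
      bd (W - {v}) (\<lambda>A. ksgn v A (c (insert v A))) A = 0"
proof -
  have fin: "finite A" using W A finite_subset by blast
  show "bd (W - {v}) c A = - ksgn v A (c (insert v A))" if "Suc (card A) = i" "R A"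
    using cyc[of A] A that bd_del[OF A, of c] by (auto simp: eq_neg_iff_add_eq_0)
  show "bd (W - {v}) (\<lambda>A. ksgn v A (c (insert v A))) A = 0"
    if "Suc (Suc (card A)) = i" "R (insert v A)"
  proof -
    have "card (insert v A) = Suc (card A)" using A fin by (subst card_insert_disjoint) auto
    then have "bd W c (insert v A) = 0" using cyc[of "insert v A"] A that W by auto
    then show ?thesis using bd_ins[OF A, of c] by simp
  qed
qed

text \<open>The part of \<open>c\<close> on sets containing \<open>v\<close> is bounded in the
  deletion by \<open>g\<close>. Adding \<open>g\<close> to the other part makes that part a cycle of
  the link.\<close>

lemma exact_at_split:
  assumes ex0: "exact_at TYPE('k::field) (W - {v}) R i"
    and ex1: "\<And>k. i = Suc k \<Longrightarrow> exact_at TYPE('k) (W - {v}) (\<lambda>A. R (insert v A)) k"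
  shows "exact_at TYPE('k) W R i"
proof (rule exact_atI)
  fix c :: "'v set \<Rightarrow> 'k"
  assume cyc: "\<And>A. A \<subseteq> W \<Longrightarrow> Suc (card A) = i \<Longrightarrow> R A \<Longrightarrow> bd W c A = 0"
  define \<beta> where "\<beta> A = ksgn v A (c (insert v A))" for A
  have "\<exists>g. \<forall>A. A \<subseteq> W - {v} \<longrightarrow> Suc (card A) = i \<longrightarrow> R (insert v A) \<longrightarrow> \<beta> A = bd (W - {v}) g A"
  proof (cases i)
    case (Suc k)
    have "bd (W - {v}) \<beta> A = 0" if "A \<subseteq> W - {v}" "Suc (card A) = k" "R (insert v A)" for A
      unfolding \<beta>_def by (rule cycle_parts(2)[OF cyc]) (use that Suc in auto)
    then obtain g where "\<And>A. A \<subseteq> W - {v} \<Longrightarrow> card A = k \<Longrightarrow> R (insert v A) \<Longrightarrow> \<beta> A = bd (W - {v}) g A"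
      using exact_atE[OF ex1[OF Suc], of \<beta>] by blast
    then show ?thesis using Suc by auto
  qed simp
  then obtain g where g: "\<And>A. A \<subseteq> W - {v} \<Longrightarrow> Suc (card A) = i \<Longrightarrow> R (insert v A) \<Longrightarrow> \<beta> A = bd (W - {v}) g A"
    by blast
  have "bd (W - {v}) (\<lambda>A. c A + g A) A = 0" if "A \<subseteq> W - {v}" "Suc (card A) = i" "R A" for A
  proof -
    have "bd (W - {v}) c A = - \<beta> A"
      unfolding \<beta>_def by (rule cycle_parts(1)[OF cyc]) (use that in auto)
    then show ?thesis using g[OF that(1,2) up[OF that(1,3)]] by (simp add: bd_add)
  qed
  then obtain b0 where b0: "\<And>A. A \<subseteq> W - {v} \<Longrightarrow> card A = i \<Longrightarrow> R A \<Longrightarrow> c A + g A = bd (W - {v}) b0 A"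
    using exact_atE[OF ex0, of "\<lambda>A. c A + g A"] by blast
  show "\<exists>b. \<forall>A\<subseteq>W. card A = i \<longrightarrow> R A \<longrightarrow> c A = bd W b A"
  proof (rule exact_at_glue[where ?b0.0 = b0 and ?b1.0 = "\<lambda>A. - g A"])
    show "c A = bd (W - {v}) b0 A + - g A" if "A \<subseteq> W - {v}" "card A = i" "R A" for A
      using b0[OF that] by (simp add: algebra_simps)
    show "ksgn v A (c (insert v A)) = - bd (W - {v}) (\<lambda>A. - g A) A"
      if "A \<subseteq> W - {v}" "Suc (card A) = i" "R (insert v A)" for A
      using g[OF that] by (simp add: bd_minus \<beta>_def)
  qed
qed

text \<open>When the deletion of \<open>v\<close> is acyclic, only the link contributes; sets
  avoiding \<open>v\<close> keep their cardinality, so the exterior degree stays.\<close>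

lemma exact_at_del:
  assumes ex: "\<And>k. exact_at TYPE('k::field) (W - {v}) (\<lambda>A. R (insert v A)) k"
  shows "exact_at TYPE('k) W R i \<longleftrightarrow> exact_at TYPE('k) (W - {v}) R i"
proof
  assume W_ex: "exact_at TYPE('k) W R i"
  show "exact_at TYPE('k) (W - {v}) R i"
  proof (rule exact_atI)
    fix a :: "'v set \<Rightarrow> 'k"
    assume cyc: "\<And>A. A \<subseteq> W - {v} \<Longrightarrow> Suc (card A) = i \<Longrightarrow> R A \<Longrightarrow> bd (W - {v}) a A = 0"
    define c where "c A = (if v \<in> A then 0 else a A)" for A
    have c_a: "bd (W - {v}) c A = bd (W - {v}) a A" if "A \<subseteq> W - {v}" for A
      unfolding bd_def by (rule sum.cong) (use that in \<open>auto simp: c_def\<close>)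
    have "bd W c A = 0" if A: "A \<subseteq> W" "Suc (card A) = i" "R A" for A
    proof (cases "v \<in> A")
      case False
      then have A': "A \<subseteq> W - {v}" using A by auto
      then show ?thesis using bd_del[OF A', of c] cyc[OF A'] A c_a[OF A'] by (simp add: c_def)
    next
      case True
      then show ?thesis by (simp add: bd_def c_def)
    qed
    then obtain b where b: "\<And>A. A \<subseteq> W \<Longrightarrow> card A = i \<Longrightarrow> R A \<Longrightarrow> c A = bd W b A"
      using exact_atE[OF W_ex, of c] by blast
    define b1 where "b1 A = ksgn v A (b (insert v A))" for A
    have "bd (W - {v}) b1 A = 0" if A: "A \<subseteq> W - {v}" "Suc (card A) = i" "R (insert v A)" for A
    proof -
      have "finite A" using W A(1) finite_subset by blast
      then have "card (insert v A) = i" using A by (subst card_insert_disjoint) auto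
      then have "bd W b (insert v A) = 0" using b[of "insert v A"] A W by (auto simp: c_def)
      then show ?thesis using bd_ins[OF A(1), of b] by (simp add: b1_def[abs_def])
    qed
    then obtain g where g: "\<And>A. A \<subseteq> W - {v} \<Longrightarrow> card A = i \<Longrightarrow> R (insert v A) \<Longrightarrow> b1 A = bd (W - {v}) g A"
      using exact_atE[OF ex, of i b1] by blast
    have "a A = bd (W - {v}) (\<lambda>A. b A + g A) A" if A: "A \<subseteq> W - {v}" "card A = i" "R A" for A
    proof -
      have "A \<subseteq> W" "v \<notin> A" using A by auto
      then have "a A = bd W b A" using b[of A] A by (simp add: c_def)
      then show ?thesis using bd_del[OF A(1), of b] g[OF A(1,2) up[OF A(1,3)]]
        by (simp add: bd_add b1_def)
    qed
    then show "\<exists>b. \<forall>A\<subseteq>W - {v}. card A = i \<longrightarrow> R A \<longrightarrow> a A = bd (W - {v}) b A" by blast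
  qed
qed (intro exact_at_split ex)

text \<open>When the link of \<open>v\<close> is acyclic, only the deletion contributes; it lives on
  the sets \<open>insert v A\<close>, whence the shift by one.\<close>

lemma exact_at_link:
  assumes ex: "\<And>k. exact_at TYPE('k::field) (W - {v}) R k"
  shows "exact_at TYPE('k) W R (Suc k) \<longleftrightarrow> exact_at TYPE('k) (W - {v}) (\<lambda>A. R (insert v A)) k"
proof
  assume W_ex: "exact_at TYPE('k) W R (Suc k)"
  show "exact_at TYPE('k) (W - {v}) (\<lambda>A. R (insert v A)) k"
  proof (rule exact_atI)
    fix \<beta> :: "'v set \<Rightarrow> 'k"
    assume cyc: "\<And>A. A \<subseteq> W - {v} \<Longrightarrow> Suc (card A) = k \<Longrightarrow> R (insert v A) \<Longrightarrow> bd (W - {v}) \<beta> A = 0"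
    obtain g where g: "\<And>A. A \<subseteq> W - {v} \<Longrightarrow> card A = k \<Longrightarrow> R A \<Longrightarrow> \<beta> A = bd (W - {v}) g A"
      using exact_atE[OF ex, of k \<beta>] cyc up by blast
    define c where "c A = (if v \<in> A then ksgn v (A - {v}) (\<beta> (A - {v})) else - g A)" for A
    have c_g: "bd (W - {v}) c A = - bd (W - {v}) g A" if "A \<subseteq> W - {v}" for A
      unfolding bd_def sum_negf[symmetric] by (rule sum.cong) (use that in \<open>auto simp: c_def\<close>)
    have c_b: "ksgn v A (c (insert v A)) = \<beta> A" if "v \<notin> A" for A
      using that by (simp add: c_def insert_Diff_if)
    have c_b': "bd (W - {v}) (\<lambda>A. ksgn v A (c (insert v A))) A = bd (W - {v}) \<beta> A" if "A \<subseteq> W - {v}" for A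
    proof -
      have "ksgn v (insert x A) (c (insert v (insert x A))) = \<beta> (insert x A)" if "x \<in> W - {v} - A" for x
        by (rule c_b) (use that \<open>A \<subseteq> W - {v}\<close> in auto)
      then show ?thesis unfolding bd_def by (intro sum.cong) auto
    qed
    have "bd W c A = 0" if A: "A \<subseteq> W" "Suc (card A) = Suc k" "R A" for A
    proof (cases "v \<in> A")
      case False
      then have A': "A \<subseteq> W - {v}" using A by auto
      then show ?thesis using bd_del[OF A', of c] c_g[OF A'] c_b[OF False] g[OF A'] A by simp
    next
      case True
      define B where "B = A - {v}"
      have B: "B \<subseteq> W - {v}" "insert v B = A" "Suc (card B) = k"
        using True A W finite_subset[OF A(1)] card_Suc_Diff1[of A v] by (auto simp: B_def)
      show ?thesis using bd_ins[OF B(1), of c] c_b'[OF B(1)] cyc[OF B(1,3)] B(2) A(3) by simp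
    qed
    then obtain b where b: "\<And>A. A \<subseteq> W \<Longrightarrow> card A = Suc k \<Longrightarrow> R A \<Longrightarrow> c A = bd W b A"
      using exact_atE[OF W_ex, of c] by blast
    have "\<beta> A = bd (W - {v}) (\<lambda>A. - ksgn v A (b (insert v A))) A"
      if A: "A \<subseteq> W - {v}" "card A = k" "R (insert v A)" for A
    proof -
      have "finite A" using W A(1) finite_subset by blast
      then have "card (insert v A) = Suc k" using A by (subst card_insert_disjoint) auto
      then have "c (insert v A) = bd W b (insert v A)" using b[of "insert v A"] A W by auto
      moreover have "v \<notin> A" using A by auto
      ultimately show ?thesis using c_b[of A] bd_ins[OF A(1), of b] by (simp add: bd_minus)
    qed
    then show "\<exists>b. \<forall>A\<subseteq>W - {v}. card A = k \<longrightarrow> R (insert v A) \<longrightarrow> \<beta> A = bd (W - {v}) b A"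
      by blast
  qed
qed (intro exact_at_split ex, auto)

end

text \<open>The hypothesis makes the complex a cone with apex \<open>v\<close>. The bounding chain
  is \<open>c\<close> itself, transported to the sets containing \<open>v\<close>.\<close>

lemma exact_at_cone:
  assumes cone: "\<And>A. A \<subseteq> W - {v} \<Longrightarrow> R (insert v A) \<longleftrightarrow> R A"
  shows "exact_at TYPE('k::field) W R i"
proof (rule exact_atI)
  fix c :: "'v set \<Rightarrow> 'k"
  assume cyc: "\<And>A. A \<subseteq> W \<Longrightarrow> Suc (card A) = i \<Longrightarrow> R A \<Longrightarrow> bd W c A = 0"
  have "bd (W - {v}) c A = - ksgn v A (c (insert v A))"
    if "A \<subseteq> W - {v}" "Suc (card A) = i" "R (insert v A)" for A
    by (rule cycle_parts(1)[OF _ cyc]) (use that cone in auto)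
  then show "\<exists>b. \<forall>A\<subseteq>W. card A = i \<longrightarrow> R A \<longrightarrow> c A = bd W b A"
    by (intro exact_at_glue[where ?b0.0 = "\<lambda>_. 0" and ?b1.0 = c]) simp_all
qed

end

section \<open>Independence complexes of graphs: cones, folds and isolated edges\<close>

locale sgraph =
  fixes adj :: "'v::linorder \<Rightarrow> 'v \<Rightarrow> bool"
  assumes adj_sym: "adj u v \<Longrightarrow> adj v u" and adj_irrefl: "\<not> adj v v"
begin

definition indep :: "'v set \<Rightarrow> bool" where
  "indep S \<longleftrightarrow> (\<forall>u\<in>S. \<forall>v\<in>S. \<not> adj u v)"

text \<open>By Hochster's formula this is the vanishing of the reduced cohomology of the
  independence complex of \<open>W\<close> in degree \<open>card W - i - 1\<close>.\<close>

definition ex_indep :: "'k::field itself \<Rightarrow> 'v set \<Rightarrow> nat \<Rightarrow> bool" where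
  "ex_indep k W i \<longleftrightarrow> exact_at k W (\<lambda>A. indep (W - A)) i"

lemma indep_mono: "indep S \<Longrightarrow> T \<subseteq> S \<Longrightarrow> indep T"
  unfolding indep_def by blast

lemma indep_Diff_insert: "indep (W - A) \<Longrightarrow> indep (W - insert v A)"
  by (erule indep_mono) auto

lemma ex_indep_Diff:
  "exact_at TYPE('k::field) (W - {v}) (\<lambda>A. indep (W - insert v A)) i \<longleftrightarrow> ex_indep TYPE('k) (W - {v}) i"
  unfolding ex_indep_def by (rule exact_at_cong, rule arg_cong[where f = indep]) blast

lemma indep_insert: "indep (insert v S) \<longleftrightarrow> indep S \<and> (\<forall>u\<in>S. \<not> adj v u)"
  unfolding indep_def using adj_sym adj_irrefl by blast

lemma ex_indep_isolated:
  assumes "finite W" "v \<in> W" "\<And>u. u \<in> W \<Longrightarrow> \<not> adj v u"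
  shows "ex_indep TYPE('k::field) W i"
  unfolding ex_indep_def
proof (rule exact_at_cone[OF assms(1,2)])
  fix A assume A: "A \<subseteq> W - {v}"
  then have "W - A = insert v (W - insert v A)" using assms by auto
  then show "indep (W - insert v A) \<longleftrightarrow> indep (W - A)"
    using assms(3) by (simp add: indep_insert)
qed

lemma ex_indep_0: "finite W \<Longrightarrow> W \<noteq> {} \<Longrightarrow> ex_indep TYPE('k::field) W 0"
  unfolding ex_indep_def by (rule exact_at_0)

text \<open>The one surviving class is the unit of the quotient ring; every nonvanishing computation
  below is reduced to it.\<close>

lemma ex_indep_empty: "ex_indep TYPE('k::field) {} i \<longleftrightarrow> i > 0"
proof
  assume ex: "ex_indep TYPE('k) {} i"
  show "i > 0"
  proof (rule ccontr)
    assume "\<not> i > 0"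
    then have "exact_at TYPE('k) ({}::'v set) (\<lambda>A. indep ({} - A)) 0" using ex by (simp add: ex_indep_def)
    then obtain b :: "'v set \<Rightarrow> 'k" where "\<And>A. A \<subseteq> {} \<Longrightarrow> card A = 0 \<Longrightarrow> indep ({} - A) \<Longrightarrow> 1 = bd {} b A"
      by (rule exact_atE[where c = "\<lambda>_. 1"]) auto
    from this[of "{}"] show False by (simp add: bd_def indep_def)
  qed
qed (auto simp: ex_indep_def exact_at_def)

text \<open>All neighbours of \<open>u\<close> are neighbours of \<open>v\<close>, so none of them
  occurs in the link of \<open>v\<close>. That link is therefore a cone with apex \<open>u\<close>,
  and only the deletion of \<open>v\<close> matters.\<close>

lemma ex_indep_fold:
  assumes W: "finite W" "u \<in> W" "v \<in> W" "u \<noteq> v" "\<not> adj u v"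
    and dom: "\<And>w. w \<in> W \<Longrightarrow> adj u w \<Longrightarrow> adj v w"
  shows "ex_indep TYPE('k::field) W (Suc i) \<longleftrightarrow> ex_indep TYPE('k) (W - {v}) i"
proof -
  have "exact_at TYPE('k) (W - {v}) (\<lambda>A. indep (W - A)) k" for k
  proof (rule exact_at_cone[of _ u])
    fix A assume A: "A \<subseteq> W - {v} - {u}"
    then have "W - A = insert u (W - insert u A)" using W by auto
    moreover have "\<not> adj u w" if "indep (W - insert u A)" "w \<in> W - insert u A" for w
    proof
      assume "adj u w"
      then have "adj v w" using dom that(2) by blast
      moreover have "v \<in> W - insert u A" using A W by auto
      ultimately show False using that unfolding indep_def by blast
    qed
    ultimately show "indep (W - insert u A) \<longleftrightarrow> indep (W - A)" by (auto simp: indep_insert)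
  qed (use W in simp_all)
  note link = this
  have "ex_indep TYPE('k) W (Suc i) \<longleftrightarrow> exact_at TYPE('k) (W - {v}) (\<lambda>A. indep (W - insert v A)) i"
    unfolding ex_indep_def
    by (rule exact_at_link[where R = "\<lambda>A. indep (W - A)", OF W(1,3) _ link]) (rule indep_Diff_insert)
  also have "\<dots> \<longleftrightarrow> ex_indep TYPE('k) (W - {v}) i"
    by (rule ex_indep_Diff)
  finally show ?thesis .
qed

lemma ex_indep_fold_set:
  assumes "finite T" "finite W" "u \<in> W" "T \<subseteq> W - {u}"
    and "\<And>t. t \<in> T \<Longrightarrow> \<not> adj u t"
    and "\<And>t w. t \<in> T \<Longrightarrow> w \<in> W \<Longrightarrow> adj u w \<Longrightarrow> adj t w"
  shows "ex_indep TYPE('k::field) W (i + card T) \<longleftrightarrow> ex_indep TYPE('k) (W - T) i"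
  using assms
proof (induction T arbitrary: W rule: finite_induct)
  case (insert t T)
  have "ex_indep TYPE('k) W (Suc (i + card T)) \<longleftrightarrow> ex_indep TYPE('k) (W - {t}) (i + card T)"
    by (rule ex_indep_fold[of _ u]) (use insert.prems in auto)
  also have "\<dots> \<longleftrightarrow> ex_indep TYPE('k) (W - {t} - T) i"
    by (rule insert.IH) (use insert.prems insert.hyps in auto)
  also have "W - {t} - T = W - insert t T" by blast
  finally show ?case using insert.hyps by simp
qed simp

text \<open>Folding away only \<open>i\<close> of the vertices in \<open>T\<close> already leads to
  exterior degree 0, and the vertex set left over still contains \<open>u\<close>.\<close>

lemma ex_indep_fold_low:
  assumes "finite T" "finite W" "u \<in> W" "T \<subseteq> W - {u}"
    and "\<And>t. t \<in> T \<Longrightarrow> \<not> adj u t"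
    and "\<And>t w. t \<in> T \<Longrightarrow> w \<in> W \<Longrightarrow> adj u w \<Longrightarrow> adj t w"
    and "i \<le> card T"
  shows "ex_indep TYPE('k::field) W i"
proof -
  obtain T' where T': "T' \<subseteq> T" "card T' = i"
    using obtain_subset_with_card_n[OF assms(7)] by metis
  have "ex_indep TYPE('k) W (0 + card T') \<longleftrightarrow> ex_indep TYPE('k) (W - T') 0"
    by (rule ex_indep_fold_set[of _ _ u]) (use assms T' finite_subset in auto)
  moreover have "ex_indep TYPE('k) (W - T') 0"
    by (rule ex_indep_0) (use assms T' in auto)
  ultimately show ?thesis using T' by simp
qed

text \<open>An isolated edge is a suspension. Deleting \<open>v\<close> leaves \<open>u\<close>
  isolated, hence a cone, so the link of \<open>v\<close> decides. Two variables go for one exterior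
  degree, so the row drops by one.\<close>

lemma ex_indep_edge:
  assumes W: "finite W" "u \<in> W" "v \<in> W" "adj u v"
    and nbr: "\<And>w. w \<in> W \<Longrightarrow> adj u w \<longleftrightarrow> w = v" "\<And>w. w \<in> W \<Longrightarrow> adj v w \<longleftrightarrow> w = u"
  shows "ex_indep TYPE('k::field) W (Suc i) \<longleftrightarrow> ex_indep TYPE('k) (W - {u, v}) i"
proof -
  have uv: "u \<noteq> v" using W(4) adj_irrefl[of u] by metis
  have "ex_indep TYPE('k) (W - {v}) k" for k
  proof (rule ex_indep_isolated[of _ u])
    show "\<not> adj u w" if "w \<in> W - {v}" for w using that nbr(1) by blast
  qed (use W uv in simp_all)
  then have "exact_at TYPE('k) (W - {v}) (\<lambda>A. indep (W - insert v A)) k" for k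
    by (simp only: ex_indep_Diff)
  note del = this
  have "ex_indep TYPE('k) W (Suc i) \<longleftrightarrow> exact_at TYPE('k) (W - {v}) (\<lambda>A. indep (W - A)) (Suc i)"
    unfolding ex_indep_def
    by (rule exact_at_del[where R = "\<lambda>A. indep (W - A)", OF W(1,3) _ del]) (rule indep_Diff_insert)
  also have "\<dots> \<longleftrightarrow> exact_at TYPE('k) (W - {v} - {u}) (\<lambda>A. indep (W - insert u A)) i"
  proof (rule exact_at_link[where R = "\<lambda>A. indep (W - A)"])
    \<comment> \<open>Here the complement contains both ends of the edge and is never
      independent.\<close>
    show "exact_at TYPE('k) (W - {v} - {u}) (\<lambda>A. indep (W - A)) k" for k
      by (rule exact_at_none) (use W in \<open>auto simp: indep_def\<close>)
  qed (use W uv indep_Diff_insert in simp_all)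
  also have "\<dots> \<longleftrightarrow> ex_indep TYPE('k) (W - {u, v}) i"
  proof -
    have "indep (W - insert u A) \<longleftrightarrow> indep (W - {u, v} - A)" if "A \<subseteq> W - {v} - {u}" for A
    proof -
      have "W - insert u A = insert v (W - {u, v} - A)" using W uv that by auto
      then show ?thesis using nbr(2) by (auto simp: indep_insert)
    qed
    then have "exact_at TYPE('k) (W - {v} - {u}) (\<lambda>A. indep (W - insert u A)) i
        \<longleftrightarrow> exact_at TYPE('k) (W - {v} - {u}) (\<lambda>A. indep (W - {u, v} - A)) i"
      by (rule exact_at_cong)
    moreover have "W - {v} - {u} = W - {u, v}" by blast
    ultimately show ?thesis unfolding ex_indep_def by argo
  qed
  finally show ?thesis .
qed

end

section \<open>Initial graphs of closed graphs\<close>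

text \<open>The order on the variables serves the signs of the Koszul differential; it is unrelated
  to the order of terms in the degeneration.\<close>

fun xy_index :: "xy_var \<Rightarrow> nat" where
  "xy_index (XV i) = 2 * i"
| "xy_index (YV i) = 2 * i + 1"

lemma xy_index_inj: "xy_index u = xy_index v \<Longrightarrow> u = v"
  by (cases u; cases v) (auto, presburger+)

instantiation xy_var :: linorder
begin

definition less_eq_xy_var :: "xy_var \<Rightarrow> xy_var \<Rightarrow> bool" where
  "less_eq_xy_var u v \<longleftrightarrow> xy_index u \<le> xy_index v"

definition less_xy_var :: "xy_var \<Rightarrow> xy_var \<Rightarrow> bool" where
  "less_xy_var u v \<longleftrightarrow> xy_index u < xy_index v"

instance
  by standard (auto simp: less_eq_xy_var_def less_xy_var_def intro: xy_index_inj)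

end

text \<open>
  A closed graph is given by the function \<open>far\<close> mapping \<open>i\<close> to the largest vertex of the cliques
  that contain \<open>i\<close>.  The initial ideal of its binomial edge ideal is the edge ideal of the
  bipartite graph with edges \<open>{x\<^sub>i, y\<^sub>j}\<close> for \<open>i < j \<le> far i\<close>.
\<close>

locale closed_graph =
  fixes far :: "nat \<Rightarrow> nat"
  assumes far_mono: "i \<le> j \<Longrightarrow> far i \<le> far j"
begin

fun adj :: "xy_var \<Rightarrow> xy_var \<Rightarrow> bool" where
  "adj (XV i) (YV j) \<longleftrightarrow> i < j \<and> j \<le> far i"
| "adj (YV j) (XV i) \<longleftrightarrow> i < j \<and> j \<le> far i"
| "adj _ _ \<longleftrightarrow> False"

lemma adj_XV: "adj (XV i) w \<longleftrightarrow> (\<exists>j. w = YV j \<and> i < j \<and> j \<le> far i)"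
  by (cases w) auto

lemma adj_YV: "adj (YV j) w \<longleftrightarrow> (\<exists>i. w = XV i \<and> i < j \<and> j \<le> far i)"
  by (cases w) auto

lemma adj_commute: "adj u v \<longleftrightarrow> adj v u"
  by (cases u; cases v) auto

lemma not_adj_self: "\<not> adj v v"
  by (cases v) auto

end

sublocale closed_graph \<subseteq> sgraph adj
  by standard (simp_all add: adj_commute not_adj_self)

context closed_graph
begin

text \<open>What the corner \<open>(a, b)\<close> leaves over. A later corner
  \<open>(a', b')\<close> thus satisfies \<open>b \<le> a'\<close> and
  \<open>far a < b'\<close>.\<close>

abbreviation corner_rest :: "xy_var set \<Rightarrow> nat \<Rightarrow> nat \<Rightarrow> xy_var set" where
  "corner_rest W a b \<equiv> W \<inter> (XV ` {b..} \<union> YV ` {far a<..})"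

text \<open>
  If \<open>x\<^sub>a\<close> and \<open>y\<^sub>b\<close> are adjacent and \<open>a\<close>, \<open>b\<close> are minimal, then the \<open>x\<^sub>k\<close> with \<open>a < k < b\<close> are
  dominated by \<open>x\<^sub>a\<close> and the \<open>y\<^sub>k\<close> with \<open>b < k \<le> far a\<close> by \<open>y\<^sub>b\<close>.  After they are folded away,
  \<open>{x\<^sub>a, y\<^sub>b}\<close> is an isolated edge.
\<close>

lemma ex_indep_corner:
  assumes W: "finite W" "W \<subseteq> XV ` {a..} \<union> YV ` {b..}" "XV a \<in> W" "YV b \<in> W"
    and ab: "a < b" "b \<le> far a"
  obtains k where "card W = card (corner_rest W a b) + k + 2" "k + 1 \<le> far a - a"
    "\<And>i. ex_indep TYPE('k::field) W (i + k + 1) \<longleftrightarrow> ex_indep TYPE('k) (corner_rest W a b) i"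
    "\<And>i. i \<le> k \<Longrightarrow> ex_indep TYPE('k) W i"
proof -
  define Tx where "Tx = W \<inter> XV ` {a<..<b}"
  define Ty where "Ty = W \<inter> YV ` {b<..far a}"
  have fin: "finite Tx" "finite Ty" using W by (auto simp: Tx_def Ty_def)
  have eq: "W - Tx - Ty - {XV a, YV b} = corner_rest W a b"
  proof (rule Set.set_eqI)
    fix w show "w \<in> W - Tx - Ty - {XV a, YV b} \<longleftrightarrow> w \<in> corner_rest W a b"
    proof (cases w)
      case (XV i)
      have "XV i \<in> W \<Longrightarrow> a \<le> i" using W by auto
      then show ?thesis using XV ab by (auto simp: Tx_def Ty_def image_iff)
    next
      case (YV j)
      have "YV j \<in> W \<Longrightarrow> b \<le> j" using W by auto
      then show ?thesis using YV ab by (auto simp: Tx_def Ty_def image_iff)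
    qed
  qed
  have dom_x: "adj t w" if t: "t \<in> Tx" and w: "w \<in> W" "adj (XV a) w" for t w
  proof -
    obtain k where k: "t = XV k" "a < k" "k < b" using t by (auto simp: Tx_def)
    obtain j where j: "w = YV j" "a < j" "j \<le> far a" using w adj_XV by blast
    have "b \<le> j" using W(2) w(1) j(1) by auto
    then show ?thesis using k j far_mono[of a k] by auto
  qed
  have dom_y: "adj t w" if t: "t \<in> Ty" and w: "w \<in> W - Tx" "adj (YV b) w" for t w
  proof -
    obtain k where k: "t = YV k" "b < k" "k \<le> far a" using t by (auto simp: Ty_def)
    obtain i where i: "w = XV i" "i < b" "b \<le> far i" using w adj_YV by blast
    have "a \<le> i" using W(2) w(1) i(1) by auto
    then show ?thesis using k i far_mono[of a i] by auto
  qed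
  have x: "Tx \<subseteq> W - {XV a}" "\<And>t. t \<in> Tx \<Longrightarrow> \<not> adj (XV a) t" by (auto simp: Tx_def)
  have y: "finite (W - Tx)" "YV b \<in> W - Tx" "Ty \<subseteq> W - Tx - {YV b}" "\<And>t. t \<in> Ty \<Longrightarrow> \<not> adj (YV b) t"
    using W by (auto simp: Tx_def Ty_def)
  have fold_x: "ex_indep TYPE('k) W (i + card Tx) \<longleftrightarrow> ex_indep TYPE('k) (W - Tx) i"
    and low_x: "i \<le> card Tx \<Longrightarrow> ex_indep TYPE('k) W i" for i
    by (rule ex_indep_fold_set[OF fin(1) W(1,3) x dom_x], assumption+)
      (rule ex_indep_fold_low[OF fin(1) W(1,3) x dom_x], assumption+)
  have fold_y: "ex_indep TYPE('k) (W - Tx) (i + card Ty) \<longleftrightarrow> ex_indep TYPE('k) (W - Tx - Ty) i"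
    and low_y: "i \<le> card Ty \<Longrightarrow> ex_indep TYPE('k) (W - Tx) i" for i
    by (rule ex_indep_fold_set[OF fin(2) y dom_y], assumption+)
      (rule ex_indep_fold_low[OF fin(2) y dom_y], assumption+)
  have edge: "ex_indep TYPE('k) (W - Tx - Ty) (Suc i)
      \<longleftrightarrow> ex_indep TYPE('k) (W - Tx - Ty - {XV a, YV b}) i" for i
  proof (rule ex_indep_edge)
    show "adj (XV a) (YV b)" using ab by simp
    show "adj (XV a) w \<longleftrightarrow> w = YV b" if w: "w \<in> W - Tx - Ty" for w
    proof (cases w)
      case (YV j)
      have "b \<le> j" using W(2) w YV by auto
      moreover have "\<not> (b < j \<and> j \<le> far a)" using w YV by (auto simp: Ty_def)
      ultimately show ?thesis using YV ab by auto
    qed simp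
    show "adj (YV b) w \<longleftrightarrow> w = XV a" if w: "w \<in> W - Tx - Ty" for w
    proof (cases w)
      case (XV i)
      have "a \<le> i" using W(2) w XV by auto
      moreover have "\<not> (a < i \<and> i < b)" using w XV by (auto simp: Tx_def)
      ultimately show ?thesis using XV ab by auto
    qed simp
  qed (use W in \<open>auto simp: Tx_def Ty_def\<close>)
  have "card Tx \<le> card (XV ` {a<..<b})" "card Ty \<le> card (YV ` {b<..far a})"
    by (auto simp: Tx_def Ty_def intro!: card_mono)
  moreover have "card (XV ` {a<..<b}) \<le> b - a - 1" "card (YV ` {b<..far a}) \<le> far a - b"
    using card_image_le[of "{a<..<b}" XV] card_image_le[of "{b<..far a}" YV] by auto
  \<comment> \<open>There are \<open>b - a - 1\<close> indices strictly between \<open>a\<close> and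
    \<open>b\<close> and \<open>far a - b\<close> beyond \<open>b\<close>; the isolated edge adds
    one.\<close>
  ultimately have le: "card Tx + card Ty + 1 \<le> far a - a" using ab by linarith
  have "W = corner_rest W a b \<union> (Tx \<union> Ty \<union> {XV a, YV b})"
    using eq W by (auto simp: Tx_def Ty_def)
  moreover have "card (corner_rest W a b \<union> (Tx \<union> Ty \<union> {XV a, YV b}))
      = card (corner_rest W a b) + card (Tx \<union> Ty \<union> {XV a, YV b})"
    by (rule card_Un_disjoint) (use W fin eq in auto)
  moreover have "card (Tx \<union> Ty \<union> {XV a, YV b}) = card (Tx \<union> Ty) + card {XV a, YV b}"
    by (rule card_Un_disjoint) (use fin ab in \<open>auto simp: Tx_def Ty_def\<close>)
  moreover have "card (Tx \<union> Ty) = card Tx + card Ty"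
    by (rule card_Un_disjoint) (use fin in \<open>auto simp: Tx_def Ty_def\<close>)
  ultimately have "card W = card (corner_rest W a b) + (card Tx + card Ty) + 2" by simp
  moreover have "ex_indep TYPE('k) W (i + (card Tx + card Ty) + 1)
      \<longleftrightarrow> ex_indep TYPE('k) (corner_rest W a b) i" for i
    using fold_x[of "Suc i + card Ty"] fold_y[of "Suc i"] edge[of i] unfolding eq
    by (simp add: ac_simps)
  moreover have "ex_indep TYPE('k) W i" if "i \<le> card Tx + card Ty" for i
  proof (cases "i \<le> card Tx")
    case False
    then have "ex_indep TYPE('k) (W - Tx) (i - card Tx)" using that by (intro low_y) simp
    then show ?thesis using fold_x[of "i - card Tx"] False by simp
  qed (rule low_x)
  ultimately show ?thesis using that[of "card Tx + card Ty"] le by blast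
qed

text \<open>
  A nonzero class in exterior degree \<open>i\<close> and row \<open>r\<close> comes from a sequence of \<open>r\<close> corners, and the
  corner \<open>(a, b)\<close> contributes at most \<open>far a - a\<close> to \<open>i\<close>.
\<close>

primrec corner_bound :: "nat \<Rightarrow> nat \<Rightarrow> nat \<Rightarrow> nat \<Rightarrow> bool" where
  "corner_bound 0 a b i \<longleftrightarrow> i = 0"
| "corner_bound (Suc r) a b i \<longleftrightarrow> (\<exists>a'\<ge>a. \<exists>b'\<ge>b. a' < b' \<and> b' \<le> far a' \<and>
     (\<exists>i'. corner_bound r b' (Suc (far a')) i' \<and> i \<le> i' + (far a' - a')))"

text \<open>Nonvanishing excludes isolated vertices, so the smallest \<open>x\<close> and the
  smallest \<open>y\<close> in \<open>W\<close> form a corner. Removing it takes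
  \<open>k + 2\<close> variables and lowers \<open>i\<close> by \<open>k + 1\<close>, so the row
  \<open>card W - i\<close> drops by exactly one.\<close>

lemma not_ex_indep_imp_corner_bound:
  assumes "finite W" "W \<subseteq> XV ` {a..} \<union> YV ` {b..}" "\<not> ex_indep TYPE('k::field) W i"
  shows "\<exists>r. card W = i + r \<and> corner_bound r a b i"
  using assms
proof (induction "card W" arbitrary: W a b i rule: less_induct)
  case less
  show ?case
  proof (cases "W = {}")
    case True
    then show ?thesis using less.prems ex_indep_empty[where 'k = 'k, of i] by auto
  next
    case False
    have iso: "\<exists>u\<in>W. adj v u" if "v \<in> W" for v
      using ex_indep_isolated[OF less.prems(1) that] less.prems(3) by blast
    define X Y where "X = {i. XV i \<in> W}" and "Y = {j. YV j \<in> W}"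
    have "finite X" "finite Y"
      using finite_vimageI[OF less.prems(1), of XV] finite_vimageI[OF less.prems(1), of YV]
      by (auto simp: X_def Y_def vimage_def inj_on_def)
    obtain v u where vu: "v \<in> W" "u \<in> W" "adj v u" using False iso by blast
    have "X \<noteq> {} \<and> Y \<noteq> {}"
      using vu by (cases v; cases u) (auto simp: X_def Y_def)
    define a' b' where "a' = Min X" and "b' = Min Y"
    have a': "XV a' \<in> W" and b': "YV b' \<in> W"
      using Min_in[of X] Min_in[of Y] \<open>finite X\<close> \<open>finite Y\<close> \<open>X \<noteq> {} \<and> Y \<noteq> {}\<close>
      by (auto simp: a'_def b'_def X_def Y_def)
    have min: "XV i \<in> W \<Longrightarrow> a' \<le> i" "YV j \<in> W \<Longrightarrow> b' \<le> j" for i j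
      using \<open>finite X\<close> \<open>finite Y\<close> by (auto simp: a'_def b'_def X_def Y_def)
    have sub: "W \<subseteq> XV ` {a'..} \<union> YV ` {b'..}"
    proof
      fix w assume "w \<in> W"
      then show "w \<in> XV ` {a'..} \<union> YV ` {b'..}" using min by (cases w) auto
    qed
    have ge: "a' \<ge> a" "b' \<ge> b" using a' b' less.prems(2) by auto
    obtain j where j: "YV j \<in> W" "a' < j" "j \<le> far a'"
      using iso[OF a'] by (auto simp: adj_XV)
    obtain l where l: "XV l \<in> W" "l < b'" "b' \<le> far l"
      using iso[OF b'] by (auto simp: adj_YV)
    \<comment> \<open>The neighbour \<open>YV j\<close> gives
      \<open>b' \<le> j \<le> far a'\<close>, and the neighbour \<open>XV l\<close> gives
      \<open>a' \<le> l < b'\<close>: the two minima are adjacent.\<close>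
    have ab: "a' < b'" "b' \<le> far a'" using min(2)[OF j(1)] min(1)[OF l(1)] j l by auto
    obtain k where k: "card W = card (corner_rest W a' b') + k + 2" "k + 1 \<le> far a' - a'"
      "\<And>i. ex_indep TYPE('k::field) W (i + k + 1) \<longleftrightarrow> ex_indep TYPE('k) (corner_rest W a' b') i"
      "\<And>i. i \<le> k \<Longrightarrow> ex_indep TYPE('k) W i"
      using ex_indep_corner[OF less.prems(1) sub a' b' ab] by blast
    show ?thesis
    proof (cases "i \<ge> k + 1")
      case True
      define i' where "i' = i - (k + 1)"
      have i': "i = i' + k + 1" using True by (simp add: i'_def)
      have "\<exists>r. card (corner_rest W a' b') = i' + r \<and> corner_bound r b' (Suc (far a')) i'"
      proof (rule less.hyps)
        show "\<not> ex_indep TYPE('k) (corner_rest W a' b') i'" using k(3) less.prems(3) i' by blast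
      qed (use k less.prems in auto)
      then obtain r where "card (corner_rest W a' b') = i' + r" "corner_bound r b' (Suc (far a')) i'"
        by blast
      then have "corner_bound (Suc r) a b i"
        unfolding corner_bound.simps
        by (intro exI[of _ a'] exI[of _ b'] exI[of _ i'] conjI) (use k(2) ge ab i' in simp_all)
      then show ?thesis using k(1) \<open>card _ = i' + r\<close> i' by (intro exI[of _ "Suc r"]) simp
    next
      case False
      then show ?thesis using k(4)[of i] less.prems(3) by simp
    qed
  qed
qed

end

text \<open>The right end of the last clique through \<open>i\<close>. Outside the vertex set the
  function is continued by constants, which keeps it monotone.\<close>

definition far0 :: "nat \<Rightarrow> nat" where
  "far0 i = (if i \<le> 1 then 3 else if i \<le> 2 then 5 else if i \<le> 3 then 9
     else if i \<le> 8 then 14 else if i \<le> 9 then 15 else 17)"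

interpretation G0: closed_graph far0
  by standard (simp add: far0_def)

lemma far0_cases:
  "i \<le> 1 \<and> far0 i = 3 \<or> i = 2 \<and> far0 i = 5 \<or> i = 3 \<and> far0 i = 9 \<or>
   4 \<le> i \<and> i \<le> 8 \<and> far0 i = 14 \<or> i = 9 \<and> far0 i = 15 \<or> 10 \<le> i \<and> far0 i = 17"
  by (auto simp: far0_def)

lemma G0_edge_iff_far0:
  assumes "1 \<le> i" "i < j" "j \<le> 17"
  shows "{i, j} \<in> G0 \<longleftrightarrow> j \<le> far0 i"
proof -
  have "{i, j} \<in> G0 \<longleftrightarrow> (i \<in> {1..3} \<and> j \<in> {1..3}) \<or> (i \<in> {2..5} \<and> j \<in> {2..5}) \<or>
    (i \<in> {3..9} \<and> j \<in> {3..9}) \<or> (i \<in> {4..14} \<and> j \<in> {4..14}) \<or>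
    (i \<in> {9..15} \<and> j \<in> {9..15}) \<or> (i \<in> {10..17} \<and> j \<in> {10..17})"
    using assms G0_edge_iff[of i j] by (simp add: G0_cliques_def)
  also have "\<dots> \<longleftrightarrow> j \<le> far0 i"
    using far0_cases[of i] assms unfolding atLeastAtMost_iff by (elim disjE conjE; presburger)
  finally show ?thesis .
qed

text \<open>The third corner starts past \<open>far0 a1\<close>, hence at 4 or later, so its value
  of \<open>far0\<close> is at least 14; the fifth corner must exceed the value of the fourth, which
  is therefore at most 15. This pins the fourth corner to 9 and, going back, the first two to 2 and
  1.\<close>

lemma far0_chain:
  assumes "1 \<le> a1" "a1 < b1" "b1 \<le> far0 a1"
    "b1 \<le> a2" "far0 a1 < b2" "a2 < b2" "b2 \<le> far0 a2"
    "b2 \<le> a3" "far0 a2 < b3" "a3 < b3" "b3 \<le> far0 a3"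
    "b3 \<le> a4" "far0 a3 < b4" "a4 < b4" "b4 \<le> far0 a4"
    "b4 \<le> a5" "far0 a4 < b5" "a5 < b5" "b5 \<le> far0 a5"
  shows "a1 = 1 \<and> a2 = 2 \<and> 4 \<le> a3 \<and> a3 \<le> 8 \<and> a4 = 9 \<and> 15 \<le> a5"
proof -
  have lt: "far0 a < 17 \<Longrightarrow> a \<le> 9" "far0 a < 15 \<Longrightarrow> a \<le> 8" "far0 a < 9 \<Longrightarrow> a \<le> 2" "far0 a < 5 \<Longrightarrow> a \<le> 1"
    and le: "far0 a \<le> 17" "a \<le> 9 \<Longrightarrow> far0 a \<le> 15" "a \<le> 8 \<Longrightarrow> far0 a \<le> 14" "a \<le> 2 \<Longrightarrow> far0 a \<le> 5"
    and ge: "far0 a \<ge> 3" "4 \<le> a \<Longrightarrow> 14 \<le> far0 a" "14 < far0 a \<Longrightarrow> 9 \<le> a" for a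
    by (auto simp: far0_def split: if_splits)
  have "a4 \<le> 9" using lt(1)[of a4] le(1)[of a5] assms by linarith
  then have "a3 \<le> 8" using lt(2)[of a3] le(2)[of a4] assms by linarith
  have "4 \<le> a3" using ge(1)[of a1] assms by linarith
  then have "14 \<le> far0 a3" by (rule ge)
  then have "9 \<le> a4" using ge(3)[of a4] assms by linarith
  then have "a4 = 9" using \<open>a4 \<le> 9\<close> by simp
  then have "a2 \<le> 2" using lt(3)[of a2] assms by linarith
  then have "a1 \<le> 1" using lt(4)[of a1] le(4)[of a2] assms by linarith
  then show ?thesis
    using \<open>a2 \<le> 2\<close> \<open>4 \<le> a3\<close> \<open>a3 \<le> 8\<close> \<open>a4 = 9\<close> \<open>14 \<le> far0 a3\<close> assms by linarith
qed

text \<open>Naming the truncated difference \<open>far0 a' - a'\<close> as \<open>d\<close> leaves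
  only linear arithmetic for the bounds below.\<close>

lemma corner_bound_Suc:
  assumes "G0.corner_bound (Suc r) a b i"
  obtains a' b' i' d where "a \<le> a'" "b \<le> b'" "a' < b'" "b' \<le> far0 a'" "far0 a' = d + a'"
    "G0.corner_bound r b' (Suc (far0 a')) i'" "i \<le> i' + d"
proof -
  from assms obtain a' b' i' where *: "a \<le> a'" "b \<le> b'" "a' < b'" "b' \<le> far0 a'"
    "G0.corner_bound r b' (Suc (far0 a')) i'" "i \<le> i' + (far0 a' - a')" by auto
  show ?thesis by (rule that[of a' b' "far0 a' - a'" i']) (use * in auto)
qed

text \<open>The maximum 2 + 6 + 10 + 7 is attained by corners starting at 1, 3, 4 and 10. It is
  found by distinguishing the constant pieces of \<open>far0\<close> for each corner.\<close>

lemma corner_bound_far0_le_4: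
  assumes "r \<le> 4" "G0.corner_bound r 1 2 i"
  shows "i \<le> 25"
proof -
  consider "r = 0" | "r = 1" | "r = 2" | "r = 3" | "r = 4" using assms(1) by linarith
  then show ?thesis
  proof cases
    case 1
    then show ?thesis using assms(2) by simp
  next
    case 2
    then have c: "G0.corner_bound (Suc 0) 1 2 i" using assms(2) by simp
    from c obtain a1 b1 d1 i1 where 1: "1 \<le> a1" "2 \<le> b1" "a1 < b1" "b1 \<le> far0 a1" "far0 a1 = d1 + a1"
      "G0.corner_bound 0 b1 (Suc (far0 a1)) i1" "i \<le> i1 + d1" by (rule corner_bound_Suc)
    then show ?thesis using far0_cases[of a1] by auto
  next
    case 3
    then have c: "G0.corner_bound (Suc (Suc 0)) 1 2 i" using assms(2) by (simp only: numeral_2_eq_2)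
    from c obtain a1 b1 d1 i1 where 1: "1 \<le> a1" "2 \<le> b1" "a1 < b1" "b1 \<le> far0 a1" "far0 a1 = d1 + a1"
      "G0.corner_bound (Suc 0) b1 (Suc (far0 a1)) i1" "i \<le> i1 + d1" by (rule corner_bound_Suc)
    from 1(6) obtain a2 b2 d2 i2 where 2: "b1 \<le> a2" "Suc (far0 a1) \<le> b2" "a2 < b2" "b2 \<le> far0 a2" "far0 a2 = d2 + a2"
      "G0.corner_bound 0 b2 (Suc (far0 a2)) i2" "i1 \<le> i2 + d2" by (rule corner_bound_Suc)
    have "i2 = 0" using 2(6) by simp
    then show ?thesis using far0_cases[of a1] far0_cases[of a2] 1(1-5,7) 2(1-5,7)
      by (elim disjE conjE; linarith)
  next
    case 4
    then have c: "G0.corner_bound (Suc (Suc (Suc 0))) 1 2 i" using assms(2) by (simp only: numeral_3_eq_3)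
    from c obtain a1 b1 d1 i1 where 1: "1 \<le> a1" "2 \<le> b1" "a1 < b1" "b1 \<le> far0 a1" "far0 a1 = d1 + a1"
      "G0.corner_bound (Suc (Suc 0)) b1 (Suc (far0 a1)) i1" "i \<le> i1 + d1" by (rule corner_bound_Suc)
    from 1(6) obtain a2 b2 d2 i2 where 2: "b1 \<le> a2" "Suc (far0 a1) \<le> b2" "a2 < b2" "b2 \<le> far0 a2" "far0 a2 = d2 + a2"
      "G0.corner_bound (Suc 0) b2 (Suc (far0 a2)) i2" "i1 \<le> i2 + d2" by (rule corner_bound_Suc)
    from 2(6) obtain a3 b3 d3 i3 where 3: "b2 \<le> a3" "Suc (far0 a2) \<le> b3" "a3 < b3" "b3 \<le> far0 a3" "far0 a3 = d3 + a3"
      "G0.corner_bound 0 b3 (Suc (far0 a3)) i3" "i2 \<le> i3 + d3" by (rule corner_bound_Suc)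
    have "i3 = 0" using 3(6) by simp
    then show ?thesis
      using far0_cases[of a1] far0_cases[of a2] far0_cases[of a3] 1(1-5,7) 2(1-5,7) 3(1-5,7)
      by (elim disjE conjE; linarith)
  next
    case 5
    then have c: "G0.corner_bound (Suc (Suc (Suc (Suc 0)))) 1 2 i"
    proof -
      have "(4::nat) = Suc (Suc (Suc (Suc 0)))" by simp
      then show ?thesis using assms(2) 5 by metis
    qed
    from c obtain a1 b1 d1 i1 where 1: "1 \<le> a1" "2 \<le> b1" "a1 < b1" "b1 \<le> far0 a1" "far0 a1 = d1 + a1"
      "G0.corner_bound (Suc (Suc (Suc 0))) b1 (Suc (far0 a1)) i1" "i \<le> i1 + d1" by (rule corner_bound_Suc)
    from 1(6) obtain a2 b2 d2 i2 where 2: "b1 \<le> a2" "Suc (far0 a1) \<le> b2" "a2 < b2" "b2 \<le> far0 a2" "far0 a2 = d2 + a2"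
      "G0.corner_bound (Suc (Suc 0)) b2 (Suc (far0 a2)) i2" "i1 \<le> i2 + d2" by (rule corner_bound_Suc)
    from 2(6) obtain a3 b3 d3 i3 where 3: "b2 \<le> a3" "Suc (far0 a2) \<le> b3" "a3 < b3" "b3 \<le> far0 a3" "far0 a3 = d3 + a3"
      "G0.corner_bound (Suc 0) b3 (Suc (far0 a3)) i3" "i2 \<le> i3 + d3" by (rule corner_bound_Suc)
    from 3(6) obtain a4 b4 d4 i4 where 4: "b3 \<le> a4" "Suc (far0 a3) \<le> b4" "a4 < b4" "b4 \<le> far0 a4" "far0 a4 = d4 + a4"
      "G0.corner_bound 0 b4 (Suc (far0 a4)) i4" "i3 \<le> i4 + d4" by (rule corner_bound_Suc)
    have "i4 = 0" using 4(6) by simp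
    then show ?thesis
      using far0_cases[of a1] far0_cases[of a2] far0_cases[of a3] far0_cases[of a4]
        1(1-5,7) 2(1-5,7) 3(1-5,7) 4(1-5,7)
      by (elim disjE conjE; linarith)
  qed
qed

text \<open>The starts forced by \<open>far0_chain\<close> contribute 2, 3, at most 10, 6 and at
  most 2. A sixth corner would need an index beyond 17.\<close>

lemma corner_bound_far0_ge_5:
  assumes "G0.corner_bound r 1 2 i" "5 \<le> r"
  shows "r = 5 \<and> i \<le> 23"
proof -
  obtain s where r: "r = Suc (Suc (Suc (Suc (Suc s))))"
    using assms(2) by (intro that[of "r - 5"]) simp
  from assms(1)[unfolded r] obtain a1 b1 d1 i1 where 1: "1 \<le> a1" "2 \<le> b1" "a1 < b1" "b1 \<le> far0 a1" "far0 a1 = d1 + a1"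
      "G0.corner_bound (Suc (Suc (Suc (Suc s)))) b1 (Suc (far0 a1)) i1" "i \<le> i1 + d1" by (rule corner_bound_Suc)
  from 1(6) obtain a2 b2 d2 i2 where 2: "b1 \<le> a2" "Suc (far0 a1) \<le> b2" "a2 < b2" "b2 \<le> far0 a2" "far0 a2 = d2 + a2"
    "G0.corner_bound (Suc (Suc (Suc s))) b2 (Suc (far0 a2)) i2" "i1 \<le> i2 + d2" by (rule corner_bound_Suc)
  from 2(6) obtain a3 b3 d3 i3 where 3: "b2 \<le> a3" "Suc (far0 a2) \<le> b3" "a3 < b3" "b3 \<le> far0 a3" "far0 a3 = d3 + a3"
    "G0.corner_bound (Suc (Suc s)) b3 (Suc (far0 a3)) i3" "i2 \<le> i3 + d3" by (rule corner_bound_Suc)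
  from 3(6) obtain a4 b4 d4 i4 where 4: "b3 \<le> a4" "Suc (far0 a3) \<le> b4" "a4 < b4" "b4 \<le> far0 a4" "far0 a4 = d4 + a4"
    "G0.corner_bound (Suc s) b4 (Suc (far0 a4)) i4" "i3 \<le> i4 + d4" by (rule corner_bound_Suc)
  from 4(6) obtain a5 b5 d5 i5 where 5: "b4 \<le> a5" "Suc (far0 a4) \<le> b5" "a5 < b5" "b5 \<le> far0 a5" "far0 a5 = d5 + a5"
    "G0.corner_bound s b5 (Suc (far0 a5)) i5" "i4 \<le> i5 + d5" by (rule corner_bound_Suc)
  have *: "a1 = 1 \<and> a2 = 2 \<and> 4 \<le> a3 \<and> a3 \<le> 8 \<and> a4 = 9 \<and> 15 \<le> a5"
    by (rule far0_chain[of a1 b1 a2 b2 a3 b3 a4 b4 a5 b5]) (use 1(1-4) 2(1-4) 3(1-4) 4(1-4) 5(1-4) in linarith)+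
  have f: "far0 a1 = 3" "far0 a2 = 5" "far0 a3 = 14" "far0 a4 = 15" "far0 a5 = 17"
    using * by (auto simp: far0_def)
  have "s = 0"
  proof (cases s)
    case (Suc t)
    from 5(6)[unfolded Suc] obtain a6 b6 where "Suc (far0 a5) \<le> b6" "b6 \<le> far0 a6"
      by (rule corner_bound_Suc)
    moreover have "far0 a6 \<le> 17" by (simp add: far0_def)
    ultimately show ?thesis using f by linarith
  qed
  then show ?thesis using 1(5,7) 2(5,7) 3(5,7) 4(5,7) 5(5-7) * f unfolding r by auto
qed

section \<open>The Koszul complex of a polynomial ring in a fine degree\<close>

definition sqf :: "'v set \<Rightarrow> ('v \<Rightarrow>\<^sub>0 nat)" where
  "sqf A = (\<Sum>v\<in>A. Poly_Mapping.single v 1)"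

lemma lookup_sqf: "finite A \<Longrightarrow> Poly_Mapping.lookup (sqf A) v = (if v \<in> A then 1 else 0)"
  unfolding sqf_def lookup_sum lookup_single when_def by (simp add: sum.delta')

lemma sqf_insert: "finite A \<Longrightarrow> v \<notin> A \<Longrightarrow> sqf (insert v A) = Poly_Mapping.single v 1 + sqf A"
  by (simp add: sqf_def)

lemma keys_add_nat: "Poly_Mapping.keys (s + t :: 'v \<Rightarrow>\<^sub>0 nat) = Poly_Mapping.keys s \<union> Poly_Mapping.keys t"
  by (auto simp: in_keys_iff lookup_add)

lemma keys_sqf: "finite A \<Longrightarrow> Poly_Mapping.keys (sqf A) = A"
  by (auto simp: in_keys_iff lookup_sqf split: if_splits)

text \<open>Subtraction of exponents is truncated; the inclusion makes it a true inverse of adding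
  the exterior part.\<close>

lemma diff_sqf_add:
  assumes "A \<subseteq> Poly_Mapping.keys t" shows "(t - sqf A) + sqf A = t"
proof -
  have "finite A" using finite_subset[OF assms] by simp
  then show ?thesis using assms
    by (intro poly_mapping_eqI) (auto simp: lookup_add lookup_minus lookup_sqf in_keys_iff)
qed

lemma keys_diff_sqf:
  assumes "finite A"
  shows "Poly_Mapping.keys (t - sqf A) = {v \<in> Poly_Mapping.keys t. v \<in> A \<longrightarrow> Poly_Mapping.lookup t v \<ge> 2}"
  using assms by (auto simp: in_keys_iff lookup_minus lookup_sqf)

lemma lookup_single_mult:
  fixes f :: "('v \<Rightarrow>\<^sub>0 nat) \<Rightarrow>\<^sub>0 'k::semiring_0"
  shows "Poly_Mapping.lookup (Poly_Mapping.single a c * f) (a + m) = c * Poly_Mapping.lookup f m"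
proof -
  have "Poly_Mapping.lookup (Poly_Mapping.single a c * f) (a + m)
      = (\<Sum>l. (c when l = a) * (\<Sum>q. Poly_Mapping.lookup f q when a + m = l + q))"
    by (simp add: lookup_mult lookup_single eq_commute[of a])
  also have "\<dots> = (\<Sum>l. (c * (\<Sum>q. Poly_Mapping.lookup f q when a + m = a + q)) when l = a)"
    by (intro Sum_any.cong) (simp add: when_def)
  also have "\<dots> = c * Poly_Mapping.lookup f m"
    by (simp add: eq_commute[of m])
  finally show ?thesis .
qed

lemma keys_single_mult:
  fixes f :: "('v \<Rightarrow>\<^sub>0 nat) \<Rightarrow>\<^sub>0 'k::field"
  assumes "m \<in> Poly_Mapping.keys (Poly_Mapping.single a c * f)"
  obtains q where "m = a + q" "q \<in> Poly_Mapping.keys f"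
  using keys_mult[of "Poly_Mapping.single a c" f] assms by (auto split: if_splits)

lemma lookup_Var_mult:
  "Poly_Mapping.lookup (Var v * f) m = (if v \<in> Poly_Mapping.keys m
     then Poly_Mapping.lookup f (m - Poly_Mapping.single v 1) else 0)"
proof (cases "v \<in> Poly_Mapping.keys m")
  case True
  then have "m = Poly_Mapping.single v 1 + (m - Poly_Mapping.single v 1)"
    by (intro poly_mapping_eqI) (auto simp: lookup_add lookup_minus lookup_single when_def in_keys_iff)
  then show ?thesis
    using True lookup_single_mult[of "Poly_Mapping.single v 1" 1 f "m - Poly_Mapping.single v 1"]
    by (simp add: Var_def)
next
  case False
  then have "m \<notin> Poly_Mapping.keys (Var v * f)"
    unfolding Var_def by (auto elim!: keys_single_mult simp: keys_add_nat)
  then show ?thesis using False by (simp add: in_keys_iff)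
qed

abbreviation pact :: "'v \<Rightarrow> ('v, 'k::field) mpoly \<Rightarrow> ('v, 'k) mpoly" where
  "pact v f \<equiv> Var v * f"

lemma koszul_pact: "finite V \<Longrightarrow> koszul V pact"
  by (simp add: koszul_def distrib_left mult.left_commute)

lemma lookup_ksgn: "Poly_Mapping.lookup (ksgn v A f) m = ksgn v A (Poly_Mapping.lookup f m)"
  by (simp add: ksgn_def)

text \<open>The fine degree of the Koszul chain \<open>x\<^sup>m e\<^sub>A\<close> is \<open>m + sqf A\<close>.\<close>

definition msys :: "(('v \<Rightarrow>\<^sub>0 nat) \<Rightarrow> 'v set \<Rightarrow> bool) \<Rightarrow> 'v set \<Rightarrow> ('v, 'k::field) mpoly set" where
  "msys P A = {f. \<forall>m\<in>Poly_Mapping.keys f. P (m + sqf A) A}"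

lemma msysI: "(\<And>m. Poly_Mapping.lookup f m \<noteq> 0 \<Longrightarrow> P (m + sqf A) A) \<Longrightarrow> f \<in> msys P A"
  by (simp add: msys_def in_keys_iff)

lemma msysD: "f \<in> msys P A \<Longrightarrow> Poly_Mapping.lookup f m \<noteq> 0 \<Longrightarrow> P (m + sqf A) A"
  by (simp add: msys_def in_keys_iff)

lemma msys_mono: "(\<And>t. P t A \<Longrightarrow> P' t A) \<Longrightarrow> msys P A \<subseteq> msys P' A"
  by (auto simp: msys_def)

text \<open>The differential moves a variable from the exterior part into the coefficient and so
  keeps the fine degree; only the dependence of \<open>P\<close> on \<open>A\<close> remains to be
  checked.\<close>

lemma csys_msys:
  assumes V: "finite V"
    and P: "\<And>t A v. insert v A \<subseteq> V \<Longrightarrow> v \<notin> A \<Longrightarrow> P t (insert v A) \<Longrightarrow> P t A"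
  shows "koszul.csys V pact (msys P :: _ \<Rightarrow> ('v::linorder, 'k::field) mpoly set)"
proof -
  interpret koszul V "pact :: 'v \<Rightarrow> ('v, 'k) mpoly \<Rightarrow> _" by (rule koszul_pact[OF V])
  show ?thesis
    unfolding csys_def
  proof (intro conjI allI impI ballI)
    fix A v and f :: "('v, 'k) mpoly"
    assume A: "A \<subseteq> V" and v: "v \<in> V - A" and f: "f \<in> msys P (insert v A)"
    have fin: "finite A" using A V finite_subset by blast
    show "Var v * f \<in> msys P A"
    proof (rule msysI)
      fix m assume "Poly_Mapping.lookup (Var v * f) m \<noteq> 0"
      then have m: "v \<in> Poly_Mapping.keys m" "Poly_Mapping.lookup f (m - Poly_Mapping.single v 1) \<noteq> 0"
        by (auto simp: lookup_Var_mult split: if_splits)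
      have "m = (m - Poly_Mapping.single v 1) + Poly_Mapping.single v 1"
        using m(1) by (intro poly_mapping_eqI)
          (auto simp: lookup_add lookup_minus lookup_single when_def in_keys_iff)
      then have "m + sqf A = (m - Poly_Mapping.single v 1) + sqf (insert v A)"
        using fin v by (simp add: sqf_insert ac_simps)
      then show "P (m + sqf A) A" using msysD[OF f m(2)] P[of v A] A v by simp
    qed
  next
    fix A and f g :: "('v, 'k) mpoly" assume "f \<in> msys P A" "g \<in> msys P A"
    then show "f + g \<in> msys P A"
      using Poly_Mapping.keys_add[of f g] unfolding msys_def by blast
  qed (auto simp: msys_def)
qed

context
  fixes V :: "'v::linorder set"
  assumes V: "finite V"
begin

interpretation koszul V "pact :: 'v \<Rightarrow> ('v, 'k::field) mpoly \<Rightarrow> _"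
  by (rule koszul_pact[OF V])

definition fine_part :: "('v \<Rightarrow>\<^sub>0 nat) \<Rightarrow> ('v set \<Rightarrow> ('v, 'k::field) mpoly) \<Rightarrow> 'v set \<Rightarrow> 'k" where
  "fine_part t z A = Poly_Mapping.lookup (z A) (t - sqf A)"

definition fine_chain :: "('v \<Rightarrow>\<^sub>0 nat) \<Rightarrow> ('v set \<Rightarrow> 'k) \<Rightarrow> 'v set \<Rightarrow> ('v, 'k::field) mpoly" where
  "fine_chain t c A = (if A \<subseteq> Poly_Mapping.keys t then Poly_Mapping.single (t - sqf A) (c A) else 0)"

text \<open>In fine degree \<open>t\<close> there is one coefficient for each \<open>A\<close>
  inside the support of \<open>t\<close>, and the Koszul differential becomes \<open>bd\<close> on
  that support, whatever the exponents.\<close>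

lemma fine_part_kd:
  assumes "A \<subseteq> Poly_Mapping.keys t" "Poly_Mapping.keys t \<subseteq> V"
  shows "fine_part t (kd z) A = bd (Poly_Mapping.keys t) (fine_part t z) A"
proof -
  have fin: "finite A" using finite_subset[OF assms(1)] by simp
  have "fine_part t (kd z) A
      = (\<Sum>v\<in>V - A. ksgn v A (Poly_Mapping.lookup (Var v * z (insert v A)) (t - sqf A)))"
    by (simp add: fine_part_def kd_def lookup_sum lookup_ksgn)
  also have "\<dots> = (\<Sum>v\<in>V - A. if v \<in> Poly_Mapping.keys t then ksgn v A (fine_part t z (insert v A)) else 0)"
  proof (rule sum.cong[OF refl])
    fix v assume v: "v \<in> V - A"
    then have "v \<in> Poly_Mapping.keys (t - sqf A) \<longleftrightarrow> v \<in> Poly_Mapping.keys t"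
      by (simp add: keys_diff_sqf fin)
    moreover have "t - sqf A - Poly_Mapping.single v 1 = t - sqf (insert v A)"
      using v fin by (simp add: sqf_insert diff_diff_eq add.commute)
    ultimately show "ksgn v A (Poly_Mapping.lookup (Var v * z (insert v A)) (t - sqf A))
        = (if v \<in> Poly_Mapping.keys t then ksgn v A (fine_part t z (insert v A)) else 0)"
      by (simp add: lookup_Var_mult fine_part_def)
  qed
  also have "\<dots> = (\<Sum>v\<in>(V - A) \<inter> Poly_Mapping.keys t. ksgn v A (fine_part t z (insert v A)))"
    using V by (subst sum.inter_restrict) auto
  also have "(V - A) \<inter> Poly_Mapping.keys t = Poly_Mapping.keys t - A" using assms by auto
  finally show ?thesis by (simp add: bd_def)
qed

lemma fine_part_fine_chain:
  assumes "A \<subseteq> Poly_Mapping.keys t"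
  shows "fine_part t (fine_chain t' c) A = (if t' = t then c A else 0)"
proof (cases "A \<subseteq> Poly_Mapping.keys t'")
  case True
  have "t' - sqf A = t - sqf A \<longleftrightarrow> t' = t"
    using diff_sqf_add[OF assms] diff_sqf_add[OF True] by metis
  then show ?thesis using True by (auto simp: fine_part_def fine_chain_def lookup_single when_def)
next
  case False
  then show ?thesis using assms by (auto simp: fine_part_def fine_chain_def)
qed

lemma fine_part_sum: "fine_part t (\<lambda>A. \<Sum>b\<in>B. z b A) A = (\<Sum>b\<in>B. fine_part t (z b) A)"
  by (simp add: fine_part_def lookup_sum)

lemma fine_chain_in_msys:
  assumes "P t A" shows "fine_chain t c A \<in> msys P A"
  using assms by (auto simp: fine_chain_def msys_def diff_sqf_add split: if_splits)

text \<open>Koszul homology splits over the fine degrees in \<open>Q\<close>; \<open>n t A\<close>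
  marks the positions of degree \<open>t\<close> that are divided out.\<close>

lemma van_msys_iff:
  fixes Q :: "('v \<Rightarrow>\<^sub>0 nat) set" and n :: "('v \<Rightarrow>\<^sub>0 nat) \<Rightarrow> 'v set \<Rightarrow> bool"
  assumes Q: "\<And>t. t \<in> Q \<Longrightarrow> Poly_Mapping.keys t \<subseteq> V"
  shows "van (msys (\<lambda>t A. t \<in> Q) :: 'v set \<Rightarrow> ('v, 'k::field) mpoly set) (msys (\<lambda>t A. t \<in> Q \<and> n t A)) i
    \<longleftrightarrow> (\<forall>t\<in>Q. exact_at TYPE('k) (Poly_Mapping.keys t) (\<lambda>A. \<not> n t A) i)"
proof (intro iffI ballI)
  fix t assume van: "van (msys (\<lambda>t A. t \<in> Q) :: 'v set \<Rightarrow> ('v, 'k) mpoly set) (msys (\<lambda>t A. t \<in> Q \<and> n t A)) i"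
    and t: "t \<in> Q"
  show "exact_at TYPE('k) (Poly_Mapping.keys t) (\<lambda>A. \<not> n t A) i"
  proof (rule exact_atI)
    fix c :: "'v set \<Rightarrow> 'k"
    assume cyc: "\<And>A. A \<subseteq> Poly_Mapping.keys t \<Longrightarrow> Suc (card A) = i \<Longrightarrow> \<not> n t A \<Longrightarrow> bd (Poly_Mapping.keys t) c A = 0"
    have chain: "fine_chain t c A \<in> msys (\<lambda>t' A. t' = t) A" for A
      by (rule fine_chain_in_msys) simp
    have part: "bd (Poly_Mapping.keys t) (fine_part t (fine_chain t c)) A = bd (Poly_Mapping.keys t) c A"
      if "A \<subseteq> Poly_Mapping.keys t" for A
      unfolding bd_def by (rule sum.cong) (use that in \<open>auto simp: fine_part_fine_chain\<close>)
    have z: "fine_chain t c A \<in> msys (\<lambda>t A. t \<in> Q) A" for A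
      using t by (intro fine_chain_in_msys)
    have dz: "kd (fine_chain t c) A \<in> msys (\<lambda>t A. t \<in> Q \<and> n t A) A" if A: "A \<subseteq> V" "Suc (card A) = i" for A
    proof (rule msysI)
      fix m assume m: "Poly_Mapping.lookup (kd (fine_chain t c) A) m \<noteq> 0"
      have "kd (fine_chain t c) A \<in> msys (\<lambda>t' A. t' = t) A"
        by (rule kd_in[of _ "card A"]) (use A chain in \<open>auto intro!: csys_msys V\<close>)
      then have eq: "m + sqf A = t" using m by (rule msysD)
      have "finite A" using A V finite_subset by blast
      then have At: "A \<subseteq> Poly_Mapping.keys t" using eq keys_add_nat[of m "sqf A"] keys_sqf by auto
      have "Poly_Mapping.lookup (kd (fine_chain t c) A) m = fine_part t (kd (fine_chain t c)) A"
        using eq by (simp add: fine_part_def flip: eq)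
      also have "\<dots> = bd (Poly_Mapping.keys t) c A"
        using fine_part_kd[OF At Q[OF t], of "fine_chain t c"] part[OF At] by simp
      finally show "m + sqf A \<in> Q \<and> n (m + sqf A) A"
        using cyc[OF At A(2)] m t eq by auto
    qed
    obtain w where w: "\<And>A. A \<subseteq> V \<Longrightarrow> card A = i \<Longrightarrow>
        fine_chain t c A - kd w A \<in> msys (\<lambda>t A. t \<in> Q \<and> n t A) A"
      by (rule vanE[OF van z dz]) blast+
    have "c A = bd (Poly_Mapping.keys t) (fine_part t w) A"
      if A: "A \<subseteq> Poly_Mapping.keys t" "card A = i" "\<not> n t A" for A
    proof (rule ccontr)
      assume ne: "c A \<noteq> bd (Poly_Mapping.keys t) (fine_part t w) A"
      have "Poly_Mapping.lookup (fine_chain t c A - kd w A) (t - sqf A)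
          = fine_part t (fine_chain t c) A - fine_part t (kd w) A"
        by (simp add: fine_part_def lookup_minus)
      also have "\<dots> = c A - bd (Poly_Mapping.keys t) (fine_part t w) A"
        using fine_part_kd[OF A(1) Q[OF t], of w] A(1) by (simp add: fine_part_fine_chain)
      finally have "Poly_Mapping.lookup (fine_chain t c A - kd w A) (t - sqf A) \<noteq> 0" using ne by simp
      moreover have "A \<subseteq> V" using A Q[OF t] by blast
      ultimately have "n ((t - sqf A) + sqf A) A" using msysD[OF w] A(2) by blast
      then show False using A diff_sqf_add[OF A(1)] by simp
    qed
    then show "\<exists>b. \<forall>A\<subseteq>Poly_Mapping.keys t. card A = i \<longrightarrow> \<not> n t A \<longrightarrow> c A = bd (Poly_Mapping.keys t) b A"
      by blast
  qed
next
  assume ex: "\<forall>t\<in>Q. exact_at TYPE('k) (Poly_Mapping.keys t) (\<lambda>A. \<not> n t A) i"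
  show "van (msys (\<lambda>t A. t \<in> Q) :: 'v set \<Rightarrow> ('v, 'k) mpoly set) (msys (\<lambda>t A. t \<in> Q \<and> n t A)) i"
  proof (rule vanI)
    fix z :: "'v set \<Rightarrow> ('v, 'k) mpoly"
    assume z: "\<And>A. A \<subseteq> V \<Longrightarrow> card A = i \<Longrightarrow> z A \<in> msys (\<lambda>t A. t \<in> Q) A"
      and dz: "\<And>A. A \<subseteq> V \<Longrightarrow> Suc (card A) = i \<Longrightarrow> kd z A \<in> msys (\<lambda>t A. t \<in> Q \<and> n t A) A"
    have "\<exists>b. \<forall>A\<subseteq>Poly_Mapping.keys t. card A = i \<longrightarrow> \<not> n t A \<longrightarrow> fine_part t z A = bd (Poly_Mapping.keys t) b A"
      if t: "t \<in> Q" for t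
    proof -
      have "bd (Poly_Mapping.keys t) (fine_part t z) A = 0"
        if A: "A \<subseteq> Poly_Mapping.keys t" "Suc (card A) = i" "\<not> n t A" for A
      proof (rule ccontr)
        assume "bd (Poly_Mapping.keys t) (fine_part t z) A \<noteq> 0"
        then have "Poly_Mapping.lookup (kd z A) (t - sqf A) \<noteq> 0"
          using fine_part_kd[OF A(1) Q[OF t], of z] by (simp add: fine_part_def)
        moreover have "A \<subseteq> V" using A Q[OF t] by blast
        ultimately have "n ((t - sqf A) + sqf A) A" using msysD[OF dz] A(2) by blast
        then show False using A diff_sqf_add[OF A(1)] by simp
      qed
      note cyc = this
      show ?thesis by (rule exact_atE[OF bspec[OF ex t] cyc]) blast+
    qed
    then obtain b where b: "\<And>t A. t \<in> Q \<Longrightarrow> A \<subseteq> Poly_Mapping.keys t \<Longrightarrow> card A = i \<Longrightarrow> \<not> n t A \<Longrightarrow>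
        fine_part t z A = bd (Poly_Mapping.keys t) (b t) A" by metis
    \<comment> \<open>Bounding chains are summed over the finitely many fine degrees occurring in
      \<open>z\<close>, so that the sum consists of polynomials.\<close>
    define T where "T = (\<Union>A\<in>{A. A \<subseteq> V \<and> card A = i}. (\<lambda>m. m + sqf A) ` Poly_Mapping.keys (z A))"
    have "finite T" unfolding T_def using V by (auto intro: finite_subset[of _ "Pow V"])
    have TQ: "T \<subseteq> Q" unfolding T_def using z by (auto simp: msys_def)
    define w where "w A = (\<Sum>t\<in>T. fine_chain t (b t) A)" for A
    have wT: "w A \<in> msys (\<lambda>t A. t \<in> T) A" if "A \<subseteq> V" for A
      unfolding w_def using that
      by (intro csys_sum[of "msys (\<lambda>t A. t \<in> T)"] csys_msys V fine_chain_in_msys)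
    have wpart: "bd (Poly_Mapping.keys t) (fine_part t w) A = bd (Poly_Mapping.keys t) (b t) A"
      if "t \<in> T" "A \<subseteq> Poly_Mapping.keys t" for t A
    proof -
      have "fine_part t w B = b t B" if "B \<subseteq> Poly_Mapping.keys t" for B
        using \<open>finite T\<close> \<open>t \<in> T\<close> that by (simp add: w_def[abs_def] fine_part_sum fine_part_fine_chain)
      then show ?thesis unfolding bd_def using that by (intro sum.cong) auto
    qed
    show "\<exists>w. (\<forall>A\<subseteq>V. card A = Suc i \<longrightarrow> w A \<in> msys (\<lambda>t A. t \<in> Q) A) \<and>
         (\<forall>A\<subseteq>V. card A = i \<longrightarrow> z A - kd w A \<in> msys (\<lambda>t A. t \<in> Q \<and> n t A) A)"
    proof (intro exI[of _ w] conjI allI impI)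
      fix A assume A: "A \<subseteq> V"
      show "w A \<in> msys (\<lambda>t A. t \<in> Q) A"
        using wT[OF A] TQ by (auto simp: msys_def)
      assume card: "card A = i"
      show "z A - kd w A \<in> msys (\<lambda>t A. t \<in> Q \<and> n t A) A"
      proof (rule msysI)
        fix m assume m: "Poly_Mapping.lookup (z A - kd w A) m \<noteq> 0"
        define t where "t = m + sqf A"
        have "finite A" using A V finite_subset by blast
        then have At: "A \<subseteq> Poly_Mapping.keys t"
          using keys_add_nat[of m "sqf A"] keys_sqf by (auto simp: t_def)
        have m_eq: "m = t - sqf A" by (simp add: t_def)
        have "kd w A \<in> msys (\<lambda>t A. t \<in> T) A"
          by (rule kd_in[OF _ _ A card]) (auto intro!: csys_msys V wT)
        moreover have "t \<in> T" if "Poly_Mapping.lookup (z A) m \<noteq> 0"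
          using that A card by (auto simp: T_def t_def in_keys_iff)
        ultimately have t: "t \<in> T" using m msysD[of "kd w A" "\<lambda>t A. t \<in> T" A m]
          by (cases "Poly_Mapping.lookup (z A) m = 0") (auto simp: lookup_minus t_def)
        then have tQ: "t \<in> Q" using TQ by blast
        have "Poly_Mapping.lookup (kd w A) m = bd (Poly_Mapping.keys t) (b t) A"
          using fine_part_kd[OF At Q[OF tQ], of w] wpart[OF t At] by (simp add: fine_part_def m_eq)
        moreover have "Poly_Mapping.lookup (z A) m = fine_part t z A" by (simp add: fine_part_def m_eq)
        ultimately have "n t A" using b[OF tQ At card] m by (auto simp: lookup_minus)
        then show "m + sqf A \<in> Q \<and> n (m + sqf A) A" using tQ by (simp add: t_def)
      qed
    qed
  qed
qed

end

section \<open>Degeneration to the initial ideal\<close>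

lemma (in koszul) van_zero:
  assumes "csys N" "\<And>A. A \<subseteq> V \<Longrightarrow> M A \<subseteq> {0}" "\<And>A. A \<subseteq> V \<Longrightarrow> 0 \<in> M A"
  shows "van M N i"
proof (rule vanI)
  fix z assume "\<And>A. A \<subseteq> V \<Longrightarrow> card A = i \<Longrightarrow> z A \<in> M A"
  then have "z A = 0" if "A \<subseteq> V" "card A = i" for A
    using assms(2) that by blast
  then show "\<exists>w. (\<forall>A\<subseteq>V. card A = Suc i \<longrightarrow> w A \<in> M A) \<and>
           (\<forall>A\<subseteq>V. card A = i \<longrightarrow> z A - kd w A \<in> N A)"
    using assms(3) csys_0[OF assms(1)] by (intro exI[of _ "\<lambda>_. 0"]) (simp add: kd_def)
qed

text \<open>
  \<open>Q\<close> is a set of fine degrees, closed under replacing a nonstandard monomial by a monomial of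
  larger weight that is congruent to it modulo \<open>J\<close>.  The nonstandard monomials span the initial
  ideal of \<open>J\<close> with respect to the terms of smallest weight.
\<close>

locale degeneration =
  fixes V :: "'v::linorder set" and J :: "('v, 'k::field) mpoly set"
    and wt :: "('v \<Rightarrow>\<^sub>0 nat) \<Rightarrow> nat" and nonstd :: "('v \<Rightarrow>\<^sub>0 nat) \<Rightarrow> bool"
    and Q :: "('v \<Rightarrow>\<^sub>0 nat) set" and B :: nat
  assumes V: "finite V"
    and J: "0 \<in> J" "\<And>f g. f \<in> J \<Longrightarrow> g \<in> J \<Longrightarrow> f + g \<in> J" "\<And>f. f \<in> J \<Longrightarrow> - f \<in> J"
      "\<And>v f. v \<in> V \<Longrightarrow> f \<in> J \<Longrightarrow> Var v * f \<in> J"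
    and wt_add: "wt (s + t) = wt s + wt t"
    and Q: "\<And>t. t \<in> Q \<Longrightarrow> Poly_Mapping.keys t \<subseteq> V"
    and wt_le: "\<And>t. t \<in> Q \<Longrightarrow> wt t \<le> B"
    and nonstd_add: "\<And>m m'. nonstd m \<Longrightarrow> nonstd (m + m')"
    and lowest: "\<And>f m. f \<in> J \<Longrightarrow> m \<in> Poly_Mapping.keys f \<Longrightarrow>
      (\<And>m'. m' \<in> Poly_Mapping.keys f \<Longrightarrow> wt m \<le> wt m') \<Longrightarrow> nonstd m"
    and reduce: "\<And>A m. A \<subseteq> V \<Longrightarrow> m + sqf A \<in> Q \<Longrightarrow> nonstd m \<Longrightarrow>
      \<exists>m'. m' + sqf A \<in> Q \<and> wt m < wt m' \<and>
        (\<forall>c. Poly_Mapping.single m c - Poly_Mapping.single m' c \<in> J)"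
begin

sublocale koszul V "pact :: 'v \<Rightarrow> ('v, 'k) mpoly \<Rightarrow> _"
  by (rule koszul_pact[OF V])

text \<open>Weight is measured on the fine degree, exterior part included, so the differential
  respects the filtration by weight.\<close>

definition Qge :: "nat \<Rightarrow> ('v \<Rightarrow>\<^sub>0 nat) set" where
  "Qge c = {t \<in> Q. c \<le> wt t}"

definition Sge :: "nat \<Rightarrow> 'v set \<Rightarrow> ('v, 'k) mpoly set" where
  "Sge c = msys (\<lambda>t A. t \<in> Qge c)"

definition Jge :: "nat \<Rightarrow> 'v set \<Rightarrow> ('v, 'k) mpoly set" where
  "Jge c A = J \<inter> Sge c A"

definition lead :: "nat \<Rightarrow> ('v \<Rightarrow>\<^sub>0 nat) \<Rightarrow> 'v set \<Rightarrow> bool" where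
  "lead c t A \<longleftrightarrow> (wt t = c \<longrightarrow> nonstd (t - sqf A))"

text \<open>Terms of weight exactly \<open>c\<close> must be nonstandard. So
  \<open>Sge c / Nge c\<close> is the layer of weight \<open>c\<close> of the Koszul complex modulo
  the initial ideal, and \<open>Nge c\<close> is the sum of \<open>Sge (Suc c)\<close> and
  \<open>Jge c\<close>.\<close>

definition Nge :: "nat \<Rightarrow> 'v set \<Rightarrow> ('v, 'k) mpoly set" where
  "Nge c = msys (\<lambda>t A. t \<in> Qge c \<and> lead c t A)"

definition std_exact :: "('v \<Rightarrow>\<^sub>0 nat) \<Rightarrow> nat \<Rightarrow> bool" where
  "std_exact t i \<longleftrightarrow> exact_at TYPE('k) (Poly_Mapping.keys t) (\<lambda>A. \<not> nonstd (t - sqf A)) i"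

lemma csys_Sge: "csys (Sge c)"
  unfolding Sge_def by (rule csys_msys[OF V])

lemma csys_Jge: "csys (Jge c)"
  unfolding csys_def
proof (intro conjI allI impI ballI)
  fix A v f assume A: "A \<subseteq> V" "v \<in> V - A" and f: "f \<in> Jge c (insert v A)"
  then have "Var v * f \<in> Sge c A" using csys_act[OF csys_Sge, of v A f] by (auto simp: Jge_def)
  then show "Var v * f \<in> Jge c A" using A f J(4) by (auto simp: Jge_def)
next
  fix A f g assume A: "A \<subseteq> V" and fg: "f \<in> Jge c A" "g \<in> Jge c A"
  show "f + g \<in> Jge c A" "- f \<in> Jge c A"
    using fg J(2,3) csys_add[OF csys_Sge A, of f c g] csys_neg[OF csys_Sge A, of f c]
    by (simp_all add: Jge_def)
qed (use J(1) csys_0[OF csys_Sge] in \<open>simp add: Jge_def\<close>)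

text \<open>Removing \<open>v\<close> from the exterior part multiplies the coefficient monomial by
  \<open>v\<close>, and multiples of nonstandard monomials are nonstandard. The last hypothesis
  keeps the truncated subtraction exact.\<close>

lemma lead_insert:
  assumes "insert v A \<subseteq> V" "v \<notin> A" "lead c t (insert v A)" "insert v A \<subseteq> Poly_Mapping.keys t"
  shows "lead c t A"
proof -
  have fin: "finite A" using finite_subset[of A V] assms(1) V by simp
  have "t - sqf A = (t - sqf (insert v A)) + Poly_Mapping.single v 1"
  proof (rule poly_mapping_eqI)
    fix k show "Poly_Mapping.lookup (t - sqf A) k
        = Poly_Mapping.lookup ((t - sqf (insert v A)) + Poly_Mapping.single v 1) k"
      using assms(2,4) fin
      by (cases "k = v") (auto simp: lookup_add lookup_minus lookup_sqf lookup_single when_def in_keys_iff)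
  qed
  then show ?thesis using assms(3) nonstd_add unfolding lead_def by metis
qed

lemma Nge_alt: "A \<subseteq> V \<Longrightarrow> f \<in> Nge c A \<longleftrightarrow>
    (\<forall>m\<in>Poly_Mapping.keys f. m + sqf A \<in> Qge c \<and> (wt (m + sqf A) = c \<longrightarrow> nonstd m))"
  by (simp add: Nge_def msys_def lead_def)

lemma csys_Nge: "csys (Nge c)"
proof -
  have "csys (msys (\<lambda>t A. A \<subseteq> Poly_Mapping.keys t \<and> t \<in> Qge c \<and> lead c t A) :: _ \<Rightarrow> ('v, 'k) mpoly set)"
    by (rule csys_msys[OF V]) (use lead_insert in blast)
  moreover have "msys (\<lambda>t A. A \<subseteq> Poly_Mapping.keys t \<and> t \<in> Qge c \<and> lead c t A) A = Nge c A"
    if "A \<subseteq> V" for A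
  proof -
    have "finite A" using finite_subset[of A V] that V by simp
    then have "A \<subseteq> Poly_Mapping.keys (m + sqf A)" for m :: "'v \<Rightarrow>\<^sub>0 nat"
      by (simp add: keys_add_nat keys_sqf)
    then show ?thesis by (simp add: Nge_def msys_def)
  qed
  ultimately show ?thesis unfolding csys_def by (smt (verit) DiffE insert_subset)
qed

lemma Nge_subset_Sge: "Nge c A \<subseteq> Sge c A"
  unfolding Nge_def Sge_def by (rule msys_mono) simp

lemma Sge_Suc_subset_Nge: "Sge (Suc c) A \<subseteq> Nge c A"
  unfolding Nge_def Sge_def by (rule msys_mono) (auto simp: Qge_def lead_def)

lemma Sge_Suc_subset_Sge: "Sge (Suc c) A \<subseteq> Sge c A"
  using Sge_Suc_subset_Nge Nge_subset_Sge by blast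

text \<open>A term of weight exactly \<open>c\<close> has minimal weight in \<open>f\<close>, so
  \<open>lowest\<close> applies to it.\<close>

lemma Jge_subset_Nge:
  assumes "A \<subseteq> V" shows "Jge c A \<subseteq> Nge c A"
proof
  fix f assume f: "f \<in> Jge c A"
  then have keys: "m + sqf A \<in> Qge c" if "m \<in> Poly_Mapping.keys f" for m
    using that by (auto simp: Jge_def Sge_def msys_def)
  have "nonstd m" if m: "m \<in> Poly_Mapping.keys f" "wt (m + sqf A) = c" for m
  proof (rule lowest)
    show "f \<in> J" using f by (simp add: Jge_def)
    show "wt m \<le> wt m'" if "m' \<in> Poly_Mapping.keys f" for m'
      using keys[OF that] m by (simp add: Qge_def wt_add)
  qed (rule m)
  then show "f \<in> Nge c A" using keys Nge_alt[OF assms] by blast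
qed

text \<open>Each nonstandard term of weight \<open>c\<close> is traded for a congruent monomial of
  larger weight; \<open>h\<close> collects the differences and lies in \<open>J\<close>.\<close>

lemma Nge_split:
  assumes A: "A \<subseteq> V" and y: "y \<in> Nge c A"
  shows "\<exists>x\<in>Sge (Suc c) A. y - x \<in> Jge c A"
proof -
  define M where "M = {m \<in> Poly_Mapping.keys y. wt (m + sqf A) = c}"
  have "finite M" by (simp add: M_def)
  have keys: "m + sqf A \<in> Qge c" if "m \<in> Poly_Mapping.keys y" for m
    using that y Nge_alt[OF A] by blast
  have "\<exists>m'. m' + sqf A \<in> Q \<and> wt m < wt m' \<and>
        (\<forall>a. Poly_Mapping.single m a - Poly_Mapping.single m' a \<in> J)" if "m \<in> M" for m
  proof (rule reduce[OF A])
    show "m + sqf A \<in> Q" using keys[of m] that by (simp add: M_def Qge_def)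
    show "nonstd m" using that y Nge_alt[OF A] by (auto simp: M_def)
  qed
  then obtain p where p: "\<And>m. m \<in> M \<Longrightarrow> p m + sqf A \<in> Q" "\<And>m. m \<in> M \<Longrightarrow> wt m < wt (p m)"
    "\<And>m a. m \<in> M \<Longrightarrow> Poly_Mapping.single m a - Poly_Mapping.single (p m) a \<in> J"
    by metis
  define h where "h = (\<Sum>m\<in>M. Poly_Mapping.single m (Poly_Mapping.lookup y m)
      - Poly_Mapping.single (p m) (Poly_Mapping.lookup y m))"
  have "h \<in> J" unfolding h_def using \<open>finite M\<close> p(3)
    by (induction M rule: finite_induct) (auto intro: J)
  define y' where "y' = y - (\<Sum>m\<in>M. Poly_Mapping.single m (Poly_Mapping.lookup y m))"
  have "y' \<in> Sge (Suc c) A"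
    unfolding Sge_def
  proof (rule msysI)
    fix k assume k: "Poly_Mapping.lookup y' k \<noteq> 0"
    have "Poly_Mapping.lookup y' k = Poly_Mapping.lookup y k
        - (\<Sum>m\<in>M. if m = k then Poly_Mapping.lookup y k else 0)"
      unfolding y'_def lookup_minus lookup_sum lookup_single when_def by (simp cong: if_cong)
    also have "\<dots> = (if k \<in> M then 0 else Poly_Mapping.lookup y k)"
      using \<open>finite M\<close> by simp
    finally have "k \<in> Poly_Mapping.keys y" "k \<notin> M" using k by (auto simp: in_keys_iff split: if_splits)
    then show "k + sqf A \<in> Qge (Suc c)" using keys[of k] by (auto simp: M_def Qge_def)
  qed
  moreover have "Poly_Mapping.single (p m) (Poly_Mapping.lookup y m) \<in> Sge (Suc c) A" if "m \<in> M" for m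
    using p(1,2)[OF that] that by (auto simp: Sge_def msys_def Qge_def M_def wt_add)
  ultimately have "y' + (\<Sum>m\<in>M. Poly_Mapping.single (p m) (Poly_Mapping.lookup y m)) \<in> Sge (Suc c) A"
    by (intro csys_add[OF csys_Sge A] csys_sum[OF csys_Sge A])
  moreover have "y' + (\<Sum>m\<in>M. Poly_Mapping.single (p m) (Poly_Mapping.lookup y m)) = y - h"
    by (simp add: y'_def h_def sum_subtractf)
  ultimately have yh: "y - h \<in> Sge (Suc c) A" by simp
  have "y - (y - h) \<in> Sge c A"
    by (rule csys_diff[OF csys_Sge A]) (use subsetD[OF Nge_subset_Sge y] subsetD[OF Sge_Suc_subset_Sge yh] in simp_all)
  then have "y - (y - h) \<in> Jge c A" using \<open>h \<in> J\<close> by (simp add: Jge_def)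
  then show ?thesis using yh by blast
qed

text \<open>Second isomorphism theorem: \<open>Nge c\<close> is the sum of
  \<open>Sge (Suc c)\<close> and \<open>Jge c\<close>, and \<open>Jge (Suc c)\<close> is their
  intersection.\<close>

lemma van_Nge_Jge: "van (Nge c) (Jge c) i \<longleftrightarrow> van (Sge (Suc c)) (Jge (Suc c)) i"
proof -
  have "van (Sge (Suc c)) (Jge (Suc c)) i \<longleftrightarrow> van (Nge c) (Jge c) i"
    by (rule van_iso[where f = "\<lambda>x. x"])
      (use koszul_axioms csys_Sge csys_Jge Nge_split subsetD[OF Sge_Suc_subset_Nge]
        subsetD[OF Sge_Suc_subset_Sge] in \<open>simp_all add: Jge_def\<close>)
  then show ?thesis by simp
qed

text \<open>Fine degrees of weight above \<open>c\<close> lie entirely in \<open>Nge c\<close>; only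
  those of weight \<open>c\<close> contribute.\<close>

lemma van_Sge_Nge: "van (Sge c) (Nge c) i \<longleftrightarrow> (\<forall>t\<in>Q. wt t = c \<longrightarrow> std_exact t i)"
proof -
  have "van (Sge c) (Nge c) i \<longleftrightarrow>
      (\<forall>t\<in>Qge c. exact_at TYPE('k) (Poly_Mapping.keys t) (\<lambda>A. \<not> lead c t A) i)"
    unfolding Sge_def Nge_def by (rule van_msys_iff[OF V]) (use Q in \<open>auto simp: Qge_def\<close>)
  also have "\<dots> \<longleftrightarrow> (\<forall>t\<in>Q. wt t = c \<longrightarrow> std_exact t i)"
  proof -
    have "exact_at TYPE('k) (Poly_Mapping.keys t) (\<lambda>A. \<not> lead c t A) i
        \<longleftrightarrow> (wt t = c \<longrightarrow> std_exact t i)" for t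
      using exact_at_none[of "Poly_Mapping.keys t" "\<lambda>A. False" i, where 'k = 'k]
      by (cases "wt t = c") (simp_all add: lead_def std_exact_def)
    then show ?thesis by (auto simp: Qge_def)
  qed
  finally show ?thesis .
qed

text \<open>Downward induction on \<open>c\<close>, starting beyond the bound \<open>B\<close>,
  where nothing is left. Each step adds one layer \<open>Sge c / Nge c\<close>.\<close>

lemma van_Sge_Jge:
  assumes "\<And>t. t \<in> Q \<Longrightarrow> std_exact t i"
  shows "van (Sge c) (Jge c) i"
proof (induction "Suc B - c" arbitrary: c)
  case 0
  then have "Qge c = {}" using wt_le by (force simp: Qge_def)
  then have "Sge c A = {0}" for A by (auto simp: Sge_def msys_def)
  then show ?case by (intro van_zero csys_Jge) auto
next
  case (Suc k)
  show ?case
  proof (rule van_extend[OF csys_Sge csys_Nge])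
    show "van (Nge c) (Jge c) i" unfolding van_Nge_Jge by (rule Suc.hyps) (use Suc.hyps(2) in simp)
    show "van (Sge c) (Nge c) i" unfolding van_Sge_Nge using assms by blast
  qed (use Jge_subset_Nge Nge_subset_Sge in auto)
qed

text \<open>At the weight of \<open>t\<close> the class of the layer lifts to
  \<open>Sge / Jge\<close>, since the homology of \<open>Nge / Jge\<close> in degree
  \<open>i\<close> vanishes. On the way down to weight 0 it survives, because each lower layer
  vanishes in degree \<open>Suc (Suc i)\<close>, the source of the connecting map that could kill
  it.\<close>

lemma not_van_Sge_Jge:
  assumes ex: "\<And>t. t \<in> Q \<Longrightarrow> std_exact t i" "\<And>t. t \<in> Q \<Longrightarrow> std_exact t (Suc (Suc i))"
    and t: "t \<in> Q" "\<not> std_exact t (Suc i)"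
  shows "\<not> van (Sge 0) (Jge 0) (Suc i)"
proof -
  have "\<not> van (Sge (wt t)) (Nge (wt t)) (Suc i)" unfolding van_Sge_Nge using t by blast
  moreover have "van (Nge (wt t)) (Jge (wt t)) i"
    unfolding van_Nge_Jge by (rule van_Sge_Jge) (rule ex)
  ultimately have base: "\<not> van (Sge (wt t)) (Jge (wt t)) (Suc i)"
    using van_quotient[OF csys_Sge csys_Nge Jge_subset_Nge Nge_subset_Sge csys_Jge] by blast
  have "\<not> van (Sge (wt t - k)) (Jge (wt t - k)) (Suc i)" if "k \<le> wt t" for k
    using that
  proof (induction k)
    case (Suc k)
    define c where "c = wt t - Suc k"
    have c: "wt t - k = Suc c" using Suc.prems by (simp add: c_def)
    have "\<not> van (Nge c) (Jge c) (Suc i)" using Suc unfolding van_Nge_Jge c by simp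
    moreover have "van (Sge c) (Nge c) (Suc (Suc i))" unfolding van_Sge_Nge using ex(2) by blast
    ultimately have "\<not> van (Sge c) (Jge c) (Suc i)"
      using van_sub[OF csys_Sge csys_Nge Jge_subset_Nge Nge_subset_Sge] by blast
    then show ?case by (simp add: c_def)
  qed (use base in simp)
  from this[of "wt t"] show ?thesis by simp
qed

end

section \<open>The initial ideal of the binomial edge ideal of a closed graph\<close>

lemma carrier_mpoly_ring: "f \<in> carrier (mpoly_ring V) \<longleftrightarrow> (\<forall>m\<in>Poly_Mapping.keys f. Poly_Mapping.keys m \<subseteq> V)"
  by (simp add: mpoly_ring_def)

lemma mpoly_ring_simps [simp]:
  "x \<otimes>\<^bsub>mpoly_ring V\<^esub> y = x * y" "x \<oplus>\<^bsub>mpoly_ring V\<^esub> y = x + y"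
  "\<zero>\<^bsub>mpoly_ring V\<^esub> = 0" "\<one>\<^bsub>mpoly_ring V\<^esub> = 1"
  by (simp_all add: mpoly_ring_def)

lemma mpoly_carrier_closed:
  assumes "f \<in> carrier (mpoly_ring V)" "g \<in> carrier (mpoly_ring V)"
  shows "f + g \<in> carrier (mpoly_ring V)" "f * g \<in> carrier (mpoly_ring V)"
    "- f \<in> carrier (mpoly_ring V)" "f - g \<in> carrier (mpoly_ring V)"
proof -
  interpret R: cring "mpoly_ring V :: ('a, 'b) mpoly ring" by (rule mpoly_ring_cring)
  show "f + g \<in> carrier (mpoly_ring V)" "f * g \<in> carrier (mpoly_ring V)"
    using R.add.m_closed[OF assms] R.m_closed[OF assms] by simp_all
  have neg: "- h \<in> carrier (mpoly_ring V)" if "h \<in> carrier (mpoly_ring V)" for h :: "('a, 'b) mpoly"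
    using that by (simp add: carrier_mpoly_ring)
  show "- f \<in> carrier (mpoly_ring V)" by (rule neg[OF assms(1)])
  show "f - g \<in> carrier (mpoly_ring V)"
    using R.add.m_closed[OF assms(1) neg[OF assms(2)]] by simp
qed

lemma mpoly_carrier_neg: "f \<in> carrier (mpoly_ring V) \<Longrightarrow> - f \<in> carrier (mpoly_ring V)"
  by (rule mpoly_carrier_closed(3))

lemma mpoly_carrier_simps [simp]:
  "0 \<in> carrier (mpoly_ring V)" "1 \<in> carrier (mpoly_ring V)"
  "Poly_Mapping.single m c \<in> carrier (mpoly_ring V) \<longleftrightarrow> c = 0 \<or> Poly_Mapping.keys m \<subseteq> V"
  "Var v \<in> carrier (mpoly_ring V :: ('v, 'k::field) mpoly ring) \<longleftrightarrow> v \<in> V"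
  by (auto simp: carrier_mpoly_ring Var_def)

lemma mpoly_a_inv: "f \<in> carrier (mpoly_ring V) \<Longrightarrow> \<ominus>\<^bsub>mpoly_ring V\<^esub> f = - f"
proof -
  assume f: "f \<in> carrier (mpoly_ring V)"
  interpret R: cring "mpoly_ring V :: ('a, 'b) mpoly ring" by (rule mpoly_ring_cring)
  show "\<ominus>\<^bsub>mpoly_ring V\<^esub> f = - f"
    by (rule R.minus_equality) (use f mpoly_carrier_closed(3) in auto)
qed

lemma mpoly_idealI:
  fixes I :: "('v, 'k::field) mpoly set"
  assumes "I \<subseteq> carrier (mpoly_ring V)" "0 \<in> I"
    and "\<And>f g. f \<in> I \<Longrightarrow> g \<in> I \<Longrightarrow> f + g \<in> I"
    and mult: "\<And>f g. f \<in> carrier (mpoly_ring V) \<Longrightarrow> g \<in> I \<Longrightarrow> f * g \<in> I"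
  shows "ideal I (mpoly_ring V)"
proof -
  interpret R: cring "mpoly_ring V :: ('v, 'k) mpoly ring" by (rule mpoly_ring_cring)
  have neg: "- f \<in> I" if "f \<in> I" for f
  proof -
    have "(- 1) * f \<in> I" using that by (intro mult mpoly_carrier_neg) auto
    then show ?thesis by simp
  qed
  show ?thesis
  proof (rule idealI[OF R.ring_axioms])
    show "subgroup I (add_monoid (mpoly_ring V))"
    proof (rule R.add.subgroupI)
      show "\<ominus>\<^bsub>mpoly_ring V\<^esub> f \<in> I" if "f \<in> I" for f
        using that neg assms(1) mpoly_a_inv by (metis subsetD)
    qed (use assms in auto)
    show "x \<otimes>\<^bsub>mpoly_ring V\<^esub> a \<in> I" "a \<otimes>\<^bsub>mpoly_ring V\<^esub> x \<in> I"
      if "a \<in> I" "x \<in> carrier (mpoly_ring V)" for a x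
      using mult[OF that(2,1)] by (simp_all add: mult.commute)
  qed
qed

context
  fixes I :: "('v, 'k::field) mpoly set" and V
  assumes I: "ideal I (mpoly_ring V)"
begin

interpretation ideal I "mpoly_ring V" by (rule I)

lemma mpoly_ideal_closed:
  shows "I \<subseteq> carrier (mpoly_ring V)" "0 \<in> I" "f \<in> I \<Longrightarrow> g \<in> I \<Longrightarrow> f + g \<in> I"
    "f \<in> I \<Longrightarrow> - f \<in> I" "h \<in> carrier (mpoly_ring V) \<Longrightarrow> f \<in> I \<Longrightarrow> h * f \<in> I"
proof -
  show sub: "I \<subseteq> carrier (mpoly_ring V)" using a_subset .
  show "0 \<in> I" using additive_subgroup.zero_closed[OF is_additive_subgroup] by simp
  show "f \<in> I \<Longrightarrow> g \<in> I \<Longrightarrow> f + g \<in> I" using additive_subgroup.a_closed[OF is_additive_subgroup, of f g] by simp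
  show mult: "f \<in> I \<Longrightarrow> h \<in> carrier (mpoly_ring V) \<Longrightarrow> h * f \<in> I" for h f using I_l_closed[of f h] by simp
  show "- f \<in> I" if "f \<in> I"
  proof -
    have "- 1 \<in> carrier (mpoly_ring V :: ('v, 'k) mpoly ring)"
      by (rule mpoly_carrier_neg) simp
    then show ?thesis using mult[OF that, of "- 1"] by simp
  qed
qed

end

lemma poly_mapping_sum_singles:
  "f = (\<Sum>m\<in>Poly_Mapping.keys f. Poly_Mapping.single m (Poly_Mapping.lookup f m))"
  by (rule poly_mapping_eqI)
    (auto simp: lookup_sum lookup_single when_def in_keys_iff sum.delta' sum.delta)

lemma mpoly_genideal:
  assumes "S \<subseteq> carrier (mpoly_ring V :: ('v, 'k::field) mpoly ring)"
  shows "ideal (Idl\<^bsub>mpoly_ring V\<^esub> S) (mpoly_ring V)" "S \<subseteq> Idl\<^bsub>mpoly_ring V\<^esub> S"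
    "\<And>I. ideal I (mpoly_ring V) \<Longrightarrow> S \<subseteq> I \<Longrightarrow> Idl\<^bsub>mpoly_ring V\<^esub> S \<subseteq> I"
proof -
  interpret R: cring "mpoly_ring V :: ('v, 'k) mpoly ring" by (rule mpoly_ring_cring)
  show "ideal (Idl\<^bsub>mpoly_ring V\<^esub> S) (mpoly_ring V)" "S \<subseteq> Idl\<^bsub>mpoly_ring V\<^esub> S"
    "\<And>I. ideal I (mpoly_ring V) \<Longrightarrow> S \<subseteq> I \<Longrightarrow> Idl\<^bsub>mpoly_ring V\<^esub> S \<subseteq> I"
    using R.genideal_ideal[OF assms] R.genideal_self[OF assms] R.genideal_minimal by auto
qed

section \<open>Weights and degrees of monomials\<close>

definition wsum :: "('v \<Rightarrow> nat) \<Rightarrow> ('v \<Rightarrow>\<^sub>0 nat) \<Rightarrow> nat" where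
  "wsum w m = (\<Sum>v\<in>Poly_Mapping.keys m. Poly_Mapping.lookup m v * w v)"

lemma wsum_add: "wsum w (s + t) = wsum w s + wsum w t"
  unfolding wsum_def by (rule setsum_keys_plus_distrib) (simp_all add: distrib_right)

lemma wsum_single: "wsum w (Poly_Mapping.single v a) = a * w v"
  by (simp add: wsum_def)

lemma mon_degree_wsum: "mon_degree = wsum (\<lambda>_. 1)"
  by (simp add: fun_eq_iff mon_degree_def wsum_def)

lemma mon_degree_add: "mon_degree (s + t) = mon_degree s + mon_degree t"
  by (simp add: mon_degree_wsum wsum_add)

lemma mon_degree_sqf: "finite A \<Longrightarrow> mon_degree (sqf A) = card A"
  by (simp add: mon_degree_def keys_sqf lookup_sqf)

text \<open>The grading by vertices: \<open>XV i\<close> and \<open>YV i\<close> both have the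
  \<open>i\<close>-th unit vector as degree. The generators of a binomial edge ideal are homogeneous
  for it, although not for the fine grading.\<close>

definition vdeg :: "(xy_var \<Rightarrow>\<^sub>0 nat) \<Rightarrow> nat \<Rightarrow> nat" where
  "vdeg m i = Poly_Mapping.lookup m (XV i) + Poly_Mapping.lookup m (YV i)"

lemma vdeg_add: "vdeg (s + t) = (\<lambda>i. vdeg s i + vdeg t i)"
  by (simp add: vdeg_def lookup_add fun_eq_iff)

fun xweight :: "xy_var \<Rightarrow> nat" where
  "xweight (XV i) = i"
| "xweight (YV i) = 0"

abbreviation (input) Xm :: "nat \<Rightarrow> (xy_var \<Rightarrow>\<^sub>0 nat)" where "Xm i \<equiv> Poly_Mapping.single (XV i) 1"
abbreviation (input) Ym :: "nat \<Rightarrow> (xy_var \<Rightarrow>\<^sub>0 nat)" where "Ym i \<equiv> Poly_Mapping.single (YV i) 1"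

lemma split_off_var: "0 < Poly_Mapping.lookup s v \<Longrightarrow> \<exists>r. s = r + Poly_Mapping.single v (1::nat)"
  by (intro exI[of _ "s - Poly_Mapping.single v 1"] poly_mapping_eqI)
    (auto simp: lookup_add lookup_minus lookup_single when_def)

locale closed_graph_ideal = closed_graph far for far :: "nat \<Rightarrow> nat" +
  fixes n :: nat and E :: "nat set set"
  assumes E: "1 \<le> i \<Longrightarrow> i < j \<Longrightarrow> j \<le> n \<Longrightarrow> {i, j} \<in> E \<longleftrightarrow> j \<le> far i"
begin

abbreviation V :: "xy_var set" where "V \<equiv> xy_vars n"

lemma finite_V: "finite V"
  by (simp add: xy_vars_def)

lemma XV_in_V [simp]: "XV i \<in> V \<longleftrightarrow> 1 \<le> i \<and> i \<le> n" and YV_in_V [simp]: "YV i \<in> V \<longleftrightarrow> 1 \<le> i \<and> i \<le> n"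
  by (auto simp: xy_vars_def)

text \<open>
  Modulo the generators \<open>x\<^sub>i y\<^sub>j - x\<^sub>j y\<^sub>i\<close> two monomials are congruent if and only if they are connected
  by these moves.  Confluence of the moves takes the place of Buchberger's criterion.
\<close>

inductive move :: "(xy_var \<Rightarrow>\<^sub>0 nat) \<Rightarrow> (xy_var \<Rightarrow>\<^sub>0 nat) \<Rightarrow> bool" where
  "1 \<le> i \<Longrightarrow> i < j \<Longrightarrow> j \<le> n \<Longrightarrow> j \<le> far i \<Longrightarrow> move (s + Xm i + Ym j) (s + Xm j + Ym i)"

definition nonstd :: "(xy_var \<Rightarrow>\<^sub>0 nat) \<Rightarrow> bool" where
  "nonstd m \<longleftrightarrow> \<not> indep (Poly_Mapping.keys m)"

lemma moveI:
  assumes "1 \<le> i" "i < j" "j \<le> n" "j \<le> far i" "m = s + Xm i + Ym j" "m' = s + Xm j + Ym i"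
  shows "move m m'"
  unfolding assms(5,6) by (rule move.intros) (rule assms)+

lemma move_add: "move m m' \<Longrightarrow> move (s + m) (s + m')"
proof (induction rule: move.induct)
  case (1 i j r)
  then show ?case by (intro moveI[of i j _ "s + r"]) (simp_all only: ac_simps)
qed

text \<open>Moves on disjoint pairs of variables commute. If two different moves share a variable,
  their results are one move apart, and closedness of the graph supplies the edge for it.\<close>

lemma strong_confluentp_move: "strong_confluentp move"
proof
  fix m m1 m2 assume "move m m1" "move m m2"
  from \<open>move m m1\<close> obtain i j s where 1: "m = s + Xm i + Ym j" "m1 = s + Xm j + Ym i"
    "1 \<le> i" "i < j" "j \<le> n" "j \<le> far i" by cases
  from \<open>move m m2\<close> obtain k l s' where 2: "m = s' + Xm k + Ym l" "m2 = s' + Xm l + Ym k"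
    "1 \<le> k" "k < l" "l \<le> n" "l \<le> far k" by cases
  have eq: "s + Xm i + Ym j = s' + Xm k + Ym l" using 1(1) 2(1) by simp
  have lk: "Poly_Mapping.lookup s v + Poly_Mapping.lookup (Xm i) v + Poly_Mapping.lookup (Ym j) v
      = Poly_Mapping.lookup s' v + Poly_Mapping.lookup (Xm k) v + Poly_Mapping.lookup (Ym l) v" for v
    using arg_cong[OF eq, of "\<lambda>p. Poly_Mapping.lookup p v"] by (simp only: lookup_add)
  consider "i = k" "j = l" | "i = k" "j \<noteq> l" | "i \<noteq> k" "j = l" | "i \<noteq> k" "j \<noteq> l" by blast
  then show "\<exists>u. move\<^sup>*\<^sup>* m1 u \<and> move\<^sup>=\<^sup>= m2 u"
  proof cases
    case 1
    then have "m1 = m2" using \<open>m1 = _\<close> 2 eq by simp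
    then show ?thesis by auto
  next
    case 2
    then obtain r where r: "s = r + Ym l" using lk[of "YV l"] split_off_var[of s "YV l"] by (auto simp: lookup_single when_def split: if_splits)
    have "(r + Ym j) + (Xm i + Ym l) = s' + (Xm i + Ym l)" using eq r 2 by (simp only: ac_simps)
    then have s': "s' = r + Ym j" by (simp only: add_right_cancel)
    show ?thesis
    proof (cases "j < l")
      case True
      \<comment> \<open>The factor \<open>XV j * YV l\<close> becomes \<open>XV l * YV j\<close>;
        the edge \<open>{j, l}\<close> exists because
        \<open>l \<le> far i \<le> far j\<close>.\<close>
      have "move m1 m2"
        by (rule moveI[of j l _ "r + Ym i"]) (use 1 2 \<open>k < l\<close> \<open>l \<le> n\<close> \<open>l \<le> far k\<close> \<open>m2 = _\<close> True r s' far_mono[of i j] in \<open>auto simp: ac_simps\<close>)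
      then show ?thesis by blast
    next
      case False
      have "move m2 m1"
        by (rule moveI[of l j _ "r + Ym i"]) (use 1 2 \<open>k < l\<close> \<open>l \<le> n\<close> \<open>l \<le> far k\<close> \<open>m2 = _\<close> False r s' far_mono[of k l] in \<open>auto simp: ac_simps\<close>)
      then show ?thesis by blast
    qed
  next
    case 3
    then obtain r where r: "s = r + Xm k" using lk[of "XV k"] split_off_var[of s "XV k"] by (auto simp: lookup_single when_def split: if_splits)
    have "(r + Xm i) + (Xm k + Ym j) = s' + (Xm k + Ym j)" using eq r 3 by (simp only: ac_simps)
    then have s': "s' = r + Xm i" by (simp only: add_right_cancel)
    show ?thesis
    proof (cases "i < k")
      case True
      \<comment> \<open>The factor \<open>XV i * YV k\<close> becomes \<open>XV k * YV i\<close>;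
        the edge \<open>{i, k}\<close> exists because \<open>k < j \<le> far i\<close>.\<close>
      have "move m2 m1"
        by (rule moveI[of i k _ "r + Xm j"]) (use 1 3 \<open>k < l\<close> \<open>l \<le> n\<close> \<open>l \<le> far k\<close> \<open>m2 = _\<close> True r s' in \<open>auto simp: ac_simps\<close>)
      then show ?thesis by blast
    next
      case False
      have "move m1 m2"
        by (rule moveI[of k i _ "r + Xm j"]) (use 1 3 \<open>1 \<le> k\<close> \<open>k < l\<close> \<open>l \<le> n\<close> \<open>l \<le> far k\<close> \<open>m2 = _\<close> False r s' in \<open>auto simp: ac_simps\<close>)
      then show ?thesis by blast
    qed
  next
    case 4
    then obtain r' where r': "s = r' + Ym l" using lk[of "YV l"] split_off_var[of s "YV l"] by (auto simp: lookup_single when_def split: if_splits)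
    have "Poly_Mapping.lookup r' (XV k) > 0" using lk[of "XV k"] 4 r' by (auto simp: lookup_add lookup_single when_def split: if_splits)
    then obtain r where r: "r' = r + Xm k" using split_off_var[of r' "XV k"] by auto
    have "(r + Xm i + Ym j) + (Xm k + Ym l) = s' + (Xm k + Ym l)" using eq r r' by (simp only: ac_simps)
    then have s': "s' = r + Xm i + Ym j" by (simp only: add_right_cancel)
    define u where "u = r + Xm j + Ym i + Xm l + Ym k"
    have "move m1 u"
      by (rule moveI[of k l _ "r + Xm j + Ym i"]) (use 1(2) r r' 2 in \<open>simp_all only: ac_simps u_def\<close>)
    moreover have "move m2 u"
      by (rule moveI[of i j _ "r + Xm l + Ym k"]) (use 1 2(2) s' in \<open>simp_all only: ac_simps u_def\<close>)
    ultimately show ?thesis by blast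
  qed
qed

lemma move_imp_nonstd: "move m m' \<Longrightarrow> nonstd m"
proof (induction rule: move.induct)
  case (1 i j s)
  have "XV i \<in> Poly_Mapping.keys (s + Xm i + Ym j)" "YV j \<in> Poly_Mapping.keys (s + Xm i + Ym j)"
    by (simp_all add: keys_add_nat)
  moreover have "adj (XV i) (YV j)" using 1 by simp
  ultimately show ?case unfolding nonstd_def indep_def by blast
qed

lemma nonstd_imp_move:
  assumes "Poly_Mapping.keys m \<subseteq> V" "nonstd m" obtains m' where "move m m'"
proof -
  obtain u v where uv: "u \<in> Poly_Mapping.keys m" "v \<in> Poly_Mapping.keys m" "adj u v"
    using assms(2) unfolding nonstd_def indep_def by blast
  then obtain i j where ij: "XV i \<in> Poly_Mapping.keys m" "YV j \<in> Poly_Mapping.keys m" "i < j" "j \<le> far i"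
    by (cases u; cases v) auto
  obtain r where r: "m = r + Ym j" using ij(2) split_off_var[of m "YV j"] by (auto simp: in_keys_iff)
  have "0 < Poly_Mapping.lookup r (XV i)" using ij(1) r by (auto simp: in_keys_iff lookup_add lookup_single)
  then obtain s where "r = s + Xm i" using split_off_var[of r "XV i"] by auto
  moreover have "1 \<le> i" "j \<le> n" using ij assms(1) by auto
  ultimately have "move m (s + Xm j + Ym i)" using ij r by (intro moveI) auto
  then show ?thesis by (rule that)
qed

lemma move_invariants:
  assumes "move m m'"
  shows "vdeg m' = vdeg m" "mon_degree m' = mon_degree m" "wsum xweight m < wsum xweight m'"
    "Poly_Mapping.keys m \<subseteq> V \<Longrightarrow> Poly_Mapping.keys m' \<subseteq> V"
  using assms
  by (induction rule: move.induct)
    (auto simp: vdeg_add vdeg_def lookup_single when_def mon_degree_wsum wsum_add wsum_single keys_add_nat)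

text \<open>The linear functional given by its values on monomials. Functionals that are constant
  along moves vanish on the ideal and detect standard monomials.\<close>

definition pairing :: "((xy_var \<Rightarrow>\<^sub>0 nat) \<Rightarrow> 'k) \<Rightarrow> (xy_var, 'k::field) mpoly \<Rightarrow> 'k" where
  "pairing \<theta> f = (\<Sum>m\<in>Poly_Mapping.keys f. Poly_Mapping.lookup f m * \<theta> m)"

lemma pairing_add: "pairing \<theta> (f + g) = pairing \<theta> f + pairing \<theta> g"
  unfolding pairing_def by (rule setsum_keys_plus_distrib) (simp_all add: distrib_right)

lemma pairing_0 [simp]: "pairing \<theta> 0 = 0"
  by (simp add: pairing_def)

lemma pairing_sum: "pairing \<theta> (sum f B) = (\<Sum>b\<in>B. pairing \<theta> (f b))"
  by (induction B rule: infinite_finite_induct) (simp_all add: pairing_add)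

lemma pairing_single: "pairing \<theta> (Poly_Mapping.single m c) = c * \<theta> m"
  by (simp add: pairing_def)

lemma pairing_single_mult:
  "pairing \<theta> (Poly_Mapping.single s c * f) = c * pairing (\<lambda>m. \<theta> (s + m)) f"
proof -
  have "Poly_Mapping.single s c * f
      = (\<Sum>m\<in>Poly_Mapping.keys f. Poly_Mapping.single (s + m) (c * Poly_Mapping.lookup f m))"
    by (subst (1) poly_mapping_sum_singles[of f]) (simp add: sum_distrib_left mult_single)
  then show ?thesis
    by (simp add: pairing_sum pairing_single) (simp add: pairing_def sum_distrib_left mult.assoc)
qed

definition invariant :: "((xy_var \<Rightarrow>\<^sub>0 nat) \<Rightarrow> 'k) \<Rightarrow> bool" where
  "invariant \<theta> \<longleftrightarrow> (\<forall>m m'. move m m' \<longrightarrow> \<theta> m = \<theta> m')"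

abbreviation J :: "(xy_var, 'k::field) mpoly set" where
  "J \<equiv> binomial_edge_ideal n E"

abbreviation gens :: "(xy_var, 'k::field) mpoly set" where
  "gens \<equiv> {Var (XV i) * Var (YV j) - Var (XV j) * Var (YV i) |i j.
        i \<in> {1..n} \<and> j \<in> {1..n} \<and> i < j \<and> {i, j} \<in> E}"

lemma gens_carrier: "gens \<subseteq> carrier (mpoly_ring V)"
  by (auto intro!: mpoly_carrier_closed)

lemma ideal_J: "ideal J (mpoly_ring V)"
  unfolding binomial_edge_ideal_def by (rule mpoly_genideal[OF gens_carrier])

lemma gens_subset_J: "gens \<subseteq> J"
  unfolding binomial_edge_ideal_def by (rule mpoly_genideal[OF gens_carrier])

lemma gen_eq: "Var (XV i) * Var (YV j) - Var (XV j) * Var (YV i)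
    = Poly_Mapping.single (Xm i + Ym j) 1 - Poly_Mapping.single (Xm j + Ym i) (1 :: 'k::field)"
  by (simp add: Var_def mult_single)

text \<open>The polynomials killed by all invariant functionals form an ideal: multiplying by a
  monomial translates the functional, and translates of invariant functionals are invariant. This is
  why \<open>I\<close> quantifies over all of them.\<close>

lemma pairing_J:
  fixes f :: "(xy_var, 'k::field) mpoly"
  assumes "f \<in> J" "invariant \<theta>" shows "pairing \<theta> f = 0"
proof -
  define I :: "(xy_var, 'k) mpoly set" where
    "I = {f \<in> carrier (mpoly_ring V). \<forall>\<theta>. invariant \<theta> \<longrightarrow> pairing \<theta> f = 0}"
  have "ideal I (mpoly_ring V)"
  proof (rule mpoly_idealI)
    fix f g :: "(xy_var, 'k) mpoly"
    assume f: "f \<in> carrier (mpoly_ring V)" and g: "g \<in> I"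
    have "pairing \<theta> (f * g) = 0" if "invariant \<theta>" for \<theta>
    proof -
      have "invariant (\<lambda>m. \<theta> (s + m))" for s
        using that move_add unfolding invariant_def by blast
      then have "pairing (\<lambda>m. \<theta> (s + m)) g = 0" for s using g by (simp add: I_def)
      moreover have "f * g = (\<Sum>m\<in>Poly_Mapping.keys f. Poly_Mapping.single m (Poly_Mapping.lookup f m) * g)"
        by (subst (1) poly_mapping_sum_singles[of f]) (simp add: sum_distrib_right)
      ultimately show ?thesis by (simp add: pairing_sum pairing_single_mult)
    qed
    then show "f * g \<in> I" using mpoly_carrier_closed(2)[OF f, of g] g by (simp add: I_def)
  qed (auto simp: I_def pairing_add mpoly_carrier_closed)
  moreover have "gens \<subseteq> I"
  proof
    fix g :: "(xy_var, 'k) mpoly" assume g: "g \<in> gens"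
    then obtain i j where ij: "g = Var (XV i) * Var (YV j) - Var (XV j) * Var (YV i)"
      "1 \<le> i" "j \<le> n" "i < j" "{i, j} \<in> E" by auto
    have "move (0 + Xm i + Ym j) (0 + Xm j + Ym i)"
      by (rule move.intros) (use ij E[of i j] in auto)
    then have "pairing \<theta> g = 0" if "invariant \<theta>" for \<theta>
      using that pairing_add[of \<theta> g "Poly_Mapping.single (Xm j + Ym i) 1"]
      unfolding ij(1) gen_eq invariant_def by (simp add: pairing_single)
    moreover have "g \<in> carrier (mpoly_ring V)" using g gens_carrier by blast
    ultimately show "g \<in> I" by (simp add: I_def)
  qed
  ultimately have "J \<subseteq> I"
    unfolding binomial_edge_ideal_def by (rule mpoly_genideal(3)[OF gens_carrier])
  then show ?thesis using assms by (auto simp: I_def)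
qed

text \<open>A standard monomial \<open>m\<close> is a normal form, and by confluence the indicator
  of the monomials reducing to \<open>m\<close> is invariant, so it vanishes on \<open>f\<close>. On
  the support of \<open>f\<close> it singles out \<open>m\<close>, whose coefficient would then be
  zero.\<close>

lemma lowest_nonstd:
  fixes f :: "(xy_var, 'k::field) mpoly"
  assumes f: "f \<in> J" "m \<in> Poly_Mapping.keys f"
    and min: "\<And>m'. m' \<in> Poly_Mapping.keys f \<Longrightarrow> wsum xweight m \<le> wsum xweight m'"
  shows "nonstd m"
proof (rule ccontr)
  assume std: "\<not> nonstd m"
  have conf: "confluentp move"
    by (rule strong_confluentp_imp_confluentp[OF strong_confluentp_move])
  have final: "u = m" if "move\<^sup>*\<^sup>* m u" for u
    using that std by (metis converse_rtranclpE move_imp_nonstd)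
  define \<theta> :: "(xy_var \<Rightarrow>\<^sub>0 nat) \<Rightarrow> 'k" where "\<theta> k = (if move\<^sup>*\<^sup>* k m then 1 else 0)" for k
  have "invariant \<theta>"
    unfolding invariant_def
  proof (intro allI impI)
    fix k k' assume move: "move k k'"
    have "move\<^sup>*\<^sup>* k' m" if "move\<^sup>*\<^sup>* k m"
      using confluentpD[OF conf that, of k'] move final by (metis r_into_rtranclp)
    moreover have "move\<^sup>*\<^sup>* k m" if "move\<^sup>*\<^sup>* k' m"
      using move that by (rule converse_rtranclp_into_rtranclp)
    ultimately show "\<theta> k = \<theta> k'" unfolding \<theta>_def by metis
  qed
  then have "pairing \<theta> f = 0" by (rule pairing_J[OF f(1)])
  \<comment> \<open>Moves raise the weight, so any other monomial reducing to \<open>m\<close> would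
    be lighter than \<open>m\<close>.\<close>
  moreover have "\<theta> k = (if k = m then 1 else 0)" if "k \<in> Poly_Mapping.keys f" for k
  proof (cases "k = m")
    case False
    have "wsum xweight a < wsum xweight b" if "move\<^sup>+\<^sup>+ a b" for a b
      using that by induction (use move_invariants(3) less_trans in blast)+
    then have "\<not> move\<^sup>*\<^sup>* k m" using min[OF that] False by (metis leD rtranclpD)
    then show ?thesis using False by (simp add: \<theta>_def)
  qed (simp add: \<theta>_def)
  then have "pairing \<theta> f = (\<Sum>k\<in>Poly_Mapping.keys f. if k = m then Poly_Mapping.lookup f m else 0)"
    unfolding pairing_def by (intro sum.cong) auto
  ultimately show False using f(2) by (simp add: in_keys_iff)
qed

lemma move_diff_in_J:
  assumes "move m m'" "Poly_Mapping.keys m \<subseteq> V"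
  shows "Poly_Mapping.single m c - Poly_Mapping.single m' c \<in> (J :: (xy_var, 'k::field) mpoly set)"
  using assms
proof (induction rule: move.induct)
  case (1 i j s)
  have "Var (XV i) * Var (YV j) - Var (XV j) * Var (YV i) \<in> (J :: (xy_var, 'k) mpoly set)"
    using 1 E[of i j] by (intro subsetD[OF gens_subset_J]) force
  moreover have "Poly_Mapping.single s c \<in> carrier (mpoly_ring V)"
    using 1 by (auto simp: keys_add_nat)
  ultimately have "Poly_Mapping.single s c * (Var (XV i) * Var (YV j) - Var (XV j) * Var (YV i)) \<in> J"
    by (intro mpoly_ideal_closed(5)[OF ideal_J])
  then show ?case by (simp add: gen_eq right_diff_distrib mult_single add.assoc)
qed

text \<open>With \<open>UNIV\<close> these are all fine degrees of total degree \<open>d\<close>,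
  with a singleton those of one vertex degree. Either way they are stable under moves.\<close>

definition block :: "(nat \<Rightarrow> nat) set \<Rightarrow> nat \<Rightarrow> (xy_var \<Rightarrow>\<^sub>0 nat) set" where
  "block \<A> d = {t. Poly_Mapping.keys t \<subseteq> V \<and> vdeg t \<in> \<A> \<and> mon_degree t = d}"

lemma degeneration_J:
  "degeneration V (J :: (xy_var, 'k::field) mpoly set) (wsum xweight) nonstd (block \<A> d) (n * d)"
proof
  note J = mpoly_ideal_closed[OF ideal_J]
  show "finite V" by (rule finite_V)
  show "0 \<in> (J :: (xy_var, 'k) mpoly set)" by (rule J)
  show "f + g \<in> J" if "f \<in> J" "g \<in> J" for f g :: "(xy_var, 'k) mpoly" using that by (rule J)
  show "- f \<in> J" if "f \<in> J" for f :: "(xy_var, 'k) mpoly" using that by (rule J)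
  show "Var v * f \<in> J" if "v \<in> V" "f \<in> J" for v and f :: "(xy_var, 'k) mpoly"
    using that by (intro J) simp_all
  show "wsum xweight (s + t) = wsum xweight s + wsum xweight t" for s t by (rule wsum_add)
  show "Poly_Mapping.keys t \<subseteq> V" if "t \<in> block \<A> d" for t using that by (simp add: block_def)
  show "wsum xweight t \<le> n * d" if t: "t \<in> block \<A> d" for t
  proof -
    have "wsum xweight t \<le> (\<Sum>v\<in>Poly_Mapping.keys t. Poly_Mapping.lookup t v * n)"
      unfolding wsum_def
    proof (intro sum_mono mult_left_mono)
      fix v assume "v \<in> Poly_Mapping.keys t"
      then have "v \<in> V" using t by (auto simp: block_def)
      then show "xweight v \<le> n" by (cases v) auto
    qed simp
    also have "\<dots> = n * d" using t by (simp add: block_def mon_degree_def flip: sum_distrib_right)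
    finally show ?thesis .
  qed
  show "nonstd (m + m')" if "nonstd m" for m m'
    using that indep_mono[of "Poly_Mapping.keys (m + m')" "Poly_Mapping.keys m"]
    by (auto simp: nonstd_def keys_add_nat)
  show "nonstd m" if "f \<in> J" "m \<in> Poly_Mapping.keys f"
    "\<And>m'. m' \<in> Poly_Mapping.keys f \<Longrightarrow> wsum xweight m \<le> wsum xweight m'"
    for f :: "(xy_var, 'k) mpoly" and m
    using that by (rule lowest_nonstd)
  show "\<exists>m'. m' + sqf A \<in> block \<A> d \<and> wsum xweight m < wsum xweight m' \<and>
      (\<forall>c. Poly_Mapping.single m c - Poly_Mapping.single m' c \<in> (J :: (xy_var, 'k) mpoly set))"
    if mA: "A \<subseteq> V" "m + sqf A \<in> block \<A> d" "nonstd m" for A m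
  proof -
    have keys: "Poly_Mapping.keys m \<subseteq> V" using mA(2) by (simp add: block_def keys_add_nat)
    obtain m' where m': "move m m'" by (rule nonstd_imp_move[OF keys mA(3)])
    then show ?thesis
      using move_invariants[OF m'] move_diff_in_J[OF m' keys] keys mA(2)
      by (intro exI[of _ m']) (auto simp: block_def keys_add_nat vdeg_add mon_degree_add)
  qed
qed

text \<open>A variable of exponent at least 2 in \<open>t\<close> stays in the support of the
  coefficient whether or not it belongs to \<open>A\<close>, so it is a cone point. Only squarefree
  degrees remain, and they give independence complexes.\<close>

lemma std_exact_block:
  assumes t: "t \<in> block \<A> d"
    and ex: "\<And>W. sqf W \<in> block \<A> d \<Longrightarrow> W \<subseteq> V \<Longrightarrow> card W = d \<Longrightarrow> ex_indep TYPE('k::field) W i"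
  shows "degeneration.std_exact TYPE('k) nonstd t i"
proof -
  interpret D: degeneration V "J :: (xy_var, 'k) mpoly set" "wsum xweight" nonstd "block \<A> d" "n * d"
    by (rule degeneration_J)
  show ?thesis
  proof (cases "\<forall>v\<in>Poly_Mapping.keys t. Poly_Mapping.lookup t v = 1")
    case True
    define W where "W = Poly_Mapping.keys t"
    have "Poly_Mapping.lookup t v = Poly_Mapping.lookup (sqf W) v" for v
      using True by (cases "v \<in> W") (auto simp: W_def lookup_sqf in_keys_iff)
    then have tW: "t = sqf W" by (rule poly_mapping_eqI)
    have "finite W" by (simp add: W_def)
    then have "card W = mon_degree t" unfolding tW by (simp only: mon_degree_sqf)
    moreover have "sqf W \<in> block \<A> d" using t unfolding tW .
    ultimately have "ex_indep TYPE('k) W i" using t by (intro ex) (auto simp: block_def W_def)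
    moreover have "\<not> nonstd (t - sqf A) \<longleftrightarrow> indep (W - A)" if "A \<subseteq> W" for A
    proof -
      have "finite A" using that finite_subset[of A W] by (simp add: W_def)
      then have "Poly_Mapping.keys (t - sqf A) = W - A"
        using True by (force simp: keys_diff_sqf W_def)
      then show ?thesis by (simp add: nonstd_def)
    qed
    then have "exact_at TYPE('k) W (\<lambda>A. \<not> nonstd (t - sqf A)) i \<longleftrightarrow> ex_indep TYPE('k) W i"
      unfolding ex_indep_def by (rule exact_at_cong)
    ultimately show ?thesis unfolding D.std_exact_def W_def[symmetric] by simp
  next
    case False
    then obtain v where v: "v \<in> Poly_Mapping.keys t" "Poly_Mapping.lookup t v \<noteq> 1" by blast
    then have "Poly_Mapping.lookup t v \<ge> 2" by (auto simp: in_keys_iff)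
    then have "Poly_Mapping.keys (t - sqf (insert v A)) = Poly_Mapping.keys (t - sqf A)"
      if "A \<subseteq> Poly_Mapping.keys t - {v}" for A
      using that finite_subset[OF that] by (auto simp: keys_diff_sqf)
    then show ?thesis
      unfolding D.std_exact_def by (intro exact_at_cone[of _ v]) (use v in \<open>auto simp: nonstd_def\<close>)
  qed
qed

end

section \<open>Graded Koszul homology\<close>

definition Sg :: "'v set \<Rightarrow> int \<Rightarrow> ('v, 'k::field) mpoly set" where
  "Sg V d = {f \<in> carrier (mpoly_ring V). homogeneous d f}"

text \<open>Vanishing of Tor of \<open>S/J\<close> and the residue field, in homological degree
  \<open>i\<close> and internal degree \<open>d\<close>; an exterior monomial on \<open>A\<close>
  has degree \<open>card A\<close>.\<close>

definition tor_van :: "'v::linorder set \<Rightarrow> ('v, 'k::field) mpoly set \<Rightarrow> nat \<Rightarrow> int \<Rightarrow> bool" where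
  "tor_van V J i d \<longleftrightarrow> koszul.van V pact (\<lambda>A. Sg V (d - int (card A)))
     (\<lambda>A. J \<inter> Sg V (d - int (card A))) i"

lemma (in koszul) van_cong:
  assumes "\<And>A. A \<subseteq> V \<Longrightarrow> M A = M' A" "\<And>A. A \<subseteq> V \<Longrightarrow> N A = N' A"
  shows "van M N i \<longleftrightarrow> van M' N' i"
  unfolding van_def using assms by simp

lemma Sg_alt: "f \<in> Sg V d \<longleftrightarrow>
    (\<forall>m\<in>Poly_Mapping.keys f. Poly_Mapping.keys m \<subseteq> V \<and> int (mon_degree m) = d)"
  by (auto simp: Sg_def carrier_mpoly_ring homogeneous_def)

definition fine_block :: "'v set \<Rightarrow> int \<Rightarrow> ('v \<Rightarrow>\<^sub>0 nat) set" where
  "fine_block V d = {t. Poly_Mapping.keys t \<subseteq> V \<and> int (mon_degree t) = d}"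

lemma Sg_msys:
  assumes "A \<subseteq> V" "finite A"
  shows "Sg V (d - int (card A)) = msys (\<lambda>t A. t \<in> fine_block V d) A"
proof -
  have "Poly_Mapping.keys m \<subseteq> V \<and> int (mon_degree m) = d - int (card A) \<longleftrightarrow> m + sqf A \<in> fine_block V d" for m
    using assms by (auto simp: fine_block_def keys_add_nat keys_sqf mon_degree_add mon_degree_sqf)
  then show ?thesis by (auto simp: Sg_alt msys_def)
qed

lemma csys_Sg:
  assumes "finite V" shows "koszul.csys V pact (\<lambda>A. Sg V (d - int (card A)) :: ('v::linorder, 'k::field) mpoly set)"
proof -
  interpret koszul V "pact :: 'v \<Rightarrow> ('v, 'k) mpoly \<Rightarrow> _" by (rule koszul_pact[OF assms])
  have "csys (msys (\<lambda>t A. t \<in> fine_block V d))" by (rule csys_msys[OF assms])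
  moreover have "Sg V (d - int (card A)) = (msys (\<lambda>t A. t \<in> fine_block V d) A :: ('v, 'k) mpoly set)"
    if "A \<subseteq> V" for A
    using Sg_msys[OF that] finite_subset[OF that assms] by blast
  ultimately show ?thesis unfolding csys_def by simp
qed

text \<open>With nothing divided out, every variable in the support of a fine degree is a cone
  point; only the unit in degree 0 survives.\<close>

lemma tor_van_zero:
  assumes V: "finite V" and id: "0 < i \<or> d \<noteq> 0"
  shows "tor_van V {0 :: ('v::linorder, 'k::field) mpoly} i d"
proof -
  interpret koszul V "pact :: 'v \<Rightarrow> ('v, 'k) mpoly \<Rightarrow> _" by (rule koszul_pact[OF V])
  have "van (msys (\<lambda>t A. t \<in> fine_block V d)) (msys (\<lambda>t A. t \<in> fine_block V d \<and> False)) i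
    \<longleftrightarrow> (\<forall>t\<in>fine_block V d. exact_at TYPE('k) (Poly_Mapping.keys t) (\<lambda>A. \<not> False) i)"
    by (rule van_msys_iff[OF V]) (auto simp: fine_block_def)
  moreover have "exact_at TYPE('k) (Poly_Mapping.keys t) (\<lambda>A. \<not> False) i" if t: "t \<in> fine_block V d" for t
  proof (cases "Poly_Mapping.keys t = {}")
    case True
    then have "i > 0" using id t by (auto simp: fine_block_def mon_degree_def)
    then show ?thesis using True by (simp add: exact_at_def)
  next
    case False
    then obtain v where "v \<in> Poly_Mapping.keys t" by blast
    then show ?thesis by (intro exact_at_cone[of _ v]) auto
  qed
  ultimately have "van (msys (\<lambda>t A. t \<in> fine_block V d)) (msys (\<lambda>t A. t \<in> fine_block V d \<and> False)) i"
    by blast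
  moreover have "van (\<lambda>A. Sg V (d - int (card A))) (\<lambda>A. {0} \<inter> Sg V (d - int (card A))) i \<longleftrightarrow>
      van (msys (\<lambda>t A. t \<in> fine_block V d)) (msys (\<lambda>t A. t \<in> fine_block V d \<and> False)) i"
  proof (rule van_cong)
    fix A assume A: "A \<subseteq> V"
    show "Sg V (d - int (card A)) = msys (\<lambda>t A. t \<in> fine_block V d) A"
      using Sg_msys[OF A] finite_subset[OF A V] by blast
    show "{0} \<inter> Sg V (d - int (card A)) = msys (\<lambda>t A. t \<in> fine_block V d \<and> False) A"
      by (auto simp: msys_def Sg_alt)
  qed
  ultimately show ?thesis unfolding tor_van_def by blast
qed

section \<open>Truncation of polynomials to a set of monomials\<close>

definition restrict_mpoly :: "(('v \<Rightarrow>\<^sub>0 nat) \<Rightarrow> bool) \<Rightarrow> ('v, 'k::field) mpoly \<Rightarrow> ('v, 'k) mpoly" where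
  "restrict_mpoly P f = (\<Sum>m\<in>{m\<in>Poly_Mapping.keys f. P m}. Poly_Mapping.single m (Poly_Mapping.lookup f m))"

lemma lookup_restrict_mpoly:
  "Poly_Mapping.lookup (restrict_mpoly P f) m = (if P m then Poly_Mapping.lookup f m else 0)"
proof -
  have "Poly_Mapping.lookup (restrict_mpoly P f) m
      = (\<Sum>k\<in>{k\<in>Poly_Mapping.keys f. P k}. if k = m then Poly_Mapping.lookup f m else 0)"
    unfolding restrict_mpoly_def lookup_sum lookup_single when_def by (rule sum.cong) auto
  then show ?thesis by (auto simp: in_keys_iff)
qed

lemma restrict_mpoly_add: "restrict_mpoly P (f + g) = restrict_mpoly P f + restrict_mpoly P g"
  by (rule poly_mapping_eqI) (simp add: lookup_restrict_mpoly lookup_add)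

lemma restrict_mpoly_minus: "restrict_mpoly P (- f) = - restrict_mpoly P f"
  by (rule poly_mapping_eqI) (simp add: lookup_restrict_mpoly)

lemma restrict_mpoly_diff: "restrict_mpoly P (f - g) = restrict_mpoly P f - restrict_mpoly P g"
  by (rule poly_mapping_eqI) (simp add: lookup_restrict_mpoly lookup_minus)

lemma restrict_mpoly_0 [simp]: "restrict_mpoly P 0 = 0"
  by (rule poly_mapping_eqI) (simp add: lookup_restrict_mpoly)

lemma restrict_mpoly_sum: "restrict_mpoly P (sum f B) = (\<Sum>b\<in>B. restrict_mpoly P (f b))"
  by (induction B rule: infinite_finite_induct) (simp_all add: restrict_mpoly_add)

lemma restrict_mpoly_ksgn: "restrict_mpoly P (ksgn v A f) = ksgn v A (restrict_mpoly P f)"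
  by (simp add: ksgn_def restrict_mpoly_minus)

lemma restrict_mpoly_id: "(\<And>m. m \<in> Poly_Mapping.keys f \<Longrightarrow> P m) \<Longrightarrow> restrict_mpoly P f = f"
  by (rule poly_mapping_eqI) (auto simp: lookup_restrict_mpoly in_keys_iff)

lemma restrict_mpoly_none: "(\<And>m. m \<in> Poly_Mapping.keys f \<Longrightarrow> \<not> P m) \<Longrightarrow> restrict_mpoly P f = 0"
  by (rule poly_mapping_eqI) (auto simp: lookup_restrict_mpoly in_keys_iff)

lemma restrict_mpoly_single_mult:
  "restrict_mpoly P (Poly_Mapping.single s c * f)
    = Poly_Mapping.single s c * restrict_mpoly (\<lambda>m. P (s + m)) f"
proof -
  define h where "h = f - restrict_mpoly (\<lambda>m. P (s + m)) f"
  define g where "g = restrict_mpoly (\<lambda>m. P (s + m)) f"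
  have keys: "P (s + m)" if "m \<in> Poly_Mapping.keys g" for m
    using that by (auto simp: g_def in_keys_iff lookup_restrict_mpoly split: if_splits)
  have keys': "\<not> P (s + m)" if "m \<in> Poly_Mapping.keys h" for m
    using that by (auto simp: h_def in_keys_iff lookup_restrict_mpoly lookup_minus split: if_splits)
  have "restrict_mpoly P (Poly_Mapping.single s c * g) = Poly_Mapping.single s c * g"
    by (rule restrict_mpoly_id) (auto elim!: keys_single_mult dest: keys)
  moreover have "restrict_mpoly P (Poly_Mapping.single s c * h) = 0"
    by (rule restrict_mpoly_none) (auto elim!: keys_single_mult dest: keys')
  moreover have "Poly_Mapping.single s c * f = Poly_Mapping.single s c * g + Poly_Mapping.single s c * h"
    by (simp add: g_def h_def flip: distrib_left)
  ultimately show ?thesis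
    unfolding g_def[symmetric] by (simp add: restrict_mpoly_add)
qed

lemma restrict_mpoly_Var_mult:
  "restrict_mpoly P (Var v * f) = Var v * restrict_mpoly (\<lambda>m. P (Poly_Mapping.single v 1 + m)) f"
  unfolding Var_def by (rule restrict_mpoly_single_mult)

lemma keys_restrict_mpoly: "Poly_Mapping.keys (restrict_mpoly P f) = {m \<in> Poly_Mapping.keys f. P m}"
  by (auto simp: in_keys_iff lookup_restrict_mpoly split: if_splits)

lemma restrict_mpoly_single:
  "restrict_mpoly P (Poly_Mapping.single m c) = (if P m then Poly_Mapping.single m c else 0)"
  by (rule poly_mapping_eqI) (auto simp: lookup_restrict_mpoly lookup_single when_def)

context closed_graph_ideal
begin

text \<open>An additive description of the ideal. Truncation is additive but does not commute with
  multiplication, so it can be followed along this form.\<close>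

inductive_set jspan :: "(xy_var, 'k::field) mpoly set" where
  zero: "0 \<in> jspan"
| step: "f \<in> jspan \<Longrightarrow> move m m' \<Longrightarrow> Poly_Mapping.keys m \<subseteq> V \<Longrightarrow>
    (Poly_Mapping.single m c - Poly_Mapping.single m' c) + f \<in> jspan"

lemma jspan_add: "f \<in> jspan \<Longrightarrow> g \<in> jspan \<Longrightarrow> f + g \<in> jspan"
  by (induction rule: jspan.induct) (auto simp: add.assoc intro: jspan.intros)

lemma jspan_sum: "(\<And>b. b \<in> B \<Longrightarrow> f b \<in> jspan) \<Longrightarrow> sum f B \<in> jspan"
  by (induction B rule: infinite_finite_induct) (auto intro: jspan_add jspan.zero)

lemma jspan_single: "move m m' \<Longrightarrow> Poly_Mapping.keys m \<subseteq> V \<Longrightarrow>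
    Poly_Mapping.single m c - Poly_Mapping.single m' c \<in> jspan"
  using jspan.step[OF jspan.zero] by simp

lemma jspan_carrier: "f \<in> jspan \<Longrightarrow> f \<in> carrier (mpoly_ring V)"
  by (induction rule: jspan.induct)
    (auto intro!: mpoly_carrier_closed dest: move_invariants(4))

lemma jspan_single_mult:
  assumes "f \<in> jspan" "Poly_Mapping.keys s \<subseteq> V"
  shows "Poly_Mapping.single s a * f \<in> jspan"
  using assms(1)
proof (induction rule: jspan.induct)
  case (step f m m' c)
  have "Poly_Mapping.single s a * (Poly_Mapping.single m c - Poly_Mapping.single m' c)
      = Poly_Mapping.single (s + m) (a * c) - Poly_Mapping.single (s + m') (a * c)"
    by (simp add: right_diff_distrib mult_single)
  moreover have "\<dots> \<in> jspan"
    using step assms(2) by (intro jspan_single move_add) (auto simp: keys_add_nat)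
  ultimately show ?case using step.IH by (simp only: distrib_left jspan_add)
qed (simp add: jspan.zero)

lemma J_subset_jspan: "(J :: (xy_var, 'k::field) mpoly set) \<subseteq> jspan"
  unfolding binomial_edge_ideal_def
proof (rule mpoly_genideal(3)[OF gens_carrier])
  show "ideal (jspan :: (xy_var, 'k) mpoly set) (mpoly_ring V)"
  proof (rule mpoly_idealI)
    fix f g :: "(xy_var, 'k) mpoly" assume f: "f \<in> carrier (mpoly_ring V)" and g: "g \<in> jspan"
    have "(\<Sum>m\<in>Poly_Mapping.keys f. Poly_Mapping.single m (Poly_Mapping.lookup f m) * g) \<in> jspan"
      by (rule jspan_sum, rule jspan_single_mult) (use f g in \<open>auto simp: carrier_mpoly_ring\<close>)
    then show "f * g \<in> jspan"
      by (subst poly_mapping_sum_singles[of f]) (simp add: sum_distrib_right)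
  qed (use jspan_carrier in \<open>auto intro: jspan_add jspan.zero\<close>)
  show "gens \<subseteq> (jspan :: (xy_var, 'k) mpoly set)"
  proof
    fix g :: "(xy_var, 'k) mpoly" assume "g \<in> gens"
    then obtain i j where ij: "g = Var (XV i) * Var (YV j) - Var (XV j) * Var (YV i)"
      "1 \<le> i" "j \<le> n" "i < j" "{i, j} \<in> E" by auto
    have "move (0 + Xm i + Ym j) (0 + Xm j + Ym i)"
      by (rule move.intros) (use ij E[of i j] in auto)
    then have "Poly_Mapping.single (Xm i + Ym j) 1 - Poly_Mapping.single (Xm j + Ym i) 1 \<in> (jspan :: (xy_var, 'k) mpoly set)"
      using ij by (intro jspan_single) (auto simp: keys_add_nat)
    then show "g \<in> jspan" unfolding ij(1) gen_eq .
  qed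
qed

text \<open>The binomial of a move lies wholly inside or wholly outside a set of monomials stable
  under moves. Applied to vertex degree and total degree, this is homogeneity of the ideal for both
  gradings.\<close>

lemma restrict_J:
  fixes f :: "(xy_var, 'k::field) mpoly"
  assumes P: "\<And>m m'. move m m' \<Longrightarrow> P m \<longleftrightarrow> P m'" and f: "f \<in> J"
  shows "restrict_mpoly P f \<in> J"
proof -
  have "f \<in> jspan" using f J_subset_jspan by blast
  then show ?thesis
  proof (induction rule: jspan.induct)
    case zero
    then show ?case using mpoly_ideal_closed(2)[OF ideal_J] by simp
  next
    case (step f m m' c)
    have "restrict_mpoly P (Poly_Mapping.single m c - Poly_Mapping.single m' c)
        = (if P m then Poly_Mapping.single m c - Poly_Mapping.single m' c else 0)"
      using P[OF step(2)] by (simp add: restrict_mpoly_diff restrict_mpoly_single)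
    then have "restrict_mpoly P (Poly_Mapping.single m c - Poly_Mapping.single m' c) \<in> J"
      using move_diff_in_J[OF step(2,3), of c] mpoly_ideal_closed(2)[OF ideal_J[where 'a = 'k]]
      by (cases "P m") (simp_all only: if_True if_False)
    then show ?case
      using step.IH mpoly_ideal_closed(3)[OF ideal_J] by (simp add: restrict_mpoly_add)
  qed
qed

lemma tor_van_block:
  "tor_van V (J :: (xy_var, 'k::field) mpoly set) i (int d) \<longleftrightarrow>
    koszul.van V pact (degeneration.Sge (wsum xweight) (block UNIV d) 0)
      (degeneration.Jge (J :: (xy_var, 'k) mpoly set) (wsum xweight) (block UNIV d) 0) i"
proof -
  interpret D: degeneration V "J :: (xy_var, 'k) mpoly set" "wsum xweight" nonstd "block UNIV d" "n * d"
    by (rule degeneration_J)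
  have "D.Qge 0 = fine_block V (int d)"
    unfolding D.Qge_def by (auto simp: fine_block_def block_def)
  then have "Sg V (int d - int (card A)) = D.Sge 0 A" if "A \<subseteq> V" for A
    using Sg_msys[OF that finite_subset[OF that finite_V], of "int d"]
    by (simp add: D.Sge_def)
  then show ?thesis unfolding tor_van_def by (intro D.van_cong) (simp_all add: D.Jge_def)
qed

lemma tor_vanI:
  assumes "\<And>W. W \<subseteq> V \<Longrightarrow> card W = d \<Longrightarrow> ex_indep TYPE('k::field) W i"
  shows "tor_van V (J :: (xy_var, 'k) mpoly set) i (int d)"
proof -
  interpret D: degeneration V "J :: (xy_var, 'k) mpoly set" "wsum xweight" nonstd "block UNIV d" "n * d"
    by (rule degeneration_J)
  show ?thesis unfolding tor_van_block
    by (rule D.van_Sge_Jge) (use assms std_exact_block[where 'k = 'k] in blast)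
qed

text \<open>The degeneration is run in the single vertex degree of \<open>W\<close>, so the adjacent
  vanishing is asked only there. This block is a direct summand of degree \<open>d\<close>: a
  bounding chain in degree \<open>d\<close> can be truncated to it.\<close>

lemma not_tor_vanI:
  assumes W: "W \<subseteq> V" "card W = d" "\<not> ex_indep TYPE('k::field) W (Suc i)"
    and ex: "\<And>W'. W' \<subseteq> V \<Longrightarrow> card W' = d \<Longrightarrow> vdeg (sqf W') = vdeg (sqf W) \<Longrightarrow>
      ex_indep TYPE('k) W' i \<and> ex_indep TYPE('k) W' (Suc (Suc i))"
  shows "\<not> tor_van V (J :: (xy_var, 'k) mpoly set) (Suc i) (int d)"
proof
  assume "tor_van V (J :: (xy_var, 'k) mpoly set) (Suc i) (int d)"
  note van = this[unfolded tor_van_block]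
  define \<A> where "\<A> = {vdeg (sqf W)}"
  interpret C: degeneration V "J :: (xy_var, 'k) mpoly set" "wsum xweight" nonstd "block UNIV d" "n * d"
    by (rule degeneration_J)
  interpret D: degeneration V "J :: (xy_var, 'k) mpoly set" "wsum xweight" nonstd "block \<A> d" "n * d"
    by (rule degeneration_J)
  have fW: "finite W" using finite_subset[OF W(1) finite_V] .
  have "\<not> D.std_exact (sqf W) (Suc i)"
  proof -
    have "\<not> nonstd (sqf W - sqf A) \<longleftrightarrow> indep (W - A)" if "A \<subseteq> W" for A
    proof -
      have "Poly_Mapping.keys (sqf W - sqf A) = W - A"
        using finite_subset[OF that fW] fW that by (auto simp: keys_diff_sqf keys_sqf lookup_sqf)
      then show ?thesis by (simp add: nonstd_def)
    qed
    then have "exact_at TYPE('k) W (\<lambda>A. \<not> nonstd (sqf W - sqf A)) (Suc i) \<longleftrightarrow> ex_indep TYPE('k) W (Suc i)"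
      unfolding ex_indep_def by (rule exact_at_cong)
    then show ?thesis using W(3) by (simp add: D.std_exact_def keys_sqf[OF fW])
  qed
  moreover have "sqf W \<in> block \<A> d"
    using W fW by (simp add: block_def \<A>_def keys_sqf mon_degree_sqf)
  moreover have "D.std_exact t i" "D.std_exact t (Suc (Suc i))" if "t \<in> block \<A> d" for t
    by (rule std_exact_block[OF that]; use ex in \<open>auto simp: block_def \<A>_def\<close>)+
  ultimately have "\<not> C.van (D.Sge 0) (D.Jge 0) (Suc i)"
    by (intro D.not_van_Sge_Jge)
  moreover have "C.van (D.Sge 0) (D.Jge 0) (Suc i)"
  proof (rule C.vanI)
    fix z assume z: "\<And>A. A \<subseteq> V \<Longrightarrow> card A = Suc i \<Longrightarrow> z A \<in> D.Sge 0 A"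
      and dz: "\<And>A. A \<subseteq> V \<Longrightarrow> Suc (card A) = Suc i \<Longrightarrow> C.kd z A \<in> D.Jge 0 A"
    have D_mem: "f \<in> D.Sge 0 A \<longleftrightarrow> (\<forall>m\<in>Poly_Mapping.keys f. m + sqf A \<in> block \<A> d)"
      and C_mem: "f \<in> C.Sge 0 A \<longleftrightarrow> (\<forall>m\<in>Poly_Mapping.keys f. m + sqf A \<in> block UNIV d)"
      for f :: "(xy_var, 'k) mpoly" and A
      by (simp_all add: D.Sge_def C.Sge_def D.Qge_def C.Qge_def msys_def)
    have block_iff: "t \<in> block \<A> d \<longleftrightarrow> t \<in> block UNIV d \<and> vdeg t = vdeg (sqf W)" for t
      by (auto simp: block_def \<A>_def)
    have sub: "D.Sge 0 A \<subseteq> C.Sge 0 A" "D.Jge 0 A \<subseteq> C.Jge 0 A" for A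
      unfolding D.Jge_def C.Jge_def by (auto simp: D_mem C_mem block_iff)
    obtain w where w: "\<And>A. A \<subseteq> V \<Longrightarrow> card A = Suc (Suc i) \<Longrightarrow> w A \<in> C.Sge 0 A"
      and zw: "\<And>A. A \<subseteq> V \<Longrightarrow> card A = Suc i \<Longrightarrow> z A - C.kd w A \<in> C.Jge 0 A"
      by (rule C.vanE[OF van subsetD[OF sub(1) z] subsetD[OF sub(2) dz]]) blast+
    \<comment> \<open>Projection onto the block. Counting the exterior part in the vertex degree
      makes it commute with the differential.\<close>
    define r :: "xy_var set \<Rightarrow> (xy_var, 'k) mpoly \<Rightarrow> (xy_var, 'k) mpoly"
      where "r A = restrict_mpoly (\<lambda>m. vdeg (m + sqf A) = vdeg (sqf W))" for A
    define w' where "w' A = r A (w A)" for A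
    have r_kd: "r A (C.kd w A) = C.kd w' A" if "A \<subseteq> V" for A
    proof -
      have "r A (Var v * f) = Var v * r (insert v A) f" if "v \<notin> A" for v f
      proof -
        have "Poly_Mapping.single v 1 + m + sqf A = m + sqf (insert v A)" for m
          using that finite_subset[OF \<open>A \<subseteq> V\<close> finite_V] by (simp add: sqf_insert ac_simps)
        then show ?thesis by (simp only: r_def restrict_mpoly_Var_mult)
      qed
      then show ?thesis
        by (simp add: C.kd_def w'_def r_def restrict_mpoly_sum restrict_mpoly_ksgn)
    qed
    have r_Sge: "r A f \<in> D.Sge 0 A" if "f \<in> C.Sge 0 A" for A and f :: "(xy_var, 'k) mpoly"
      using that by (auto simp: r_def keys_restrict_mpoly D_mem C_mem block_iff)
    have r_J: "r A f \<in> J" if "f \<in> J" for A and f :: "(xy_var, 'k) mpoly"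
      unfolding r_def by (rule restrict_J[OF _ that]) (simp add: move_invariants(1) vdeg_add)
    show "\<exists>w. (\<forall>A\<subseteq>V. card A = Suc (Suc i) \<longrightarrow> w A \<in> D.Sge 0 A) \<and>
         (\<forall>A\<subseteq>V. card A = Suc i \<longrightarrow> z A - C.kd w A \<in> D.Jge 0 A)"
    proof (intro exI[of _ w'] conjI allI impI)
      fix A assume A: "A \<subseteq> V"
      show "w' A \<in> D.Sge 0 A" if "card A = Suc (Suc i)"
        unfolding w'_def by (rule r_Sge[OF w[OF A that]])
      assume c: "card A = Suc i"
      have "r A (z A) = z A"
        using z[OF A c] unfolding r_def
        by (intro restrict_mpoly_id) (auto simp: D_mem block_iff)
      then have "z A - C.kd w' A = r A (z A - C.kd w A)"
        using r_kd[OF A] by (simp add: r_def restrict_mpoly_diff)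
      then show "z A - C.kd w' A \<in> D.Jge 0 A"
        using zw[OF A c] r_Sge r_J by (simp add: D.Jge_def C.Jge_def)
    qed
  qed
  ultimately show False by blast
qed

end

section \<open>The graph \<open>G\<^sub>0\<close>\<close>

interpretation G0: closed_graph_ideal far0 17 G0
  by standard (rule G0_edge_iff_far0)

text \<open>A neighbour of \<open>YV 1\<close> would be some \<open>XV l\<close> with
  \<open>l < 1\<close>, so this vertex would be isolated. Hence corner sequences may start with
  \<open>y\<close> indices from 2 on.\<close>

lemma G0_YV_1:
  assumes "W \<subseteq> xy_vars 17" "\<not> G0.ex_indep TYPE('k::field) W i"
  shows "YV 1 \<notin> W"
proof
  assume Y1: "YV 1 \<in> W"
  have "\<not> G0.adj (YV 1) u" if "u \<in> W" for u
  proof (cases u)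
    case (XV l)
    then show ?thesis using subsetD[OF assms(1) that] by simp
  qed simp
  then show False
    using G0.ex_indep_isolated[OF finite_subset[OF assms(1) G0.finite_V] Y1] assms(2) by blast
qed

lemma G0_not_ex_indep:
  assumes "W \<subseteq> xy_vars 17" "\<not> G0.ex_indep TYPE('k::field) W i"
  shows "\<exists>r. card W = i + r \<and> r \<le> 5 \<and> i \<le> 25 \<and> (r = 5 \<longrightarrow> i \<le> 23)"
proof -
  have fin: "finite W" using finite_subset[OF assms(1) G0.finite_V] .
  have Y1: "YV 1 \<notin> W" by (rule G0_YV_1[OF assms])
  have "W \<subseteq> XV ` {1..} \<union> YV ` {2..}"
  proof
    fix w assume w: "w \<in> W"
    then have wV: "w \<in> xy_vars 17" using assms(1) by blast
    show "w \<in> XV ` {1..} \<union> YV ` {2..}"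
    proof (cases w)
      case (YV j)
      then have "j \<noteq> 1" "1 \<le> j" using w wV Y1 by auto
      then show ?thesis using YV by simp
    qed (use wV in simp)
  qed
  then obtain r where r: "card W = i + r" "G0.corner_bound r 1 2 i"
    using G0.not_ex_indep_imp_corner_bound[OF fin _ assms(2)] by blast
  then show ?thesis
    using corner_bound_far0_ge_5[of r i] corner_bound_far0_le_4[of r i] by (cases "5 \<le> r") auto
qed

lemma G0_tor_van:
  assumes "i + 6 \<le> d \<or> 26 \<le> i \<or> 24 \<le> i \<and> i + 5 \<le> d"
  shows "tor_van (xy_vars 17) (binomial_edge_ideal 17 G0 :: (xy_var, 'k::field) mpoly set) i (int d)"
proof (rule G0.tor_vanI, rule ccontr)
  fix W assume W: "W \<subseteq> xy_vars 17" "card W = d" "\<not> G0.ex_indep TYPE('k) W i"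
  then obtain r where "d = i + r" "r \<le> 5" "i \<le> 25" "r = 5 \<longrightarrow> i \<le> 23"
    using G0_not_ex_indep[OF W(1,3)] by auto
  then show False using assms by linarith
qed

text \<open>The number of folded vertices is read off from cardinalities, so each concrete corner
  becomes a computation with explicit finite sets.\<close>

lemma G0_corner:
  assumes "finite W" "W \<subseteq> XV ` {a..} \<union> YV ` {b..}" "XV a \<in> W" "YV b \<in> W"
    "a < b" "b \<le> far0 a" "W \<inter> (XV ` {b..} \<union> YV ` {far0 a<..}) = W'" "card W = card W' + k + 2"
  shows "G0.ex_indep TYPE('k::field) W (Suc k + i) \<longleftrightarrow> G0.ex_indep TYPE('k) W' i"
proof -
  obtain k' where "card W = card (W \<inter> (XV ` {b..} \<union> YV ` {far0 a<..})) + k' + 2"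
    "\<And>i. G0.ex_indep TYPE('k) W (i + k' + 1) \<longleftrightarrow>
      G0.ex_indep TYPE('k) (W \<inter> (XV ` {b..} \<union> YV ` {far0 a<..})) i"
    by (rule G0.ex_indep_corner[OF assms(1-6)]) blast
  then show ?thesis using assms(7,8) by (simp add: add.commute)
qed

text \<open>The corners (1,3), (3,4), (4,10) and (10,15) together with every variable they dominate:
  25 exterior degrees and 4 rows make 29 variables.\<close>

definition W_long :: "xy_var set" where
  "W_long = {XV 1, XV 2, YV 3, XV 3, YV 4, YV 5, YV 6, YV 7, YV 8, YV 9,
     XV 4, XV 5, XV 6, XV 7, XV 8, XV 9, YV 10, YV 11, YV 12, YV 13, YV 14,
     XV 10, XV 11, XV 12, XV 13, XV 14, YV 15, YV 16, YV 17}"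

lemma W_long: "\<not> G0.ex_indep TYPE('k::field) W_long 25" "card W_long = 29" "W_long \<subseteq> xy_vars 17"
proof -
  define W1 where "W1 = {XV 3, YV 4, YV 5, YV 6, YV 7, YV 8, YV 9,
     XV 4, XV 5, XV 6, XV 7, XV 8, XV 9, YV 10, YV 11, YV 12, YV 13, YV 14,
     XV 10, XV 11, XV 12, XV 13, XV 14, YV 15, YV 16, YV 17}"
  define W2 where "W2 = {XV 4, XV 5, XV 6, XV 7, XV 8, XV 9, YV 10, YV 11, YV 12, YV 13, YV 14,
     XV 10, XV 11, XV 12, XV 13, XV 14, YV 15, YV 16, YV 17}"
  define W3 where "W3 = {XV 10, XV 11, XV 12, XV 13, XV 14, YV 15, YV 16, YV 17}"
  note defs = W_long_def W1_def W2_def W3_def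
  have card: "card W_long = 29" "card W1 = 26" "card W2 = 19" "card W3 = 8"
    by (simp_all add: defs)
  then show "card W_long = 29" by simp
  show "W_long \<subseteq> xy_vars 17" by (simp add: defs)
  have 0: "G0.ex_indep TYPE('k) W_long (Suc 1 + i) \<longleftrightarrow> G0.ex_indep TYPE('k) W1 i" for i
  proof (rule G0_corner[of _ 1 3])
    show "W_long \<inter> (XV ` {3..} \<union> YV ` {far0 1<..}) = W1"
      unfolding defs by (simp add: far0_def image_iff)
  qed (unfold card, simp_all add: defs far0_def)
  have 1: "G0.ex_indep TYPE('k) W1 (Suc 5 + i) \<longleftrightarrow> G0.ex_indep TYPE('k) W2 i" for i
  proof (rule G0_corner[of _ 3 4])
    show "W1 \<inter> (XV ` {4..} \<union> YV ` {far0 3<..}) = W2"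
      unfolding defs by (simp add: far0_def image_iff)
  qed (unfold card, simp_all add: defs far0_def)
  have 2: "G0.ex_indep TYPE('k) W2 (Suc 9 + i) \<longleftrightarrow> G0.ex_indep TYPE('k) W3 i" for i
  proof (rule G0_corner[of _ 4 10])
    show "W2 \<inter> (XV ` {10..} \<union> YV ` {far0 4<..}) = W3"
      unfolding defs by (simp add: far0_def image_iff)
  qed (unfold card, simp_all add: defs far0_def)
  have 3: "G0.ex_indep TYPE('k) W3 (Suc 6 + i) \<longleftrightarrow> G0.ex_indep TYPE('k) {} i" for i
  proof (rule G0_corner[of _ 10 15])
    show "W3 \<inter> (XV ` {15..} \<union> YV ` {far0 10<..}) = {}"
      unfolding defs by (simp add: far0_def image_iff)
  qed (unfold card, simp_all add: defs far0_def)
  \<comment> \<open>Stripping the four corners takes exterior degree 25 to 23, 17, 7 and 0, where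
    the empty set has its class.\<close>
  show "\<not> G0.ex_indep TYPE('k) W_long 25"
    using 0[of 23] 1[of 17] 2[of 7] 3[of 0] G0.ex_indep_empty[of 0, where 'k = 'k] by simp
qed

text \<open>In degree 29 the exterior degrees 24 and 26 are excluded for every \<open>W\<close>: the
  former would lie in row 5, whose columns end at 23, and the latter exceeds 25.\<close>

lemma G0_not_tor_van_25:
  "\<not> tor_van (xy_vars 17) (binomial_edge_ideal 17 G0 :: (xy_var, 'k::field) mpoly set) 25 29"
proof -
  have "\<not> tor_van (xy_vars 17) (binomial_edge_ideal 17 G0 :: (xy_var, 'k) mpoly set) (Suc 24) (int 29)"
  proof (rule G0.not_tor_vanI[OF W_long(3,2)])
    show "\<not> G0.ex_indep TYPE('k) W_long (Suc 24)" using W_long(1)[where 'k = 'k] by simp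
    fix W assume W: "W \<subseteq> xy_vars 17" "card W = 29"
    show "G0.ex_indep TYPE('k) W 24 \<and> G0.ex_indep TYPE('k) W (Suc (Suc 24))"
      using G0_not_ex_indep[OF W(1), where 'k = 'k, of 24] G0_not_ex_indep[OF W(1), where 'k = 'k, of 26] W(2)
      by auto
  qed
  then show ?thesis by simp
qed

text \<open>One corner for each edge of the path, with no dominated variable included, so that each
  corner costs exactly one exterior degree.\<close>

definition W_path :: "xy_var set" where
  "W_path = {XV 1, YV 2, XV 2, YV 4, XV 4, YV 9, XV 9, YV 15, XV 15, YV 16}"

lemma W_path: "G0.ex_indep TYPE('k::field) W_path (5 + i) \<longleftrightarrow> 0 < i" "card W_path = 10" "W_path \<subseteq> xy_vars 17"
proof -
  define W1 where "W1 = {XV 2, YV 4, XV 4, YV 9, XV 9, YV 15, XV 15, YV 16}"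
  define W2 where "W2 = {XV 4, YV 9, XV 9, YV 15, XV 15, YV 16}"
  define W3 where "W3 = {XV 9, YV 15, XV 15, YV 16}"
  define W4 where "W4 = {XV 15, YV 16}"
  note defs = W_path_def W1_def W2_def W3_def W4_def
  have card: "card W_path = 10" "card W1 = 8" "card W2 = 6" "card W3 = 4" "card W4 = 2"
    by (simp_all add: defs)
  then show "card W_path = 10" by simp
  show "W_path \<subseteq> xy_vars 17" by (simp add: defs)
  have 0: "G0.ex_indep TYPE('k) W_path (Suc 0 + i) \<longleftrightarrow> G0.ex_indep TYPE('k) W1 i" for i
  proof (rule G0_corner[of _ 1 2])
    show "W_path \<inter> (XV ` {2..} \<union> YV ` {far0 1<..}) = W1"
      unfolding defs by (simp add: far0_def image_iff)
  qed (unfold card, simp_all add: defs far0_def)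
  have 1: "G0.ex_indep TYPE('k) W1 (Suc 0 + i) \<longleftrightarrow> G0.ex_indep TYPE('k) W2 i" for i
  proof (rule G0_corner[of _ 2 4])
    show "W1 \<inter> (XV ` {4..} \<union> YV ` {far0 2<..}) = W2"
      unfolding defs by (simp add: far0_def image_iff)
  qed (unfold card, simp_all add: defs far0_def)
  have 2: "G0.ex_indep TYPE('k) W2 (Suc 0 + i) \<longleftrightarrow> G0.ex_indep TYPE('k) W3 i" for i
  proof (rule G0_corner[of _ 4 9])
    show "W2 \<inter> (XV ` {9..} \<union> YV ` {far0 4<..}) = W3"
      unfolding defs by (simp add: far0_def image_iff)
  qed (unfold card, simp_all add: defs far0_def)
  have 3: "G0.ex_indep TYPE('k) W3 (Suc 0 + i) \<longleftrightarrow> G0.ex_indep TYPE('k) W4 i" for i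
  proof (rule G0_corner[of _ 9 15])
    show "W3 \<inter> (XV ` {15..} \<union> YV ` {far0 9<..}) = W4"
      unfolding defs by (simp add: far0_def image_iff)
  qed (unfold card, simp_all add: defs far0_def)
  have 4: "G0.ex_indep TYPE('k) W4 (Suc 0 + i) \<longleftrightarrow> G0.ex_indep TYPE('k) {} i" for i
  proof (rule G0_corner[of _ 15 16])
    show "W4 \<inter> (XV ` {16..} \<union> YV ` {far0 15<..}) = {}"
      unfolding defs by (simp add: far0_def image_iff)
  qed (unfold card, simp_all add: defs far0_def)
  show "G0.ex_indep TYPE('k) W_path (5 + i) \<longleftrightarrow> 0 < i"
    using 0[of "4 + i"] 1[of "3 + i"] 2[of "2 + i"] 3[of "1 + i"] 4[of i]
      G0.ex_indep_empty[of i, where 'k = 'k] by (simp add: eval_nat_numeral)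
qed

lemma vdeg_sqf: "finite W \<Longrightarrow> vdeg (sqf W) i = (if XV i \<in> W then 1 else 0) + (if YV i \<in> W then 1 else 0)"
  by (simp add: vdeg_def lookup_sqf)

text \<open>
  In the vertex degree of the path \<open>1, 2, 4, 9, 15, 16\<close> the only squarefree degree without isolated
  vertices is that of the path itself.
\<close>

lemma W_path_unique:
  assumes W: "W \<subseteq> xy_vars 17" "vdeg (sqf W) = vdeg (sqf W_path)"
    and ex: "\<not> G0.ex_indep TYPE('k::field) W i" "card W = 10" "i = 4 \<or> i = 6"
  shows False
proof -
  have fin: "finite W" "finite W_path"
    using finite_subset[OF W(1) G0.finite_V] by (simp_all add: W_path_def)
  have deg: "(if XV i \<in> W then 1 else 0) + (if YV i \<in> W then 1 else (0::nat))
      = (if XV i \<in> W_path then 1 else 0) + (if YV i \<in> W_path then 1 else 0)" for i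
    using fun_cong[OF W(2), of i] by (simp add: vdeg_sqf fin)
  have Y1: "YV 1 \<notin> W" by (rule G0_YV_1[OF W(1) ex(1)])
  have "YV 17 \<notin> W" using deg[of 17] by (auto simp: W_path_def split: if_splits)
  \<comment> \<open>The only possible neighbour of \<open>XV 16\<close> is \<open>YV 17\<close>,
    which the vertex degree excludes.\<close>
  have X16: "XV 16 \<notin> W"
  proof
    assume X16: "XV 16 \<in> W"
    have "\<not> G0.adj (XV 16) u" if "u \<in> W" for u
    proof (cases u)
      case (YV l)
      then have "l \<noteq> 17" using that \<open>YV 17 \<notin> W\<close> by auto
      then show ?thesis using YV by (simp add: far0_def)
    qed simp
    then show False using G0.ex_indep_isolated[OF fin(1) X16] ex(1) by blast
  qed
  have both: "XV l \<in> W \<and> YV l \<in> W" if "XV l \<in> W_path" "YV l \<in> W_path" for l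
    using deg[of l] that by (simp split: if_splits)
  have "XV 1 \<in> W_path" by (simp add: W_path_def)
  then have "XV 1 \<in> W" using deg[of 1] Y1 by (simp split: if_splits)
  have "YV 16 \<in> W_path" by (simp add: W_path_def)
  then have "YV 16 \<in> W" using deg[of 16] X16 by (simp split: if_splits)
  have "W_path \<subseteq> W"
    using both[of 2] both[of 4] both[of 9] both[of 15] \<open>XV 1 \<in> W\<close> \<open>YV 16 \<in> W\<close>
    by (simp add: W_path_def)
  then have "W_path = W"
    using card_subset_eq[OF fin(1)] W_path(2) ex(2) by simp
  then have "\<not> G0.ex_indep TYPE('k) W_path i" using ex(1) by simp
  then have "i \<noteq> 6" using W_path(1)[where 'k = 'k, of 1] by auto
  then have "i = 4" using ex(3) by simp
  \<comment> \<open>Ten variables in exterior degree 4 would mean row 6.\<close>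
  then show False using G0_not_ex_indep[OF W(1) ex(1)] ex(2) by auto
qed

lemma G0_not_tor_van_5:
  "\<not> tor_van (xy_vars 17) (binomial_edge_ideal 17 G0 :: (xy_var, 'k::field) mpoly set) 5 10"
proof -
  have "\<not> tor_van (xy_vars 17) (binomial_edge_ideal 17 G0 :: (xy_var, 'k) mpoly set) (Suc 4) (int 10)"
  proof (rule G0.not_tor_vanI[OF W_path(3,2)])
    show "\<not> G0.ex_indep TYPE('k) W_path (Suc 4)" using W_path(1)[where 'k = 'k, of 0] by simp
    fix W assume W: "W \<subseteq> xy_vars 17" "card W = 10" "vdeg (sqf W) = vdeg (sqf W_path)"
    have "G0.ex_indep TYPE('k) W i" if "i = 4 \<or> i = 6" for i
      using W_path_unique[OF W(1,3) _ W(2) that] by blast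
    from this[of 4] this[of 6]
    show "G0.ex_indep TYPE('k) W 4 \<and> G0.ex_indep TYPE('k) W (Suc (Suc 4))" by simp
  qed
  then show ?thesis by simp
qed

section \<open>Graded submodules of free modules\<close>

text \<open>Vectors are functions that vanish beyond the rank, so one type serves free modules of
  every rank and is itself an abelian group.\<close>

type_synonym ('v, 'k) fvec = "nat \<Rightarrow> ('v, 'k) mpoly"

lemma sum_fvec_apply: "(sum f B :: ('v, 'k::field) fvec) c = (\<Sum>b\<in>B. f b c)"
  by (induction B rule: infinite_finite_induct) auto

definition smul :: "('v, 'k::field) mpoly \<Rightarrow> ('v, 'k) fvec \<Rightarrow> ('v, 'k) fvec" where
  "smul h f = (\<lambda>c. h * f c)"

abbreviation vact :: "'v \<Rightarrow> ('v, 'k::field) fvec \<Rightarrow> ('v, 'k) fvec" where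
  "vact v f \<equiv> smul (Var v) f"

lemma koszul_vact: "finite V \<Longrightarrow> koszul V vact"
  by (simp add: koszul_def smul_def fun_eq_iff distrib_left mult.left_commute)

text \<open>A graded module is given by its homogeneous components; negatives come from
  multiplication by the constant -1.\<close>

definition gmod :: "'v set \<Rightarrow> (int \<Rightarrow> ('v, 'k::field) fvec set) \<Rightarrow> bool" where
  "gmod V M \<longleftrightarrow> (\<forall>d. 0 \<in> M d \<and> (\<forall>f\<in>M d. \<forall>g\<in>M d. f + g \<in> M d) \<and>
     (\<forall>e. \<forall>h\<in>Sg V e. \<forall>f\<in>M d. smul h f \<in> M (d + e)))"

definition Fr :: "'v set \<Rightarrow> int list \<Rightarrow> int \<Rightarrow> ('v, 'k::field) fvec set" where
  "Fr V a d = {f. \<forall>c. if c < length a then f c \<in> Sg V (d - a ! c) else f c = 0}"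

lemma Sg_closed:
  "0 \<in> Sg V d" "f \<in> Sg V d \<Longrightarrow> g \<in> Sg V d \<Longrightarrow> f + g \<in> Sg V d"
  "f \<in> Sg V d \<Longrightarrow> - f \<in> Sg V d" "f \<in> Sg V d \<Longrightarrow> g \<in> Sg V e \<Longrightarrow> f * g \<in> Sg V (d + e)"
  "Poly_Mapping.single 0 c \<in> Sg V 0" "Var v \<in> Sg V 1 \<longleftrightarrow> v \<in> V"
proof -
  show "f \<in> Sg V d \<Longrightarrow> g \<in> Sg V d \<Longrightarrow> f + g \<in> Sg V d"
    using Poly_Mapping.keys_add[of f g] unfolding Sg_alt by blast
  show "f \<in> Sg V d \<Longrightarrow> g \<in> Sg V e \<Longrightarrow> f * g \<in> Sg V (d + e)"
    using keys_mult[of f g] unfolding Sg_alt by (fastforce simp: keys_add_nat mon_degree_add)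
  show "Var v \<in> Sg V 1 \<longleftrightarrow> v \<in> V"
    by (simp add: Sg_alt Var_def mon_degree_def)
qed (auto simp: Sg_alt mon_degree_def)

lemma Sg_sum: "(\<And>b. b \<in> B \<Longrightarrow> f b \<in> Sg V d) \<Longrightarrow> sum f B \<in> Sg V d"
  by (induction B rule: infinite_finite_induct) (auto simp: Sg_closed)

lemma one_Sg: "1 \<in> Sg V 0"
  using Sg_closed(5)[of 1 V] by simp

lemma Sg_0_eq:
  assumes "f \<in> Sg V 0" shows "f = Poly_Mapping.single 0 (Poly_Mapping.lookup f 0)"
proof -
  have "m = 0" if "m \<in> Poly_Mapping.keys f" for m
  proof -
    have "mon_degree m = 0" using assms that by (auto simp: Sg_alt)
    then show ?thesis by (intro poly_mapping_eqI) (auto simp: mon_degree_def in_keys_iff)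
  qed
  then show ?thesis by (intro poly_mapping_eqI) (auto simp: lookup_single when_def in_keys_iff)
qed

lemma Sg_lookup_0:
  assumes "f \<in> Sg V d" "Poly_Mapping.lookup f 0 \<noteq> 0" shows "d = 0"
proof -
  have "(0 :: 'a \<Rightarrow>\<^sub>0 nat) \<in> Poly_Mapping.keys f" using assms(2) by (simp add: in_keys_iff)
  then have "int (mon_degree (0 :: 'a \<Rightarrow>\<^sub>0 nat)) = d" using assms(1) unfolding Sg_alt by blast
  then show ?thesis by (simp add: mon_degree_def)
qed

lemma lookup_Var_mult_0 [simp]: "Poly_Mapping.lookup (Var v * f) 0 = 0"
  by (simp add: lookup_Var_mult)

lemma lookup_mult_0:
  fixes g h :: "('v, 'k::field) mpoly"
  assumes "Poly_Mapping.lookup h 0 = 0" shows "Poly_Mapping.lookup (g * h) 0 = 0"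
proof (rule ccontr)
  assume "Poly_Mapping.lookup (g * h) 0 \<noteq> 0"
  then have "0 \<in> Poly_Mapping.keys (g * h)" by (simp add: in_keys_iff)
  then obtain p q where pq: "0 = p + q" "q \<in> Poly_Mapping.keys h" using keys_mult[of g h] by blast
  have "q = 0" using pq(1) by (metis add_eq_0_iff_both_eq_0 lookup_add lookup_zero poly_mapping_eqI)
  then show False using pq(2) assms by (simp add: in_keys_iff)
qed

lemma gmodD:
  assumes "gmod V M"
  shows "0 \<in> M d" "f \<in> M d \<Longrightarrow> g \<in> M d \<Longrightarrow> f + g \<in> M d"
    "h \<in> Sg V e \<Longrightarrow> f \<in> M d \<Longrightarrow> smul h f \<in> M (d + e)"
  using assms unfolding gmod_def by blast+

lemma gmod_sum: "gmod V M \<Longrightarrow> (\<And>b. b \<in> B \<Longrightarrow> f b \<in> M d) \<Longrightarrow> sum f B \<in> M d"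
  by (induction B rule: infinite_finite_induct) (auto simp: gmodD)

lemma gmod_neg: assumes "gmod V M" "f \<in> M d" shows "- f \<in> M d"
proof -
  have "smul (- 1) f \<in> M (d + 0)"
    using gmodD(3)[OF assms(1) Sg_closed(3)[OF one_Sg] assms(2)] .
  then show ?thesis by (simp add: smul_def fun_Compl_def)
qed

lemma csys_gmod:
  assumes V: "finite V" and M: "gmod V M"
  shows "koszul.csys V vact (\<lambda>A. M (d - int (card A)) :: ('v::linorder, 'k::field) fvec set)"
proof -
  interpret koszul V "vact :: 'v \<Rightarrow> ('v, 'k) fvec \<Rightarrow> _" by (rule koszul_vact[OF V])
  show ?thesis
    unfolding csys_def
  proof (intro conjI allI impI ballI)
    fix A v f assume A: "A \<subseteq> V" "v \<in> V - A" and f: "f \<in> M (d - int (card (insert v A)))"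
    have "card (insert v A) = Suc (card A)" using A finite_subset[OF A(1) V] by simp
    then have eq: "d - int (card (insert v A)) + 1 = d - int (card A)" by simp
    have "Var v \<in> Sg V 1" using A by (simp add: Sg_closed)
    from gmodD(3)[OF M this f] show "vact v f \<in> M (d - int (card A))" unfolding eq .
  qed (use gmodD[OF M] gmod_neg[OF M] in auto)
qed

lemma FrI:
  assumes "\<And>c. c < length a \<Longrightarrow> f c \<in> Sg V (d - a ! c)" "\<And>c. length a \<le> c \<Longrightarrow> f c = 0"
  shows "f \<in> Fr V a d"
  using assms by (simp add: Fr_def)

lemma FrD: "f \<in> Fr V a d \<Longrightarrow> c < length a \<Longrightarrow> f c \<in> Sg V (d - a ! c)"
  unfolding Fr_def mem_Collect_eq by (elim allE[of _ c]) simp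

lemma FrD0: "f \<in> Fr V a d \<Longrightarrow> length a \<le> c \<Longrightarrow> f c = 0"
  unfolding Fr_def mem_Collect_eq by (elim allE[of _ c]) simp

lemma Sg_degree: "f \<in> Sg V e \<Longrightarrow> e = e' \<Longrightarrow> f \<in> Sg V e'"
  by simp

lemma gmod_Fr: "gmod V (Fr V a :: int \<Rightarrow> ('v, 'k::field) fvec set)"
  unfolding gmod_def
proof (intro conjI allI ballI)
  fix d e h and f g :: "('v, 'k) fvec" assume f: "f \<in> Fr V a d"
  show "smul h f \<in> Fr V a (d + e)" if h: "h \<in> Sg V e"
  proof (rule FrI)
    show "smul h f c \<in> Sg V (d + e - a ! c)" if "c < length a" for c
      unfolding smul_def by (rule Sg_degree[OF Sg_closed(4)[OF h FrD[OF f that]]]) simp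
  qed (use FrD0[OF f] in \<open>simp add: smul_def\<close>)
  show "f + g \<in> Fr V a d" if g: "g \<in> Fr V a d"
    by (rule FrI) (simp_all add: Sg_closed FrD[OF f] FrD[OF g] FrD0[OF f] FrD0[OF g])
qed (auto simp: Fr_def Sg_closed)

lemma gmod_zero: "gmod V (\<lambda>_. {0})"
  by (auto simp: gmod_def smul_def)

text \<open>Vanishing of Tor of \<open>M / N\<close> and the residue field in homological degree
  \<open>i\<close> and internal degree \<open>d\<close>.\<close>

definition gvan :: "'v::linorder set \<Rightarrow> (int \<Rightarrow> ('v, 'k::field) fvec set) \<Rightarrow> (int \<Rightarrow> ('v, 'k) fvec set)
    \<Rightarrow> nat \<Rightarrow> int \<Rightarrow> bool" where
  "gvan V M N i d \<longleftrightarrow> koszul.van V vact (\<lambda>A. M (d - int (card A))) (\<lambda>A. N (d - int (card A))) i"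

lemma kd_vact_apply:
  fixes z :: "'v::linorder set \<Rightarrow> ('v, 'k::field) fvec"
  assumes "finite V"
  shows "koszul.kd V vact z A c = koszul.kd V pact (\<lambda>A. z A c) A"
proof -
  interpret f: koszul V "vact :: 'v \<Rightarrow> ('v, 'k) fvec \<Rightarrow> _" by (rule koszul_vact[OF assms])
  interpret p: koszul V "pact :: 'v \<Rightarrow> ('v, 'k) mpoly \<Rightarrow> _" by (rule koszul_pact[OF assms])
  have "ksgn v A g c = ksgn v A (g c)" for v and g :: "('v, 'k) fvec"
    by (simp add: ksgn_def)
  then show ?thesis unfolding f.kd_def p.kd_def sum_fvec_apply
    by (intro sum.cong) (simp_all add: smul_def)
qed

lemma gvan_Fr_zero_gen:
  assumes V: "finite V"
    and van: "\<And>c. c < length a \<Longrightarrow> tor_van V {0 :: ('v::linorder, 'k::field) mpoly} i (d - a ! c)"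
  shows "gvan V (Fr V a :: int \<Rightarrow> ('v, 'k) fvec set) (\<lambda>_. {0}) i d"
proof -
  interpret f: koszul V "vact :: 'v \<Rightarrow> ('v, 'k) fvec \<Rightarrow> _" by (rule koszul_vact[OF V])
  interpret p: koszul V "pact :: 'v \<Rightarrow> ('v, 'k) mpoly \<Rightarrow> _" by (rule koszul_pact[OF V])
  show ?thesis
    unfolding gvan_def
  proof (rule f.vanI)
    fix z :: "'v set \<Rightarrow> ('v, 'k) fvec"
    assume z: "\<And>A. A \<subseteq> V \<Longrightarrow> card A = i \<Longrightarrow> z A \<in> Fr V a (d - int (card A))"
      and dz: "\<And>A. A \<subseteq> V \<Longrightarrow> Suc (card A) = i \<Longrightarrow> f.kd z A \<in> {0}"
    have "\<exists>w. (\<forall>A\<subseteq>V. card A = Suc i \<longrightarrow> w A \<in> Sg V (d - a ! c - int (card A))) \<and>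
        (\<forall>A\<subseteq>V. card A = i \<longrightarrow> z A c - p.kd w A = 0)" if c: "c < length a" for c
    proof -
      have z': "z A c \<in> Sg V (d - a ! c - int (card A))" if "A \<subseteq> V" "card A = i" for A
        by (rule Sg_degree[OF FrD[OF z[OF that] c]]) simp
      have dz': "p.kd (\<lambda>A. z A c) A \<in> {0} \<inter> Sg V (d - a ! c - int (card A))" if "A \<subseteq> V" "Suc (card A) = i" for A
        using dz[OF that] kd_vact_apply[OF V, of z A c] by (simp add: Sg_closed)
      show ?thesis
        by (rule p.vanE[OF van[OF c, unfolded tor_van_def] z' dz']) (assumption | blast)+
    qed
    then obtain w where w: "\<And>c A. c < length a \<Longrightarrow> A \<subseteq> V \<Longrightarrow> card A = Suc i \<Longrightarrow> w c A \<in> Sg V (d - a ! c - int (card A))"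
      and zw: "\<And>c A. c < length a \<Longrightarrow> A \<subseteq> V \<Longrightarrow> card A = i \<Longrightarrow> z A c - p.kd (w c) A = 0"
      by metis
    define w' where "w' A = (\<lambda>c. if c < length a then w c A else 0)" for A
    show "\<exists>w. (\<forall>A\<subseteq>V. card A = Suc i \<longrightarrow> w A \<in> Fr V a (d - int (card A))) \<and>
          (\<forall>A\<subseteq>V. card A = i \<longrightarrow> z A - f.kd w A \<in> {0})"
    proof (intro exI[of _ w'] conjI allI impI)
      fix A assume A: "A \<subseteq> V"
      show "w' A \<in> Fr V a (d - int (card A))" if "card A = Suc i"
      proof (rule FrI)
        show "w' A c \<in> Sg V (d - int (card A) - a ! c)" if "c < length a" for c
          using Sg_degree[OF w[OF that A \<open>card A = Suc i\<close>], of "d - int (card A) - a ! c"] that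
          by (simp add: w'_def)
      qed (simp add: w'_def)
      assume c: "card A = i"
      have "z A c = f.kd w' A c" for c
      proof (cases "c < length a")
        case True
        then have "p.kd (\<lambda>A. w' A c) A = p.kd (w c) A" by (simp add: w'_def)
        then show ?thesis using zw[OF True A c] by (simp add: kd_vact_apply[OF V])
      next
        case False
        then have "p.kd (\<lambda>A. w' A c) A = 0" by (simp add: w'_def p.kd_def)
        then show ?thesis using False FrD0[OF z[OF A c]] by (simp add: kd_vact_apply[OF V])
      qed
      then show "z A - f.kd w' A \<in> {0}" by (simp add: fun_eq_iff)
    qed
  qed
qed

lemma gvan_Fr_zero:
  "finite V \<Longrightarrow> gvan V (Fr V a :: int \<Rightarrow> ('v::linorder, 'k::field) fvec set) (\<lambda>_. {0}) (Suc i) d"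
  by (rule gvan_Fr_zero_gen) (auto intro: tor_van_zero)

lemma gvan_Fr_zero_0:
  assumes "finite V" "d \<notin> set a"
  shows "gvan V (Fr V a :: int \<Rightarrow> ('v::linorder, 'k::field) fvec set) (\<lambda>_. {0}) 0 d"
  by (rule gvan_Fr_zero_gen[OF assms(1)], rule tor_van_zero[OF assms(1)]) (use assms(2) in auto)

text \<open>Tor in homological degree 0 is the quotient by the irrelevant ideal, so its vanishing
  expresses elements of degree \<open>d\<close> through those of degree
  \<open>d - 1\<close>.\<close>

lemma gvan_0E:
  assumes V: "finite V" and van: "gvan V M N 0 d" and f: "f \<in> (M d :: ('v::linorder, 'k::field) fvec set)"
  obtains w where "\<And>v. v \<in> V \<Longrightarrow> w v \<in> M (d - 1)" "f - (\<Sum>v\<in>V. vact v (w v)) \<in> N d"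
proof -
  interpret koszul V "vact :: 'v \<Rightarrow> ('v, 'k) fvec \<Rightarrow> _" by (rule koszul_vact[OF V])
  obtain w where w: "\<And>A. A \<subseteq> V \<Longrightarrow> card A = Suc 0 \<Longrightarrow> w A \<in> M (d - int (card A))"
    "\<And>A. A \<subseteq> V \<Longrightarrow> card A = 0 \<Longrightarrow> f - kd w A \<in> N (d - int (card A))"
  proof (rule vanE[OF van[unfolded gvan_def], of "\<lambda>_. f"])
    show "f \<in> M (d - int (card A))" if "A \<subseteq> V" "card A = 0" for A
      using f that by simp
  qed auto
  have "kd w {} = (\<Sum>v\<in>V. vact v (w {v}))"
    by (simp add: kd_def ksgn_def odd_below_def)
  then show ?thesis
    using w(1)[of "{_}"] w(2)[of "{}"] by (intro that[of "\<lambda>v. w {v}"]) auto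
qed

lemma gvan_0I:
  fixes M :: "int \<Rightarrow> ('v::linorder, 'k::field) fvec set"
  assumes V: "finite V"
    and ex: "\<And>f. f \<in> M d \<Longrightarrow> \<exists>w. (\<forall>v\<in>V. w v \<in> M (d - 1)) \<and> f - (\<Sum>v\<in>V. vact v (w v)) \<in> N d"
  shows "gvan V M N 0 d"
proof -
  interpret koszul V "vact :: 'v \<Rightarrow> ('v, 'k) fvec \<Rightarrow> _" by (rule koszul_vact[OF V])
  have empty: "A = {}" if "A \<subseteq> V" "card A = 0" for A
    using that finite_subset[OF that(1) V] by simp
  show ?thesis
    unfolding gvan_def
  proof (rule vanI)
    fix z assume z: "\<And>A. A \<subseteq> V \<Longrightarrow> card A = 0 \<Longrightarrow> z A \<in> M (d - int (card A))"
    then have "z {} \<in> M d" using z[of "{}"] by simp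
    then obtain w where w: "\<forall>v\<in>V. w v \<in> M (d - 1)" "z {} - (\<Sum>v\<in>V. vact v (w v)) \<in> N d"
      using ex by blast
    define w' where "w' A = w (the_elem A)" for A
    have "kd w' {} = (\<Sum>v\<in>V. vact v (w v))"
      by (simp add: kd_def ksgn_def odd_below_def w'_def)
    moreover have "w' A \<in> M (d - int (card A))" if "A \<subseteq> V" "card A = Suc 0" for A
      using that w(1) by (auto simp: card_1_singleton_iff w'_def)
    ultimately show "\<exists>w. (\<forall>A\<subseteq>V. card A = Suc 0 \<longrightarrow> w A \<in> M (d - int (card A))) \<and>
          (\<forall>A\<subseteq>V. card A = 0 \<longrightarrow> z A - kd w A \<in> N (d - int (card A)))"
    proof (intro exI[of _ w'] conjI allI impI)
      fix A assume "A \<subseteq> V" "card A = 0"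
      then show "z A - kd w' A \<in> N (d - int (card A))" using empty[of A] w(2) \<open>kd w' {} = _\<close> by simp
    qed blast
  qed
qed

text \<open>For homogeneous vectors of a free module this is membership in the irrelevant ideal
  times that module, the condition for minimality.\<close>

definition const_free :: "('v, 'k::field) fvec \<Rightarrow> bool" where
  "const_free f \<longleftrightarrow> (\<forall>c. Poly_Mapping.lookup (f c) 0 = 0)"

text \<open>Entries of nonzero degree are combinations of the variables by exactness of the Koszul
  complex of the ring; entries of degree 0 are constants, hence zero.\<close>

lemma const_free_decomp:
  assumes V: "finite V" and f: "f \<in> Fr V a d" "const_free f"
  obtains w where "\<And>v. v \<in> V \<Longrightarrow> w v \<in> Fr V a (d - 1)"
    "f = (\<Sum>v\<in>V. vact v (w v :: ('v::linorder, 'k::field) fvec))"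
proof -
  interpret p: koszul V "pact :: 'v \<Rightarrow> ('v, 'k) mpoly \<Rightarrow> _" by (rule koszul_pact[OF V])
  have "\<exists>w. (\<forall>v\<in>V. w v \<in> Sg V (d - a ! c - 1)) \<and> f c = (\<Sum>v\<in>V. Var v * w v)" if c: "c < length a" for c
  proof (cases "d - a ! c = 0")
    case True
    have "f c \<in> Sg V 0" using FrD[OF f(1) c] True by simp
    then have "f c = 0" using Sg_0_eq[of "f c"] f(2) by (simp add: const_free_def)
    then show ?thesis by (intro exI[of _ "\<lambda>_. 0"]) (simp add: Sg_closed)
  next
    case False
    have fc: "f c \<in> Sg V (d - a ! c)" by (rule FrD[OF f(1) c])
    have fc': "(\<lambda>i. if i = 0 then f c else 0) \<in> Fr V [0] (d - a ! c)"
      by (rule FrI) (use fc in auto)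
    have van: "gvan V (Fr V [0] :: int \<Rightarrow> ('v, 'k) fvec set) (\<lambda>_. {0}) 0 (d - a ! c)"
      by (rule gvan_Fr_zero_0[OF V]) (use False in auto)
    obtain w where w: "\<And>v. v \<in> V \<Longrightarrow> w v \<in> Fr V [0] (d - a ! c - 1)"
      "(\<lambda>i. if i = 0 then f c else 0) - (\<Sum>v\<in>V. vact v (w v)) \<in> {0}"
      by (rule gvan_0E[OF V van fc']) blast
    have "\<forall>x. (if x = 0 then f c else 0) = (\<Sum>v\<in>V. Var v * w v x)"
      using w(2) by (simp add: fun_eq_iff sum_fvec_apply smul_def)
    from spec[OF this, of 0] have "f c = (\<Sum>v\<in>V. Var v * w v 0)" by simp
    moreover have "w v 0 \<in> Sg V (d - a ! c - 1)" if "v \<in> V" for v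
      using FrD[OF w(1)[OF that], of 0] by simp
    ultimately show ?thesis by (intro exI[of _ "\<lambda>v. w v 0"]) auto
  qed
  then obtain w where w: "\<And>c v. c < length a \<Longrightarrow> v \<in> V \<Longrightarrow> w c v \<in> Sg V (d - a ! c - 1)"
    "\<And>c. c < length a \<Longrightarrow> f c = (\<Sum>v\<in>V. Var v * w c v)" by metis
  show ?thesis
  proof (rule that[of "\<lambda>v c. if c < length a then w c v else 0"])
    show "(\<lambda>c. if c < length a then w c v else 0) \<in> Fr V a (d - 1)" if "v \<in> V" for v
    proof (rule FrI)
      show "(if c < length a then w c v else 0) \<in> Sg V (d - 1 - a ! c)" if "c < length a" for c
        using Sg_degree[OF w(1)[OF that \<open>v \<in> V\<close>], of "d - 1 - a ! c"] that by simp
    qed simp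
    show "f = (\<Sum>v\<in>V. vact v (\<lambda>c. if c < length a then w c v else 0))"
    proof
      fix c show "f c = (\<Sum>v\<in>V. vact v (\<lambda>c. if c < length a then w c v else 0)) c"
        using w(2)[of c] FrD0[OF f(1), of c] by (cases "c < length a") (simp_all add: sum_fvec_apply smul_def)
    qed
  qed
qed

text \<open>As \<open>N\<close> lies in the irrelevant ideal times the free module, Tor in
  homological degree 0 has exactly the basis elements of the free module as a basis.\<close>

lemma gvan_Fr_0_iff:
  fixes N :: "int \<Rightarrow> ('v::linorder, 'k::field) fvec set"
  assumes V: "finite V" and N: "\<And>d f. f \<in> N d \<Longrightarrow> const_free f" "gmod V N"
  shows "gvan V (Fr V a) N 0 d \<longleftrightarrow> d \<notin> set a"
proof
  assume van: "gvan V (Fr V a) N 0 d"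
  show "d \<notin> set a"
  proof
    assume "d \<in> set a"
    then obtain c0 where c0: "c0 < length a" "a ! c0 = d" by (auto simp: in_set_conv_nth)
    define u :: "('v, 'k) fvec" where "u c = (if c = c0 then 1 else 0)" for c
    have "u \<in> Fr V a d" using c0 by (auto simp: Fr_def u_def Sg_closed one_Sg)
    note u = this
    obtain w where "u - (\<Sum>v\<in>V. vact v (w v)) \<in> N d"
      by (rule gvan_0E[OF V van u]) blast
    then have "Poly_Mapping.lookup ((u - (\<Sum>v\<in>V. vact v (w v))) c0) 0 = 0"
      using N(1) unfolding const_free_def by blast
    then show False
      by (simp add: u_def sum_fvec_apply lookup_minus lookup_sum smul_def)
  qed
next
  assume "d \<notin> set a"
  then have van: "gvan V (Fr V a :: int \<Rightarrow> ('v, 'k) fvec set) (\<lambda>_. {0}) 0 d"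
    by (rule gvan_Fr_zero_0[OF V])
  show "gvan V (Fr V a) N 0 d"
  proof (rule gvan_0I[OF V])
    fix f :: "('v, 'k) fvec" assume "f \<in> Fr V a d"
    note f = this
    obtain w where "\<And>v. v \<in> V \<Longrightarrow> w v \<in> Fr V a (d - 1)" "f - (\<Sum>v\<in>V. vact v (w v)) \<in> {0}"
      by (rule gvan_0E[OF V van f]) blast
    then show "\<exists>w. (\<forall>v\<in>V. w v \<in> Fr V a (d - 1)) \<and> f - (\<Sum>v\<in>V. vact v (w v)) \<in> N d"
      using gmodD(1)[OF N(2)] by (intro exI[of _ w]) auto
  qed
qed

text \<open>Dimension shifting wherever the free module contributes nothing in position
  \<open>i\<close>, \<open>d\<close>. It serves generators that are not yet known to be
  minimal.\<close>

lemma gvan_shift_sub: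
  fixes N :: "int \<Rightarrow> ('v::linorder, 'k::field) fvec set"
  assumes V: "finite V" and N: "gmod V N" "\<And>d. N d \<subseteq> Fr V a d"
    and van: "gvan V (Fr V a) N (Suc i) d"
    and F: "gvan V (Fr V a :: int \<Rightarrow> ('v::linorder, 'k::field) fvec set) (\<lambda>_. {0}) i d"
  shows "gvan V N (\<lambda>_. {0}) i d"
proof -
  interpret koszul V "vact :: 'v \<Rightarrow> ('v, 'k) fvec \<Rightarrow> _" by (rule koszul_vact[OF V])
  show ?thesis
    unfolding gvan_def
    by (rule van_sub[where L = "\<lambda>A. Fr V a (d - int (card A))"])
      (use van F gmodD(1)[OF N(1)] N(2) csys_gmod[OF V gmod_Fr] csys_gmod[OF V N(1)]
        in \<open>simp_all add: gvan_def\<close>)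
qed

text \<open>The delicate case is \<open>i = 0\<close>, where the free module contributes. There an
  element \<open>f\<close> of \<open>N\<close> is the boundary of a chain \<open>z\<close> with free
  coefficients, because it has no constant entries. Then \<open>z\<close> is a cycle modulo
  \<open>N\<close>, and subtracting a boundary moves \<open>z\<close> into \<open>N\<close> while
  its own boundary stays \<open>f\<close>.\<close>

lemma gvan_shift:
  assumes V: "finite V" and N: "gmod V N" "\<And>d. N d \<subseteq> Fr V a d"
    and free: "\<And>d f. f \<in> N d \<Longrightarrow> const_free (f :: ('v::linorder, 'k::field) fvec)"
  shows "gvan V (Fr V a) N (Suc i) d \<longleftrightarrow> gvan V N (\<lambda>_. {0}) i d"
proof -
  interpret koszul V "vact :: 'v \<Rightarrow> ('v, 'k) fvec \<Rightarrow> _" by (rule koszul_vact[OF V])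
  note cN = csys_gmod[OF V N(1)] and cF = csys_gmod[OF V gmod_Fr] and c0 = csys_gmod[OF V gmod_zero]
  show ?thesis
  proof
    assume "gvan V N (\<lambda>_. {0}) i d"
    then show "gvan V (Fr V a) N (Suc i) d"
      using gvan_Fr_zero[OF V, where a = a and i = i and d = d, where 'k = 'k] unfolding gvan_def
      by (intro van_quotient[OF cF cN _ _ c0]) (use gmodD(1)[OF N(1)] N(2) in auto)
  next
    assume van: "gvan V (Fr V a) N (Suc i) d"
    show "gvan V N (\<lambda>_. {0}) i d"
    proof (cases i)
      case (Suc j)
      then show ?thesis using gvan_shift_sub[OF V N van] gvan_Fr_zero[OF V] by blast
    next
      case 0
      show ?thesis
        unfolding 0
      proof (rule gvan_0I[OF V])
        fix f assume f: "f \<in> N d"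
        obtain w where w: "\<And>v. v \<in> V \<Longrightarrow> w v \<in> Fr V a (d - 1)" "f = (\<Sum>v\<in>V. vact v (w v))"
          by (rule const_free_decomp[OF V subsetD[OF N(2) f] free[OF f]]) blast
        define z where "z A = w (the_elem A)" for A
        have z: "z A \<in> Fr V a (d - int (card A))" if "A \<subseteq> V" "card A = Suc 0" for A
          using that w(1) by (auto simp: card_1_singleton_iff z_def)
        have kd_z: "kd z {} = f"
          using w(2) by (simp add: kd_def ksgn_def odd_below_def z_def)
        have dz: "kd z A \<in> N (d - int (card A))" if "A \<subseteq> V" "Suc (card A) = Suc 0" for A
        proof -
          have "A = {}" using that finite_subset[OF that(1) V] by simp
          then show ?thesis using kd_z f by simp
        qed
        obtain u where u: "\<And>A. A \<subseteq> V \<Longrightarrow> card A = Suc 0 \<Longrightarrow> z A - kd u A \<in> N (d - int (card A))"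
          by (rule vanE[OF van[unfolded gvan_def 0] z dz]) (assumption | blast)+
        have "kd (\<lambda>A. z A - kd u A) {} = f"
          by (simp add: kd_diff kd_kd kd_z)
        then have "f = (\<Sum>v\<in>V. vact v (z {v} - kd u {v}))"
          by (simp add: kd_def[of "\<lambda>A. z A - kd u A"] ksgn_def odd_below_def)
        then show "\<exists>w. (\<forall>v\<in>V. w v \<in> N (d - 1)) \<and> f - (\<Sum>v\<in>V. vact v (w v)) \<in> {0}"
          using u[of "{_}"] by (intro exI[of _ "\<lambda>v. z {v} - kd u {v}"]) auto
      qed
    qed
  qed
qed

section \<open>Minimal generators and syzygies\<close>

text \<open>A list of degrees and vectors stands for a map out of a free module. The degrees are
  stored because they determine the grading of the source.\<close>

definition lin :: "(int \<times> ('v, 'k::field) fvec) list \<Rightarrow> ('v, 'k) fvec \<Rightarrow> ('v, 'k) fvec" where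
  "lin xs f = (\<lambda>r. \<Sum>c<length xs. f c * snd (xs ! c) r)"

abbreviation degs :: "(int \<times> ('v, 'k) fvec) list \<Rightarrow> int list" where
  "degs xs \<equiv> map fst xs"

definition lin_range :: "'v set \<Rightarrow> (int \<times> ('v, 'k::field) fvec) list \<Rightarrow> int \<Rightarrow> ('v, 'k) fvec set" where
  "lin_range V xs d = lin xs ` Fr V (degs xs) d"

definition syz :: "'v set \<Rightarrow> (int \<times> ('v, 'k::field) fvec) list \<Rightarrow> int \<Rightarrow> ('v, 'k) fvec set" where
  "syz V xs d = {f \<in> Fr V (degs xs) d. lin xs f = 0}"

lemma lin_add: "lin xs (f + g) = lin xs f + lin xs g"
  by (simp add: lin_def fun_eq_iff distrib_right sum.distrib)

lemma lin_smul: "lin xs (smul h f) = smul h (lin xs f)"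
  by (simp add: lin_def smul_def fun_eq_iff sum_distrib_left mult.assoc)

lemma lin_0 [simp]: "lin xs 0 = 0"
  by (simp add: lin_def fun_eq_iff)

lemma lin_alt: "lin xs f = (\<Sum>c<length xs. smul (f c) (snd (xs ! c)))"
  by (simp add: lin_def smul_def fun_eq_iff sum_fvec_apply)

lemma gmod_lin_range: "gmod V (lin_range V xs)"
  unfolding gmod_def
proof (intro conjI allI ballI)
  note Fr = gmodD[OF gmod_Fr[of V "degs xs"]]
  fix d e and h :: "('a, 'b) mpoly" and f g
  show "0 \<in> lin_range V xs d" using imageI[OF Fr(1), of "lin xs"] by (simp add: lin_range_def)
  assume f: "f \<in> lin_range V xs d"
  then obtain f' where f': "f' \<in> Fr V (degs xs) d" "f = lin xs f'" by (auto simp: lin_range_def)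
  show "f + g \<in> lin_range V xs d" if "g \<in> lin_range V xs d"
  proof -
    obtain g' where g': "g' \<in> Fr V (degs xs) d" "g = lin xs g'" using \<open>g \<in> _\<close> by (auto simp: lin_range_def)
    show ?thesis using imageI[OF Fr(2)[OF f'(1) g'(1)], of "lin xs"] f' g' by (simp add: lin_range_def lin_add)
  qed
  show "smul h f \<in> lin_range V xs (d + e)" if "h \<in> Sg V e"
    using imageI[OF Fr(3)[OF that f'(1)], of "lin xs"] f' by (simp add: lin_range_def lin_smul)
qed

lemma gmod_syz: "gmod V (syz V xs)"
  using gmodD[OF gmod_Fr[of V "degs xs"]]
  by (auto simp: gmod_def syz_def lin_add lin_smul) (auto simp: smul_def)

lemma syz_subset_Fr: "syz V xs d \<subseteq> Fr V (degs xs) d"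
  by (auto simp: syz_def)

lemma lin_range_mem:
  assumes "(e, x) \<in> set xs" shows "x \<in> lin_range V xs e"
proof -
  obtain c0 where c0: "c0 < length xs" "xs ! c0 = (e, x)" using assms by (auto simp: in_set_conv_nth)
  define u :: "('a, 'b) fvec" where "u c = (if c = c0 then 1 else 0)" for c
  have "u \<in> Fr V (degs xs) e"
    by (rule FrI) (use c0 in \<open>auto simp: u_def one_Sg Sg_closed\<close>)
  moreover have "lin xs u = x"
  proof
    fix r
    have "lin xs u r = (\<Sum>c<length xs. if c = c0 then snd (xs ! c0) r else 0)"
      unfolding lin_def by (rule sum.cong) (auto simp: u_def)
    then show "lin xs u r = x r" using c0 by simp
  qed
  ultimately show ?thesis unfolding lin_range_def by blast
qed

lemma lin_range_least:
  assumes M: "gmod V M" and xs: "\<And>e x. (e, x) \<in> set xs \<Longrightarrow> x \<in> M e"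
  shows "lin_range V xs d \<subseteq> M d"
proof
  fix y assume "y \<in> lin_range V xs d"
  then obtain f where f: "f \<in> Fr V (degs xs) d" "y = lin xs f" by (auto simp: lin_range_def)
  show "y \<in> M d"
    unfolding f(2) lin_alt
  proof (rule gmod_sum[OF M])
    fix c assume c: "c \<in> {..<length xs}"
    have "snd (xs ! c) \<in> M (fst (xs ! c))" using c by (intro xs) simp
    moreover have "f c \<in> Sg V (d - fst (xs ! c))" using FrD[OF f(1), of c] c by simp
    ultimately have "smul (f c) (snd (xs ! c)) \<in> M (fst (xs ! c) + (d - fst (xs ! c)))"
      by (intro gmodD[OF M])
    then show "smul (f c) (snd (xs ! c)) \<in> M d" by simp
  qed
qed

text \<open>First isomorphism theorem: \<open>lin xs\<close> identifies the free module modulo the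
  syzygies with \<open>N\<close>.\<close>

lemma gvan_lin:
  assumes V: "finite V" and N: "\<And>d. N d = lin_range V xs d"
  shows "gvan V (Fr V (degs xs)) (syz V xs) i d \<longleftrightarrow> gvan V N (\<lambda>_. {0 :: ('v::linorder, 'k::field) fvec}) i d"
proof -
  have "N = lin_range V xs" using N by blast
  then show ?thesis unfolding gvan_def
    by (intro van_iso[where f = "lin xs"] koszul_vact csys_gmod gmod_Fr gmod_zero V lin_add lin_smul)
      (auto simp: lin_range_def syz_def)
qed

text \<open>Takes the place of the Noetherian property: for \<open>i = 0\<close> the bound gives
  finite generation, and the bounds for larger \<open>i\<close> are handed on to the
  syzygies.\<close>

definition tor_bounded :: "'v::linorder set \<Rightarrow> int list \<Rightarrow> (int \<Rightarrow> ('v, 'k::field) fvec set) \<Rightarrow> bool" where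
  "tor_bounded V a N \<longleftrightarrow> gmod V N \<and> (\<forall>d. N d \<subseteq> Fr V a d) \<and> (\<forall>i. \<exists>D. \<forall>d\<ge>D. gvan V N (\<lambda>_. {0}) i d)"

lemma finite_monomials:
  assumes "finite V" shows "finite {m :: 'v \<Rightarrow>\<^sub>0 nat. Poly_Mapping.keys m \<subseteq> V \<and> mon_degree m \<le> e}"
proof (rule finite_imageD)
  define r where "r m = restrict (Poly_Mapping.lookup m) V" for m :: "'v \<Rightarrow>\<^sub>0 nat"
  have "Poly_Mapping.lookup m v \<le> mon_degree m" for m :: "'v \<Rightarrow>\<^sub>0 nat" and v
  proof (cases "v \<in> Poly_Mapping.keys m")
    case True
    then show ?thesis unfolding mon_degree_def by (intro member_le_sum) auto
  qed (simp add: in_keys_iff)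
  then have "Poly_Mapping.lookup m v \<le> e" if "mon_degree m \<le> e" for m :: "'v \<Rightarrow>\<^sub>0 nat" and v
    using that order_trans by blast
  then have "r ` {m. Poly_Mapping.keys m \<subseteq> V \<and> mon_degree m \<le> e} \<subseteq> V \<rightarrow>\<^sub>E {..e}"
    by (auto simp: r_def)
  then show "finite (r ` {m. Poly_Mapping.keys m \<subseteq> V \<and> mon_degree m \<le> e})"
    by (rule finite_subset) (simp add: finite_PiE assms)
  show "inj_on r {m. Poly_Mapping.keys m \<subseteq> V \<and> mon_degree m \<le> e}"
  proof (rule inj_onI, rule poly_mapping_eqI)
    fix m m' v assume m: "m \<in> {m. Poly_Mapping.keys m \<subseteq> V \<and> mon_degree m \<le> e}"
      "m' \<in> {m. Poly_Mapping.keys m \<subseteq> V \<and> mon_degree m \<le> e}" and eq: "r m = r m'"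
    show "Poly_Mapping.lookup m v = Poly_Mapping.lookup m' v"
    proof (cases "v \<in> V")
      case True
      then show ?thesis using fun_cong[OF eq, of v] by (simp add: r_def)
    next
      case False
      then have "v \<notin> Poly_Mapping.keys m" "v \<notin> Poly_Mapping.keys m'" using m by auto
      then show ?thesis by (simp add: in_keys_iff)
    qed
  qed
qed

definition const_smul :: "'k \<Rightarrow> ('v, 'k::field) fvec \<Rightarrow> ('v, 'k) fvec" where
  "const_smul a f = smul (Poly_Mapping.single 0 a) f"

lemma vector_space_const_smul: "vector_space (const_smul :: 'k::field \<Rightarrow> ('v, 'k) fvec \<Rightarrow> _)"
  by standard
    (simp_all add: const_smul_def smul_def fun_eq_iff distrib_left distrib_right single_add mult_single
      flip: mult.assoc)

text \<open>A homogeneous component sits in the span of finitely many monomial vectors. The last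
  property states that \<open>B\<close> spans \<open>N d\<close> in the form used later, as a
  comparison with graded modules.\<close>

lemma finite_dimensional:
  fixes N :: "int \<Rightarrow> ('v, 'k::field) fvec set"
  assumes V: "finite V" and N: "gmod V N" "\<And>d. N d \<subseteq> Fr V a d"
  obtains B where "finite B" "B \<subseteq> N d" "\<And>M. gmod V M \<Longrightarrow> B \<subseteq> M d \<Longrightarrow> N d \<subseteq> M d"
proof -
  interpret vs: vector_space "const_smul :: 'k \<Rightarrow> ('v, 'k) fvec \<Rightarrow> _" by (rule vector_space_const_smul)
  define e where "e = Max (insert 0 ((\<lambda>c. nat (d - a ! c)) ` {..<length a}))"
  define u :: "nat \<times> ('v \<Rightarrow>\<^sub>0 nat) \<Rightarrow> ('v, 'k) fvec" where
    "u cm = (\<lambda>r. if r = fst cm then Poly_Mapping.single (snd cm) 1 else 0)" for cm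
  define T where "T = u ` ({..<length a} \<times> {m. Poly_Mapping.keys m \<subseteq> V \<and> mon_degree m \<le> e})"
  have "finite T" unfolding T_def by (intro finite_imageI finite_cartesian_product finite_monomials V) simp
  have "Fr V a d \<subseteq> vs.span T"
  proof
    fix f :: "('v, 'k) fvec" assume f: "f \<in> Fr V a d"
    have "f = (\<Sum>c<length a. \<Sum>m\<in>Poly_Mapping.keys (f c). const_smul (Poly_Mapping.lookup (f c) m) (u (c, m)))"
    proof
      fix r
      have "(\<Sum>m\<in>Poly_Mapping.keys (f c). const_smul (Poly_Mapping.lookup (f c) m) (u (c, m))) r
          = (if c = r then f r else 0)" for c
        using poly_mapping_sum_singles[of "f c"]
        by (auto simp: sum_fvec_apply const_smul_def smul_def u_def mult_single)
      then have "(\<Sum>c<length a. \<Sum>m\<in>Poly_Mapping.keys (f c). const_smul (Poly_Mapping.lookup (f c) m) (u (c, m))) r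
          = (if r < length a then f r else 0)"
        by (simp add: sum_fvec_apply)
      then show "f r = (\<Sum>c<length a. \<Sum>m\<in>Poly_Mapping.keys (f c). const_smul (Poly_Mapping.lookup (f c) m) (u (c, m))) r"
        using FrD0[OF f, of r] by simp
    qed
    moreover have "(\<Sum>c<length a. \<Sum>m\<in>Poly_Mapping.keys (f c). const_smul (Poly_Mapping.lookup (f c) m) (u (c, m))) \<in> vs.span T"
    proof (intro vs.span_sum vs.span_scale vs.span_base)
      fix c m assume c: "c \<in> {..<length a}" and m: "m \<in> Poly_Mapping.keys (f c)"
      have "Poly_Mapping.keys m \<subseteq> V" "int (mon_degree m) = d - a ! c"
        using FrD[OF f, of c] c m by (auto simp: Sg_alt)
      moreover have "nat (d - a ! c) \<le> e" unfolding e_def using c by (intro Max_ge) auto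
      ultimately show "u (c, m) \<in> T" unfolding T_def using c by (intro imageI) auto
    qed
    ultimately show "f \<in> vs.span T" by simp
  qed
  obtain B where B: "B \<subseteq> N d" "vs.independent B" "N d \<subseteq> vs.span B"
    using vs.maximal_independent_subset[of "N d"] by blast
  have "finite B"
    using vs.independent_span_bound[OF \<open>finite T\<close> B(2)] B(1) N(2)[of d] \<open>Fr V a d \<subseteq> _\<close> by blast
  moreover have "N d \<subseteq> M d" if M: "gmod V M" "B \<subseteq> M d" for M
  proof -
    have "vs.subspace (M d)"
    proof (rule vs.subspaceI)
      show "const_smul c x \<in> M d" if "x \<in> M d" for c x
        using gmodD(3)[OF M(1) Sg_closed(5) that, of c] by (simp add: const_smul_def)
    qed (use gmodD[OF M(1)] in auto)
    then show ?thesis using vs.span_minimal[OF M(2)] B(3) by blast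
  qed
  ultimately show ?thesis using that B(1) by blast
qed

text \<open>Bases of the components from \<open>d0\<close> up to \<open>D\<close> generate: below
  there is nothing, and from \<open>D\<close> on each component consists of variables times elements
  of the preceding one.\<close>

lemma finitely_generated:
  fixes N :: "int \<Rightarrow> ('v::linorder, 'k::field) fvec set"
  assumes V: "finite V" and N: "tor_bounded V a N"
  obtains xs where "\<And>e x. (e, x) \<in> set xs \<Longrightarrow> x \<in> N e" "\<And>d. N d = lin_range V xs d"
proof -
  have gN: "gmod V N" and sub: "\<And>d. N d \<subseteq> Fr V a d" using N by (auto simp: tor_bounded_def)
  obtain D where D: "\<And>d. D \<le> d \<Longrightarrow> gvan V N (\<lambda>_. {0}) 0 d"
    using N unfolding tor_bounded_def by blast
  \<comment> \<open>A lower bound for all degrees in \<open>a\<close>; inserting 0 covers the empty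
    list.\<close>
  define d0 where "d0 = Min (insert 0 (set a))"
  have low: "N d = {0}" if "d < d0" for d
  proof -
    have "f = 0" if f: "f \<in> Fr V a d" for f :: "('v, 'k) fvec"
    proof
      fix c show "f c = 0 c"
      proof (cases "c < length a")
        case True
        then have "d0 \<le> a ! c" unfolding d0_def by (intro Min_le) auto
        then have "d - a ! c < 0" using \<open>d < d0\<close> by simp
        moreover have "f c \<in> Sg V (d - a ! c)" by (rule FrD[OF f True])
        ultimately have "Poly_Mapping.keys (f c) = {}" by (fastforce simp: Sg_alt)
        then show ?thesis by simp
      qed (use FrD0[OF f, of c] in simp)
    qed
    then show ?thesis using sub gmodD(1)[OF gN] by blast
  qed
  have "\<exists>B. finite B \<and> B \<subseteq> N d \<and> (\<forall>M. gmod V M \<longrightarrow> B \<subseteq> M d \<longrightarrow> N d \<subseteq> M d)" for d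
    using finite_dimensional[OF V gN sub, of d] by metis
  then obtain B where B: "\<And>d. finite (B d)" "\<And>d. B d \<subseteq> N d"
    "\<And>d M. gmod V M \<Longrightarrow> B d \<subseteq> M d \<Longrightarrow> N d \<subseteq> M d" by metis
  define G where "G = (SIGMA d:{d0..<D}. B d)"
  have "finite G" unfolding G_def using B(1) by auto
  then obtain xs where xs: "set xs = G" using finite_list by blast
  have mem: "x \<in> N e" if "(e, x) \<in> set xs" for e x using that B(2) by (auto simp: xs G_def)
  have "N d \<subseteq> lin_range V xs d" for d
  proof (induction "nat (d - d0)" arbitrary: d rule: less_induct)
    case less
    consider "d < d0" | "d0 \<le> d" "d < D" | "d0 \<le> d" "D \<le> d" by linarith
    then show ?case
    proof cases
      case 1
      then show ?thesis using low[OF 1] gmodD(1)[OF gmod_lin_range] by simp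
    next
      case 2
      then have "B d \<subseteq> lin_range V xs d" using lin_range_mem[of d _ xs V] by (auto simp: xs G_def)
      then show ?thesis by (rule B(3)[OF gmod_lin_range])
    next
      case 3
      show ?thesis
      proof
        fix z assume z: "z \<in> N d"
        obtain w where w: "\<And>v. v \<in> V \<Longrightarrow> w v \<in> N (d - 1)" "z - (\<Sum>v\<in>V. vact v (w v)) \<in> {0}"
          by (rule gvan_0E[OF V D[OF 3(2)] z]) blast
        have IH: "N (d - 1) \<subseteq> lin_range V xs (d - 1)"
        proof (cases "d = d0")
          case True
          then show ?thesis using low[of "d - 1"] gmodD(1)[OF gmod_lin_range] by simp
        next
          case False
          then show ?thesis using 3 by (intro less.hyps) simp
        qed
        have "(\<Sum>v\<in>V. vact v (w v)) \<in> lin_range V xs d"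
        proof (rule gmod_sum[OF gmod_lin_range])
          fix v assume v: "v \<in> V"
          have "vact v (w v) \<in> lin_range V xs (d - 1 + 1)"
            by (rule gmodD(3)[OF gmod_lin_range]) (use v w(1) IH in \<open>auto simp: Sg_closed\<close>)
          then show "vact v (w v) \<in> lin_range V xs d" by simp
        qed
        then show "z \<in> lin_range V xs d" using w(2) by simp
      qed
    qed
  qed
  moreover have "lin_range V xs d \<subseteq> N d" for d by (rule lin_range_least[OF gN mem])
  ultimately show ?thesis using that mem by blast
qed

text \<open>A generating list of least length is minimal: a syzygy with a nonzero constant entry
  would express one generator through the others.\<close>

lemma minimal_generators:
  fixes N :: "int \<Rightarrow> ('v::linorder, 'k::field) fvec set"
  assumes V: "finite V" and N: "tor_bounded V a N"
  obtains xs where "\<And>e x. (e, x) \<in> set xs \<Longrightarrow> x \<in> N e" "\<And>d. N d = lin_range V xs d"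
    "\<And>d f. f \<in> syz V xs d \<Longrightarrow> const_free f"
proof -
  have gN: "gmod V N" using N by (auto simp: tor_bounded_def)
  define gen where "gen xs \<longleftrightarrow> (\<forall>(e, x)\<in>set xs. x \<in> N e) \<and> (\<forall>d. N d = lin_range V xs d)" for xs
  obtain xs0 where xs0: "\<And>e x. (e, x) \<in> set xs0 \<Longrightarrow> x \<in> N e" "\<And>d. N d = lin_range V xs0 d"
  proof (rule finitely_generated[OF V N])
    fix xs assume xs: "\<And>e x. (e, x) \<in> set xs \<Longrightarrow> x \<in> N e" "\<And>d. N d = lin_range V xs d"
    show thesis by (rule that[of xs]) (rule xs, assumption, rule xs(2))
  qed
  have "gen xs0"
    unfolding gen_def
  proof (intro conjI ballI allI)
    fix p assume p: "p \<in> set xs0"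
    show "case p of (e, x) \<Rightarrow> x \<in> N e"
    proof (cases p)
      case (Pair e x)
      then show ?thesis using xs0(1)[of e x] p by simp
    qed
  qed (rule xs0(2))
  from ex_has_least_nat[where P = gen and m = length, OF this]
  obtain xs where xs: "gen xs" "\<And>ys. gen ys \<Longrightarrow> length xs \<le> length ys" by blast
  have xsN: "x \<in> N e" if "(e, x) \<in> set xs" for e x
  proof -
    have "\<forall>(e, x)\<in>set xs. x \<in> N e" using xs(1) unfolding gen_def by (rule conjunct1)
    then show ?thesis using that by fast
  qed
  have "const_free f" if f: "f \<in> syz V xs d" for d f
  proof (rule ccontr)
    assume "\<not> const_free f"
    then obtain c0 where c0: "Poly_Mapping.lookup (f c0) 0 \<noteq> 0" by (auto simp: const_free_def)
    have fF: "f \<in> Fr V (degs xs) d" and f0: "lin xs f = 0" using f by (auto simp: syz_def)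
    have len: "c0 < length xs" using FrD0[OF fF, of c0] c0 by (cases "c0 < length xs") auto
    define k where "k = Poly_Mapping.lookup (f c0) 0"
    have fc0: "f c0 \<in> Sg V (d - fst (xs ! c0))" using FrD[OF fF, of c0] len by simp
    \<comment> \<open>A homogeneous entry with nonzero constant term has degree 0, so it is a scalar
      and can be inverted.\<close>
    then have d: "d = fst (xs ! c0)" using Sg_lookup_0[OF fc0 c0] by simp
    have fk: "f c0 = Poly_Mapping.single 0 k" using Sg_0_eq[of "f c0" V] fc0 d by (simp add: k_def)
    define ys where "ys = take c0 xs @ drop (Suc c0) xs"
    have ys: "xs ! c \<in> set ys" if "c < length xs" "c \<noteq> c0" for c
    proof (cases "c < c0")
      case True
      then have "xs ! c = take c0 xs ! c" "c < length (take c0 xs)" using len by auto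
      then show ?thesis unfolding ys_def by (metis UnI1 nth_mem set_append)
    next
      case False
      then have "xs ! c = drop (Suc c0) xs ! (c - Suc c0)" "c - Suc c0 < length (drop (Suc c0) xs)"
        using that by auto
      then show ?thesis unfolding ys_def by (metis UnI2 nth_mem set_append)
    qed
    have sub: "set ys \<subseteq> set xs" unfolding ys_def by (auto dest: in_set_takeD in_set_dropD)
    have c0_mem: "snd (xs ! c0) \<in> lin_range V ys d"
    proof -
      have "(\<Sum>c\<in>{..<length xs} - {c0}. smul (f c) (snd (xs ! c))) \<in> lin_range V ys d"
      proof (rule gmod_sum[OF gmod_lin_range])
        fix c assume c: "c \<in> {..<length xs} - {c0}"
        have "snd (xs ! c) \<in> lin_range V ys (fst (xs ! c))"
          using ys[of c] c by (intro lin_range_mem) simp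
        moreover have "f c \<in> Sg V (d - fst (xs ! c))" using FrD[OF fF, of c] c by simp
        ultimately have "smul (f c) (snd (xs ! c)) \<in> lin_range V ys (fst (xs ! c) + (d - fst (xs ! c)))"
          by (intro gmodD[OF gmod_lin_range])
        then show "smul (f c) (snd (xs ! c)) \<in> lin_range V ys d" by simp
      qed
      moreover have "smul (f c0) (snd (xs ! c0)) + (\<Sum>c\<in>{..<length xs} - {c0}. smul (f c) (snd (xs ! c))) = 0"
        using f0 len unfolding lin_alt by (subst (asm) sum.remove[of _ c0]) auto
      ultimately have "smul (f c0) (snd (xs ! c0)) \<in> lin_range V ys d"
        using gmod_neg[OF gmod_lin_range, of "\<Sum>c\<in>{..<length xs} - {c0}. smul (f c) (snd (xs ! c))" V ys d]
        by (simp only: eq_neg_iff_add_eq_0[symmetric])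
      then have "smul (Poly_Mapping.single 0 (inverse k)) (smul (f c0) (snd (xs ! c0))) \<in> lin_range V ys (d + 0)"
        by (intro gmodD(3)[OF gmod_lin_range] Sg_closed)
      moreover have "smul (Poly_Mapping.single 0 (inverse k)) (smul (f c0) (snd (xs ! c0))) = snd (xs ! c0)"
        using c0 unfolding smul_def fk by (simp add: mult_single k_def flip: mult.assoc)
      ultimately show ?thesis by simp
    qed
    have "gen ys"
    proof -
      have "N e \<subseteq> lin_range V ys e" for e
      proof -
        have "x \<in> lin_range V ys e" if "(e, x) \<in> set xs" for e x
        proof -
          obtain c where c: "c < length xs" "xs ! c = (e, x)"
            using \<open>(e, x) \<in> set xs\<close> by (auto simp: in_set_conv_nth)
          show ?thesis
          proof (cases "c = c0")
            case True
            then show ?thesis using c0_mem c d by simp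
          next
            case False
            then show ?thesis using ys[of c] c by (intro lin_range_mem) simp
          qed
        qed
        then have "lin_range V xs e \<subseteq> lin_range V ys e" by (rule lin_range_least[OF gmod_lin_range])
        then show ?thesis using xs(1) by (simp add: gen_def)
      qed
      moreover have "lin_range V ys e \<subseteq> N e" for e
        by (rule lin_range_least[OF gN], rule xsN) (rule subsetD[OF sub])
      ultimately have "N e = lin_range V ys e" for e by blast
      then show ?thesis using sub xsN unfolding gen_def by blast
    qed
    then have "length xs \<le> length ys" by (rule xs(2))
    then show False using len by (simp add: ys_def)
  qed
  note free = this
  show ?thesis
  proof (rule that[of xs])
    show "x \<in> N e" if "(e, x) \<in> set xs" for e x using that by (rule xsN)
    show "N d = lin_range V xs d" for d using xs(1) unfolding gen_def by blast
  qed (rule free)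
qed

text \<open>The bound for the syzygies in position \<open>i\<close> is the bound for
  \<open>N\<close> in position \<open>Suc i\<close>, raised above all generator degrees so that the
  free module contributes nothing.\<close>

lemma tor_bounded_syz:
  fixes N :: "int \<Rightarrow> ('v::linorder, 'k::field) fvec set"
  assumes V: "finite V" and N: "tor_bounded V a N" and xs: "\<And>d. N d = lin_range V xs d"
  shows "tor_bounded V (degs xs) (syz V xs)"
  unfolding tor_bounded_def
proof (intro conjI allI gmod_syz syz_subset_Fr)
  fix i
  obtain D where D: "\<And>d. D \<le> d \<Longrightarrow> gvan V N (\<lambda>_. {0}) (Suc i) d"
    using N unfolding tor_bounded_def by blast
  define D' where "D' = max D (Max (insert 0 (set (degs xs))) + 1)"
  have "gvan V (syz V xs) (\<lambda>_. {0}) i d" if d: "D' \<le> d" for d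
  proof (rule gvan_shift_sub[OF V gmod_syz syz_subset_Fr])
    show "gvan V (Fr V (degs xs)) (syz V xs) (Suc i) d"
      unfolding gvan_lin[OF V xs] by (rule D) (use d in \<open>simp add: D'_def\<close>)
    have "d \<notin> set (degs xs)"
    proof
      assume "d \<in> set (degs xs)"
      then have "d \<le> Max (insert 0 (set (degs xs)))" by (intro Max_ge) auto
      then show False using d by (simp add: D'_def)
    qed
    then show "gvan V (Fr V (degs xs) :: int \<Rightarrow> ('v, 'k) fvec set) (\<lambda>_. {0}) i d"
      using gvan_Fr_zero[OF V] gvan_Fr_zero_0[OF V] by (cases i) blast+
  qed
  then show "\<exists>D. \<forall>d\<ge>D. gvan V (syz V xs) (\<lambda>_. {0}) i d" by blast
qed

text \<open>Dependent choice, with boundedness of the syzygies as the invariant that makes the next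
  step possible. The sequence is infinite; a finite resolution continues with empty lists.\<close>

lemma minimal_chain_exists:
  fixes N :: "int \<Rightarrow> ('v::linorder, 'k::field) fvec set"
  assumes V: "finite V" and N: "tor_bounded V a N"
  shows "\<exists>X. (\<forall>d. N d = lin_range V (X 0) d) \<and> (\<forall>k d. syz V (X k) d = lin_range V (X (Suc k)) d) \<and>
    (\<forall>k d. \<forall>f\<in>syz V (X k) d. const_free f) \<and> (\<forall>e x. (e, x) \<in> set (X 0) \<longrightarrow> x \<in> N e)"
proof -
  obtain xs where xs: "\<And>e x. (e, x) \<in> set xs \<Longrightarrow> x \<in> N e" "\<And>d. N d = lin_range V xs d"
    "\<And>d f. f \<in> syz V xs d \<Longrightarrow> const_free f"
    by (rule minimal_generators[OF V N]) blast
  define P where "P xs \<longleftrightarrow> tor_bounded V (degs xs) (syz V xs) \<and> (\<forall>d. \<forall>f\<in>syz V xs d. const_free f)"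
    for xs :: "(int \<times> ('v, 'k) fvec) list"
  have "\<exists>X. \<forall>k. (P (X k) \<and> (k = 0 \<longrightarrow> X k = xs)) \<and> (\<forall>d. syz V (X k) d = lin_range V (X (Suc k)) d)"
  proof (rule dependent_nat_choice)
    show "\<exists>x. P x \<and> (0 = 0 \<longrightarrow> x = xs)"
      using tor_bounded_syz[OF V N xs(2)] xs(3) unfolding P_def by blast
    fix ys and k :: nat assume "P ys \<and> (k = 0 \<longrightarrow> ys = xs)"
    then have ys: "tor_bounded V (degs ys) (syz V ys)" by (simp add: P_def)
    obtain zs where zs: "\<And>d. syz V ys d = lin_range V zs d" "\<And>d f. f \<in> syz V zs d \<Longrightarrow> const_free f"
      by (rule minimal_generators[OF V ys]) blast
    have "P zs" using tor_bounded_syz[OF V ys zs(1)] zs(2) by (simp add: P_def)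
    then show "\<exists>zs. (P zs \<and> (Suc k = 0 \<longrightarrow> zs = xs)) \<and> (\<forall>d. syz V ys d = lin_range V zs d)"
      using zs(1) by blast
  qed
  then obtain X where X: "\<forall>k. (P (X k) \<and> (k = 0 \<longrightarrow> X k = xs)) \<and> (\<forall>d. syz V (X k) d = lin_range V (X (Suc k)) d)"
    by (elim exE)
  then have X0: "X 0 = xs" by blast
  show ?thesis
  proof (intro exI[of _ X] conjI allI ballI impI)
    show "syz V (X k) d = lin_range V (X (Suc k)) d" for k d using X by blast
    show "const_free f" if "f \<in> syz V (X k) d" for k d f
    proof -
      have "P (X k)" using X by blast
      then show ?thesis using that by (simp add: P_def)
    qed
    show "N d = lin_range V (X 0) d" for d unfolding X0 by (rule xs(2))
    show "x \<in> N e" if "(e, x) \<in> set (X 0)" for e x using that unfolding X0 by (rule xs(1))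
  qed
qed

text \<open>\<open>X k\<close> generates the relations in the \<open>k\<close>-th free module, so
  its degrees belong to the free module with index \<open>Suc k\<close>.\<close>

definition chain_degs :: "int list \<Rightarrow> (nat \<Rightarrow> (int \<times> ('v, 'k) fvec) list) \<Rightarrow> nat \<Rightarrow> int list" where
  "chain_degs a X i = (case i of 0 \<Rightarrow> a | Suc k \<Rightarrow> degs (X k))"

text \<open>Iterated dimension shifting: \<open>gvan_shift\<close> passes from a free module modulo
  \<open>K k\<close> to \<open>K k\<close>, and \<open>gvan_lin\<close> presents that as the next
  free module modulo \<open>K (Suc k)\<close>. In position 0 minimality exhibits the generator
  degrees.\<close>

lemma gvan_chain:
  fixes N :: "int \<Rightarrow> ('v::linorder, 'k::field) fvec set"
  assumes V: "finite V" and N: "gmod V N" "\<And>d. N d \<subseteq> Fr V a d"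
    and X: "\<And>d. N d = lin_range V (X 0) d" "\<And>k d. syz V (X k) d = lin_range V (X (Suc k)) d"
    and free: "\<And>k e x. (e, x) \<in> set (X k) \<Longrightarrow> const_free x"
  shows "gvan V (Fr V a) N i d \<longleftrightarrow> d \<notin> set (chain_degs a X i)"
proof -
  define K where "K k = (case k of 0 \<Rightarrow> N | Suc k \<Rightarrow> syz V (X k))" for k
  have K_lin_range: "K k d = lin_range V (X k) d" for k d
    using X by (auto simp: K_def split: nat.split)
  have K_gmod: "gmod V (K k)" for k using N(1) gmod_syz by (auto simp: K_def split: nat.split)
  have K_sub: "K k d \<subseteq> Fr V (chain_degs a X k) d" for k d
    using N(2) by (cases k) (simp_all add: K_def chain_degs_def syz_subset_Fr)
  have K_free: "const_free f" if "f \<in> K k d" for k d f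
  proof -
    have "Poly_Mapping.lookup (snd (X k ! c) r) 0 = 0" if "c < length (X k)" for c r
      using free[of "fst (X k ! c)" "snd (X k ! c)" k] that by (simp add: const_free_def)
    moreover obtain f' where "f = lin (X k) f'" using \<open>f \<in> K k d\<close> by (auto simp: K_lin_range lin_range_def)
    ultimately show ?thesis by (simp add: const_free_def lin_def lookup_sum lookup_mult_0)
  qed
  have "gvan V (Fr V (chain_degs a X k)) (K k) i d \<longleftrightarrow> d \<notin> set (chain_degs a X (k + i))" for k
  proof (induction i arbitrary: k)
    case 0
    show ?case unfolding add_0_right by (rule gvan_Fr_0_iff[OF V K_free K_gmod])
  next
    case (Suc i)
    have "gvan V (Fr V (chain_degs a X k)) (K k) (Suc i) d \<longleftrightarrow> gvan V (K k) (\<lambda>_. {0}) i d"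
      by (rule gvan_shift[OF V K_gmod K_sub K_free])
    also have "\<dots> \<longleftrightarrow> gvan V (Fr V (degs (X k))) (syz V (X k)) i d"
      by (rule gvan_lin[OF V K_lin_range, symmetric])
    also have "\<dots> \<longleftrightarrow> d \<notin> set (chain_degs a X (Suc k + i))"
      using Suc[of "Suc k"] by (simp add: K_def chain_degs_def)
    finally show ?case by simp
  qed
  from this[of 0] show ?thesis by (simp add: K_def chain_degs_def)
qed

section \<open>Betti numbers as Koszul homology\<close>

definition hcomp :: "int \<Rightarrow> ('v, 'k::field) mpoly \<Rightarrow> ('v, 'k) mpoly" where
  "hcomp d = restrict_mpoly (\<lambda>m. int (mon_degree m) = d)"

lemma hcomp_sum: "hcomp d (sum h B) = (\<Sum>b\<in>B. hcomp d (h b))"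
  and hcomp_0 [simp]: "hcomp d 0 = 0"
  by (simp_all add: hcomp_def restrict_mpoly_sum)

lemma hcomp_Sg: "f \<in> carrier (mpoly_ring V) \<Longrightarrow> hcomp d f \<in> Sg V d"
  by (auto simp: hcomp_def Sg_alt keys_restrict_mpoly carrier_mpoly_ring)

lemma hcomp_id: "f \<in> Sg V d \<Longrightarrow> hcomp d f = f"
  unfolding hcomp_def by (rule restrict_mpoly_id) (auto simp: Sg_alt)

lemma hcomp_mult:
  assumes h: "h \<in> Sg V e" shows "hcomp d (f * h) = hcomp (d - e) f * h"
proof -
  have "hcomp d (f * h) = (\<Sum>m\<in>Poly_Mapping.keys h. hcomp d (Poly_Mapping.single m (Poly_Mapping.lookup h m) * f))"
    by (subst (1) poly_mapping_sum_singles[of h]) (simp add: sum_distrib_left hcomp_sum mult.commute)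
  also have "\<dots> = (\<Sum>m\<in>Poly_Mapping.keys h. Poly_Mapping.single m (Poly_Mapping.lookup h m) * hcomp (d - e) f)"
  proof (rule sum.cong[OF refl])
    fix m assume "m \<in> Poly_Mapping.keys h"
    then have "int (mon_degree m) = e" using h by (auto simp: Sg_alt)
    then have "(\<lambda>k. int (mon_degree (m + k)) = d) = (\<lambda>k. int (mon_degree k) = d - e)"
      by (auto simp: mon_degree_add)
    then show "hcomp d (Poly_Mapping.single m (Poly_Mapping.lookup h m) * f)
        = Poly_Mapping.single m (Poly_Mapping.lookup h m) * hcomp (d - e) f"
      by (simp add: hcomp_def restrict_mpoly_single_mult)
  qed
  also have "\<dots> = (\<Sum>m\<in>Poly_Mapping.keys h. Poly_Mapping.single m (Poly_Mapping.lookup h m)) * hcomp (d - e) f"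
    by (simp add: sum_distrib_right)
  also have "\<dots> = hcomp (d - e) f * h"
    by (simp add: mult.commute flip: poly_mapping_sum_singles)
  finally show ?thesis .
qed

lemma Sg_carrier: "f \<in> Sg V d \<Longrightarrow> f \<in> carrier (mpoly_ring V)"
  by (simp add: Sg_def)

definition Fu :: "'v set \<Rightarrow> int list \<Rightarrow> ('v, 'k::field) fvec set" where
  "Fu V a = {f. \<forall>c. if c < length a then f c \<in> carrier (mpoly_ring V) else f c = 0}"

lemma FuI:
  assumes "\<And>c. c < length a \<Longrightarrow> f c \<in> carrier (mpoly_ring V)" "\<And>c. length a \<le> c \<Longrightarrow> f c = 0"
  shows "f \<in> Fu V a"
  using assms by (simp add: Fu_def)

lemma FuD: "f \<in> Fu V a \<Longrightarrow> c < length a \<Longrightarrow> f c \<in> carrier (mpoly_ring V)"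
  unfolding Fu_def mem_Collect_eq by (elim allE[of _ c]) simp

lemma FuD0: "f \<in> Fu V a \<Longrightarrow> length a \<le> c \<Longrightarrow> f c = 0"
  unfolding Fu_def mem_Collect_eq by (elim allE[of _ c]) simp

lemma Fr_subset_Fu: "f \<in> Fr V a d \<Longrightarrow> f \<in> Fu V a"
  by (rule FuI) (auto intro: Sg_carrier[OF FrD] FrD0)

lemma Fu_sum: "(\<And>b. b \<in> B \<Longrightarrow> f b \<in> Fu V a) \<Longrightarrow> sum f B \<in> Fu V a"
proof (induction B rule: infinite_finite_induct)
  case (insert x F)
  then have "f x \<in> Fu V a" "sum f F \<in> Fu V a" by auto
  then have "f x + sum f F \<in> Fu V a"
    by (intro FuI) (simp_all add: mpoly_carrier_closed FuD FuD0)
  then show ?case by (simp only: sum.insert[OF insert.hyps(1,2)])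
qed (auto intro: FuI)

definition fcomp :: "int list \<Rightarrow> int \<Rightarrow> ('v, 'k::field) fvec \<Rightarrow> ('v, 'k) fvec" where
  "fcomp a x f = (\<lambda>c. if c < length a then hcomp (x - a ! c) (f c) else 0)"

lemma fcomp_Fr: "f \<in> Fu V a \<Longrightarrow> fcomp a x f \<in> Fr V a x"
  by (rule FrI) (auto simp: fcomp_def intro: hcomp_Sg FuD)

lemma fcomp_id: "f \<in> Fr V a x \<Longrightarrow> fcomp a x f = f"
  by (auto simp: fcomp_def fun_eq_iff FrD0 intro: hcomp_id[OF FrD])

lemma fcomp_0 [simp]: "fcomp a x 0 = 0"
  by (simp add: fcomp_def fun_eq_iff)

lemma fcomp_decomp:
  fixes f :: "('v, 'k::field) fvec"
  assumes "f \<in> Fu V a" obtains S where "finite S" "f = (\<Sum>x\<in>S. fcomp a x f)"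
proof -
  define S where "S = (\<Union>c<length a. (\<lambda>m. int (mon_degree m) + a ! c) ` Poly_Mapping.keys (f c))"
  have "finite S" by (simp add: S_def)
  moreover have "f c = (\<Sum>x\<in>S. fcomp a x f) c" for c
  proof (cases "c < length a")
    case True
    have "Poly_Mapping.lookup (f c) m = (\<Sum>x\<in>S. Poly_Mapping.lookup (hcomp (x - a ! c) (f c)) m)" for m
    proof -
      have "(\<Sum>x\<in>S. Poly_Mapping.lookup (hcomp (x - a ! c) (f c)) m)
          = (\<Sum>x\<in>S. if x = int (mon_degree m) + a ! c then Poly_Mapping.lookup (f c) m else 0)"
        by (rule sum.cong) (auto simp: hcomp_def lookup_restrict_mpoly)
      also have "\<dots> = (if int (mon_degree m) + a ! c \<in> S then Poly_Mapping.lookup (f c) m else 0)"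
        using \<open>finite S\<close> by simp
      also have "\<dots> = Poly_Mapping.lookup (f c) m"
      proof (cases "m \<in> Poly_Mapping.keys (f c)")
        case True
        then have "int (mon_degree m) + a ! c \<in> S" using \<open>c < length a\<close> unfolding S_def by blast
        then show ?thesis by simp
      qed (simp add: in_keys_iff)
      finally show ?thesis by simp
    qed
    then show ?thesis using True
      by (intro poly_mapping_eqI) (simp add: sum_fvec_apply fcomp_def lookup_sum)
  qed (use FuD0[OF assms] in \<open>simp add: sum_fvec_apply fcomp_def\<close>)
  ultimately show ?thesis using that[of S] by blast
qed

lemma lin_sum: "lin xs (sum f B) = (\<Sum>b\<in>B. lin xs (f b))"
proof (induction B rule: infinite_finite_induct)
  case (insert x F)
  then show ?case by (simp only: sum.insert[OF insert.hyps(1,2)] lin_add)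
qed (simp_all only: sum.infinite sum.empty lin_0 not_False_eq_True)

definition homog_gens :: "'v set \<Rightarrow> int list \<Rightarrow> (int \<times> ('v, 'k::field) fvec) list \<Rightarrow> bool" where
  "homog_gens V b xs \<longleftrightarrow> (\<forall>c<length xs. snd (xs ! c) \<in> Fr V b (fst (xs ! c)))"

lemma fcomp_lin:
  assumes xs: "homog_gens V b xs"
  shows "fcomp b x (lin xs f) = lin xs (fcomp (degs xs) x f)"
proof
  fix r
  have g: "snd (xs ! c) \<in> Fr V b (fst (xs ! c))" if "c < length xs" for c
    using xs that by (simp add: homog_gens_def)
  show "fcomp b x (lin xs f) r = lin xs (fcomp (degs xs) x f) r"
  proof (cases "r < length b")
    case True
    have "hcomp (x - b ! r) (f c * snd (xs ! c) r) = hcomp (x - fst (xs ! c)) (f c) * snd (xs ! c) r"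
      if "c < length xs" for c
      using hcomp_mult[OF FrD[OF g[OF that] True], of "x - b ! r" "f c"] by simp
    then show ?thesis using True by (simp add: fcomp_def lin_def hcomp_sum)
  next
    case False
    then have "snd (xs ! c) r = 0" if "c < length xs" for c using FrD0[OF g[OF that]] by simp
    then show ?thesis using False by (simp add: fcomp_def lin_def)
  qed
qed

lemma lin_range_subset_Fr: "homog_gens V b xs \<Longrightarrow> lin_range V xs x \<subseteq> Fr V b x"
  by (rule lin_range_least[OF gmod_Fr]) (auto simp: homog_gens_def in_set_conv_nth)

text \<open>Resolutions are defined by exactness of ungraded modules, while the homology is computed
  in homogeneous components. A homogeneous map commutes with taking components, so the two agree;
  \<open>Z\<close> is the kernel condition.\<close>

lemma exact_graded_iff:
  assumes xs: "homog_gens V b xs"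
    and Z_sum: "\<And>S g. finite (S :: int set) \<Longrightarrow> (\<And>x. x \<in> S \<Longrightarrow> Z (g x)) \<Longrightarrow> Z (sum g S)"
    and Z_comp: "\<And>f x. f \<in> Fu V b \<Longrightarrow> Z f \<Longrightarrow> Z (fcomp b x f)"
  shows "(\<forall>x. {f \<in> Fr V b x. Z f} = lin_range V xs x) \<longleftrightarrow> {f \<in> Fu V b. Z f} = lin xs ` Fu V (degs xs)"
proof
  assume graded: "\<forall>x. {f \<in> Fr V b x. Z f} = lin_range V xs x"
  show "{f \<in> Fu V b. Z f} = lin xs ` Fu V (degs xs)"
  proof (intro equalityI subsetI)
    fix f assume "f \<in> {f \<in> Fu V b. Z f}"
    then have f: "f \<in> Fu V b" "Z f" by auto
    have "fcomp b x f \<in> lin_range V xs x" for x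
      using graded fcomp_Fr[OF f(1)] Z_comp[OF f] by blast
    then have "\<exists>g. g \<in> Fr V (degs xs) x \<and> fcomp b x f = lin xs g" for x by (auto simp: lin_range_def)
    then obtain g where g: "\<And>x. g x \<in> Fr V (degs xs) x" "\<And>x. fcomp b x f = lin xs (g x)" by metis
    obtain S where "finite S" "f = (\<Sum>x\<in>S. fcomp b x f)" by (rule fcomp_decomp[OF f(1)])
    then have "f = lin xs (\<Sum>x\<in>S. g x)" by (simp add: lin_sum g(2))
    then show "f \<in> lin xs ` Fu V (degs xs)" using Fu_sum[of S g] Fr_subset_Fu[OF g(1)] by blast
  next
    fix f assume "f \<in> lin xs ` Fu V (degs xs)"
    then obtain g where g: "g \<in> Fu V (degs xs)" "f = lin xs g" by blast
    obtain S where S: "finite S" "g = (\<Sum>x\<in>S. fcomp (degs xs) x g)" by (rule fcomp_decomp[OF g(1)])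
    have f: "f = (\<Sum>x\<in>S. lin xs (fcomp (degs xs) x g))" unfolding g(2) by (subst S(2)) (rule lin_sum)
    have "lin xs (fcomp (degs xs) x g) \<in> lin_range V xs x" for x
      unfolding lin_range_def by (intro imageI fcomp_Fr g)
    then have "lin xs (fcomp (degs xs) x g) \<in> Fr V b x \<and> Z (lin xs (fcomp (degs xs) x g))" for x
      using graded by blast
    note mem = this
    have "f \<in> Fu V b" unfolding f by (rule Fu_sum) (use mem Fr_subset_Fu in blast)
    moreover have "Z f" unfolding f by (rule Z_sum[OF S(1)]) (use mem in blast)
    ultimately show "f \<in> {f \<in> Fu V b. Z f}" by simp
  qed
next
  assume exact: "{f \<in> Fu V b. Z f} = lin xs ` Fu V (degs xs)"
  show "\<forall>x. {f \<in> Fr V b x. Z f} = lin_range V xs x"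
  proof (intro allI equalityI subsetI)
    fix x f assume "f \<in> {f \<in> Fr V b x. Z f}"
    then have f: "f \<in> Fr V b x" "Z f" by auto
    then obtain g where g: "g \<in> Fu V (degs xs)" "f = lin xs g" using exact Fr_subset_Fu by blast
    have "f = lin xs (fcomp (degs xs) x g)" using fcomp_lin[OF xs, of x g] fcomp_id[OF f(1)] g(2) by simp
    then show "f \<in> lin_range V xs x" unfolding lin_range_def using fcomp_Fr[OF g(1)] by blast
  next
    fix x f assume f: "f \<in> lin_range V xs x"
    then obtain g where "g \<in> Fr V (degs xs) x" "f = lin xs g" by (auto simp: lin_range_def)
    then have "f \<in> lin xs ` Fu V (degs xs)" using Fr_subset_Fu by blast
    then show "f \<in> {f \<in> Fr V b x. Z f}" using exact lin_range_subset_Fr[OF xs] f by blast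
  qed
qed

lemma lin_zero_graded:
  assumes "homog_gens V b xs"
  shows "\<And>S g. finite S \<Longrightarrow> (\<And>x. x \<in> S \<Longrightarrow> lin xs (g x) = 0) \<Longrightarrow> lin xs (sum g S) = 0"
    "\<And>f x. lin xs f = 0 \<Longrightarrow> lin xs (fcomp (degs xs) x f) = 0"
  by (simp_all add: lin_sum flip: fcomp_lin[OF assms])

subsection \<open>Matrices\<close>

definition fun_of_vec :: "('v, 'k::field) mpoly vec \<Rightarrow> ('v, 'k) fvec" where
  "fun_of_vec v = (\<lambda>c. if c < dim_vec v then v $ c else 0)"

definition mat_gens :: "int list \<Rightarrow> ('v, 'k::field) mpoly mat \<Rightarrow> (int \<times> ('v, 'k) fvec) list" where
  "mat_gens a A = map (\<lambda>c. (a ! c, \<lambda>r. if r < dim_row A then A $$ (r, c) else 0)) [0..<length a]"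

lemma degs_mat_gens [simp]: "degs (mat_gens a A) = a"
  by (intro nth_equalityI) (simp_all add: mat_gens_def)

lemma length_mat_gens [simp]: "length (mat_gens a A) = length a"
  by (simp add: mat_gens_def)

lemma nth_mat_gens: "c < length a \<Longrightarrow>
    mat_gens a A ! c = (a ! c, \<lambda>r. if r < dim_row A then A $$ (r, c) else 0)"
  by (simp add: mat_gens_def fun_eq_iff)

lemma homog_gens_iff:
  assumes "A \<in> carrier_mat (length b) (length a)"
  shows "homog_gens V b (mat_gens a A) \<longleftrightarrow> A \<in> graded_hom V a b"
  using assms by (auto simp: homog_gens_def nth_mat_gens graded_hom_def Fr_def Sg_def)

lemma fun_of_vec_mult:
  assumes "A \<in> carrier_mat (length b) (length a)" "w \<in> carrier_vec (length a)"
  shows "fun_of_vec (A *\<^sub>v w) = lin (mat_gens a A) (fun_of_vec w)"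
proof
  fix r
  have "lin (mat_gens a A) (fun_of_vec w) r
      = (\<Sum>c<length a. w $ c * (if r < dim_row A then A $$ (r, c) else 0))"
    unfolding lin_def length_mat_gens
    by (rule sum.cong) (use assms(2) in \<open>auto simp: nth_mat_gens fun_of_vec_def\<close>)
  also have "\<dots> = fun_of_vec (A *\<^sub>v w) r"
    using assms by (auto simp: fun_of_vec_def scalar_prod_def mult.commute lessThan_atLeast0)
  finally show "fun_of_vec (A *\<^sub>v w) r = lin (mat_gens a A) (fun_of_vec w) r" by simp
qed

lemma free_module_Fu: "fun_of_vec ` free_module V a = Fu V a"
proof (intro equalityI subsetI)
  fix f assume f: "f \<in> Fu V a"
  have "fun_of_vec (vec (length a) f) = f" using FuD0[OF f] by (auto simp: fun_of_vec_def)
  moreover have "vec (length a) f \<in> free_module V a" using FuD[OF f] by (simp add: free_module_def)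
  ultimately show "f \<in> fun_of_vec ` free_module V a" by force
qed (auto simp: free_module_def Fu_def fun_of_vec_def)

lemma fun_of_vec_inj: "inj_on fun_of_vec (carrier_vec n)"
proof (rule inj_onI)
  fix v w :: "('a, 'b) mpoly vec" assume vw: "v \<in> carrier_vec n" "w \<in> carrier_vec n" "fun_of_vec v = fun_of_vec w"
  show "v = w"
  proof (rule eq_vecI)
    fix i assume "i < dim_vec w"
    then show "v $ i = w $ i" using fun_cong[OF vw(3), of i] vw(1,2) by (simp add: fun_of_vec_def)
  qed (use vw in simp)
qed

lemma exact_mat_iff:
  assumes A: "A \<in> carrier_mat (length b) (length a)"
  shows "{v \<in> free_module V b. Z (fun_of_vec v)} = (\<lambda>w. A *\<^sub>v w) ` free_module V a \<longleftrightarrow>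
    {f \<in> Fu V b. Z f} = lin (mat_gens a A) ` Fu V a"
proof -
  have sub: "{v \<in> free_module V b. Z (fun_of_vec v)} \<subseteq> carrier_vec (length b)"
    "(\<lambda>w. A *\<^sub>v w) ` free_module V a \<subseteq> carrier_vec (length b)"
    using A by (auto simp: free_module_def)
  have "fun_of_vec ` {v \<in> free_module V b. Z (fun_of_vec v)} = {f \<in> Fu V b. Z f}"
    unfolding free_module_Fu[symmetric] by blast
  moreover have "fun_of_vec ` (\<lambda>w. A *\<^sub>v w) ` free_module V a = lin (mat_gens a A) ` Fu V a"
    unfolding free_module_Fu[symmetric] image_image
    by (rule image_cong) (auto simp: free_module_def fun_of_vec_mult[OF A])
  ultimately show ?thesis using inj_on_image_eq_iff[OF fun_of_vec_inj sub] by simp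
qed

lemma fun_of_vec_eq_0_iff: "v \<in> carrier_vec n \<Longrightarrow> fun_of_vec v = 0 \<longleftrightarrow> v = 0\<^sub>v n"
  by (auto simp: fun_of_vec_def fun_eq_iff vec_eq_iff)

definition aug :: "('v, 'k::field) mpoly vec \<Rightarrow> ('v, 'k) fvec \<Rightarrow> ('v, 'k) mpoly" where
  "aug e f = (\<Sum>c<dim_vec e. f c * e $ c)"

lemma aug_fun_of_vec: "dim_vec v = dim_vec e \<Longrightarrow> aug e (fun_of_vec v) = e \<bullet> v"
  by (simp add: aug_def fun_of_vec_def scalar_prod_def mult.commute lessThan_atLeast0)

lemma aug_add: "aug e (f + g) = aug e f + aug e g"
  by (simp add: aug_def distrib_right sum.distrib)

lemma aug_smul: "aug e (smul h f) = h * aug e f"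
  by (simp add: aug_def smul_def sum_distrib_left mult.assoc)

lemma aug_sum: "aug e (sum f B) = (\<Sum>b\<in>B. aug e (f b))"
proof (induction B rule: infinite_finite_induct)
  case (insert x F)
  then show ?case by (simp only: sum.insert[OF insert.hyps(1,2)] aug_add)
qed (simp_all add: aug_def)

text \<open>Every monomial other than 1 contains a variable. This turns minimality of a resolution
  into a condition on constant terms.\<close>

lemma irrelevant_ideal_iff:
  fixes f :: "('v, 'k::field) mpoly"
  shows "f \<in> irrelevant_ideal V \<longleftrightarrow> f \<in> carrier (mpoly_ring V) \<and> Poly_Mapping.lookup f 0 = 0"
proof -
  have gens: "Var ` V \<subseteq> carrier (mpoly_ring V :: ('v, 'k) mpoly ring)" by auto
  note I = mpoly_genideal[OF gens, folded irrelevant_ideal_def]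
  have "ideal {f \<in> carrier (mpoly_ring V). Poly_Mapping.lookup f 0 = 0} (mpoly_ring V :: ('v, 'k) mpoly ring)"
    by (rule mpoly_idealI) (auto simp: lookup_add lookup_mult_0 mpoly_carrier_closed)
  then have "irrelevant_ideal V \<subseteq> {f \<in> carrier (mpoly_ring V :: ('v, 'k) mpoly ring). Poly_Mapping.lookup f 0 = 0}"
    using lookup_Var_mult_0[of _ "1 :: ('v, 'k) mpoly"] by (intro I(3)) auto
  moreover have "f \<in> irrelevant_ideal V" if f: "f \<in> carrier (mpoly_ring V)" "Poly_Mapping.lookup f 0 = 0"
  proof -
    note cl = mpoly_ideal_closed[OF I(1)]
    have sum: "sum g B \<in> irrelevant_ideal V" if "\<And>b. b \<in> B \<Longrightarrow> g b \<in> irrelevant_ideal V"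
      for g :: "('v \<Rightarrow>\<^sub>0 nat) \<Rightarrow> ('v, 'k) mpoly" and B
      using that by (induction B rule: infinite_finite_induct) (auto intro: cl)
    have "Poly_Mapping.single m (Poly_Mapping.lookup f m) \<in> irrelevant_ideal V" if m: "m \<in> Poly_Mapping.keys f" for m
    proof -
      have "m \<noteq> 0" using m f(2) by (auto simp: in_keys_iff)
      then obtain v where v: "v \<in> Poly_Mapping.keys m" using keys_eq_empty by blast
      have mV: "Poly_Mapping.keys m \<subseteq> V" using f(1) m by (auto simp: carrier_mpoly_ring)
      obtain r where r: "m = r + Poly_Mapping.single v 1" using split_off_var[of m v] v by (auto simp: in_keys_iff)
      have "Poly_Mapping.single r (Poly_Mapping.lookup f m) * Var v \<in> irrelevant_ideal V"
        using mV v I(2) r by (intro cl(5)) (auto simp: keys_add_nat)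
      moreover have "Poly_Mapping.single r (Poly_Mapping.lookup f m) * Var v
          = Poly_Mapping.single m (Poly_Mapping.lookup f m)"
        unfolding Var_def mult_single r[symmetric] by simp
      ultimately show ?thesis by simp
    qed
    then have "(\<Sum>m\<in>Poly_Mapping.keys f. Poly_Mapping.single m (Poly_Mapping.lookup f m)) \<in> irrelevant_ideal V"
      by (rule sum)
    then show ?thesis by (simp flip: poly_mapping_sum_singles)
  qed
  ultimately show ?thesis by blast
qed

section \<open>Minimal resolutions modulo a homogeneous ideal\<close>

locale hom_ideal =
  fixes V :: "'v::linorder set" and J :: "('v, 'k::field) mpoly set"
  assumes V: "finite V" and ideal: "ideal J (mpoly_ring V)"
    and hom: "\<And>f d. f \<in> J \<Longrightarrow> hcomp d f \<in> J"
begin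

lemmas J_closed = mpoly_ideal_closed[OF ideal]

lemma J_sum: "(\<And>b. b \<in> B \<Longrightarrow> g b \<in> J) \<Longrightarrow> sum g B \<in> J"
  by (induction B rule: infinite_finite_induct) (auto intro: J_closed)

definition aug_ker :: "int list \<Rightarrow> ('v, 'k) mpoly vec \<Rightarrow> int \<Rightarrow> ('v, 'k) fvec set" where
  "aug_ker a e d = {f \<in> Fr V a d. aug e f \<in> J}"

context
  fixes a :: "int list" and e :: "('v, 'k) mpoly vec"
  assumes dim_e: "dim_vec e = length a" and e: "\<And>c. c < length a \<Longrightarrow> e $ c \<in> Sg V (a ! c)"
begin

lemma aug_Sg:
  assumes f: "f \<in> Fr V a d" shows "aug e f \<in> Sg V d"
  unfolding aug_def dim_e
proof (rule Sg_sum)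
  fix c assume "c \<in> {..<length a}"
  then have c: "c < length a" by simp
  show "f c * e $ c \<in> Sg V d"
    using Sg_closed(4)[OF FrD[OF f c] e[OF c]] by simp
qed

lemma hcomp_aug: "hcomp x (aug e f) = aug e (fcomp a x f)"
  using hcomp_mult[OF e] by (simp add: aug_def dim_e hcomp_sum fcomp_def)

lemma gmod_aug_ker: "gmod V (aug_ker a e)"
  unfolding gmod_def aug_ker_def
proof (intro conjI allI ballI)
  note Fr = gmodD[OF gmod_Fr[of V a]]
  fix d e' h f g
  show "0 \<in> {f \<in> Fr V a d. aug e f \<in> J}"
    using Fr(1) J_closed(2) by (simp add: aug_def)
  assume f: "f \<in> {f \<in> Fr V a d. aug e f \<in> J}"
  show "f + g \<in> {f \<in> Fr V a d. aug e f \<in> J}" if "g \<in> {f \<in> Fr V a d. aug e f \<in> J}"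
    using f that Fr(2)[of f d g] J_closed(3) by (simp only: mem_Collect_eq aug_add)
  show "smul h f \<in> {f \<in> Fr V a (d + e'). aug e f \<in> J}" if "h \<in> Sg V e'"
    using f Fr(3)[OF that] J_closed(5)[OF Sg_carrier[OF that]] by (simp add: aug_smul)
qed

lemma csys_J_Sg: "koszul.csys V pact (\<lambda>A. J \<inter> Sg V (d - int (card A)))"
proof -
  interpret koszul V "pact :: 'v \<Rightarrow> ('v, 'k) mpoly \<Rightarrow> _" by (rule koszul_pact[OF V])
  note S = csys_Sg[OF V, where 'k = 'k, of d]
  show ?thesis
    unfolding csys_def
  proof (intro conjI allI impI ballI)
    fix A v f assume A: "A \<subseteq> V" "v \<in> V - A" and f: "f \<in> J \<inter> Sg V (d - int (card (insert v A)))"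
    have "Var v * f \<in> Sg V (d - int (card A))"
      using csys_act[OF S, of v A f] A f by simp
    moreover have "Var v * f \<in> J" using A f by (intro J_closed(5)) auto
    ultimately show "Var v * f \<in> J \<inter> Sg V (d - int (card A))" by simp
  next
    fix A f g assume "A \<subseteq> V" "f \<in> J \<inter> Sg V (d - int (card A))" "g \<in> J \<inter> Sg V (d - int (card A))"
    then show "f + g \<in> J \<inter> Sg V (d - int (card A))" "- f \<in> J \<inter> Sg V (d - int (card A))"
      using J_closed(3,4) Sg_closed(2,3) by auto
  qed (use J_closed(2) Sg_closed(1) in auto)
qed

text \<open>The augmentation identifies the free module modulo \<open>aug_ker\<close> with
  \<open>S/J\<close>. A preimage is made homogeneous by taking a component, which is legitimate
  because \<open>J\<close> is homogeneous.\<close>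

lemma tor_van_iff_gvan:
  assumes onto: "\<And>f. f \<in> carrier (mpoly_ring V) \<Longrightarrow> \<exists>g\<in>Fu V a. f - aug e g \<in> J"
  shows "gvan V (Fr V a) (aug_ker a e) i d \<longleftrightarrow> tor_van V J i d"
  unfolding gvan_def tor_van_def
proof (rule van_iso[where f = "aug e"])
  fix A :: "'v set" and f :: "('v, 'k) fvec" and y :: "('v, 'k) mpoly"
  show "aug e f \<in> Sg V (d - int (card A))" if "f \<in> Fr V a (d - int (card A))"
    by (rule aug_Sg[OF that])
  then show "aug e f \<in> J \<inter> Sg V (d - int (card A)) \<longleftrightarrow> f \<in> aug_ker a e (d - int (card A))"
    if "f \<in> Fr V a (d - int (card A))" using that by (simp add: aug_ker_def)
  assume y: "y \<in> Sg V (d - int (card A))"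
  obtain g where g: "g \<in> Fu V a" "y - aug e g \<in> J" using onto[OF Sg_carrier[OF y]] by blast
  have "hcomp (d - int (card A)) (y - aug e g) = y - aug e (fcomp a (d - int (card A)) g)"
    using hcomp_id[OF y] by (simp add: hcomp_def restrict_mpoly_diff flip: hcomp_aug)
  then have "y - aug e (fcomp a (d - int (card A)) g) \<in> J" using hom[OF g(2)] by metis
  moreover have "fcomp a (d - int (card A)) g \<in> Fr V a (d - int (card A))" by (rule fcomp_Fr[OF g(1)])
  moreover have "y - aug e (fcomp a (d - int (card A)) g) \<in> Sg V (d - int (card A))"
    using Sg_closed(2)[OF y Sg_closed(3)[OF aug_Sg[OF fcomp_Fr[OF g(1)]]]] by simp
  ultimately show "\<exists>f\<in>Fr V a (d - int (card A)). y - aug e f \<in> J \<inter> Sg V (d - int (card A))" by blast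
qed (simp_all add: koszul_vact koszul_pact V aug_add aug_smul csys_gmod gmod_Fr csys_J_Sg)

lemma exact_aug_iff:
  assumes "A \<in> carrier_mat (length a) (length b)" "A \<in> graded_hom V b a"
  shows "{v \<in> free_module V a. e \<bullet> v \<in> J} = (\<lambda>w. A *\<^sub>v w) ` free_module V b
    \<longleftrightarrow> (\<forall>x. aug_ker a e x = lin_range V (mat_gens b A) x)"
proof -
  have hg: "homog_gens V a (mat_gens b A)" using assms homog_gens_iff by blast
  have "{v \<in> free_module V a. e \<bullet> v \<in> J} = {v \<in> free_module V a. aug e (fun_of_vec v) \<in> J}"
    using aug_fun_of_vec[of _ e] dim_e by (auto simp: free_module_def)
  moreover have "(\<forall>x. {f \<in> Fr V a x. aug e f \<in> J} = lin_range V (mat_gens b A) x) \<longleftrightarrow>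
      {f \<in> Fu V a. aug e f \<in> J} = lin (mat_gens b A) ` Fu V (degs (mat_gens b A))"
  proof (rule exact_graded_iff[OF hg])
    show "aug e (sum g S) \<in> J" if "\<And>x. x \<in> S \<Longrightarrow> aug e (g x) \<in> J" for g and S :: "int set"
      unfolding aug_sum by (rule J_sum[OF that])
    show "aug e (fcomp a x f) \<in> J" if "aug e f \<in> J" for f x
      using hom[OF that] by (simp flip: hcomp_aug)
  qed
  ultimately show ?thesis
    using exact_mat_iff[OF assms(1), where Z = "\<lambda>f. aug e f \<in> J" and V = V] by (simp add: aug_ker_def)
qed

end

lemma exact_lin_iff:
  assumes A: "A \<in> graded_hom V b a" and B: "B \<in> graded_hom V c b"
  shows "{v \<in> free_module V b. A *\<^sub>v v = 0\<^sub>v (length a)} = (\<lambda>w. B *\<^sub>v w) ` free_module V c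
    \<longleftrightarrow> (\<forall>x. syz V (mat_gens b A) x = lin_range V (mat_gens c B) x)"
proof -
  have A': "A \<in> carrier_mat (length a) (length b)" and B': "B \<in> carrier_mat (length b) (length c)"
    using A B by (auto simp: graded_hom_def)
  have hA: "homog_gens V a (mat_gens b A)" and hB: "homog_gens V b (mat_gens c B)"
    using A B homog_gens_iff[OF A'] homog_gens_iff[OF B'] by auto
  have "A *\<^sub>v v = 0\<^sub>v (length a) \<longleftrightarrow> lin (mat_gens b A) (fun_of_vec v) = 0" if "v \<in> free_module V b" for v
  proof -
    have v: "v \<in> carrier_vec (length b)" using that by (simp add: free_module_def)
    then have "A *\<^sub>v v \<in> carrier_vec (length a)" using A' by simp
    then show ?thesis using fun_of_vec_eq_0_iff fun_of_vec_mult[OF A' v] by metis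
  qed
  then have "{v \<in> free_module V b. A *\<^sub>v v = 0\<^sub>v (length a)}
      = {v \<in> free_module V b. lin (mat_gens b A) (fun_of_vec v) = 0}" by blast
  moreover have "(\<forall>x. {f \<in> Fr V b x. lin (mat_gens b A) f = 0} = lin_range V (mat_gens c B) x) \<longleftrightarrow>
      {f \<in> Fu V b. lin (mat_gens b A) f = 0} = lin (mat_gens c B) ` Fu V (degs (mat_gens c B))"
  proof (rule exact_graded_iff[OF hB])
    show "lin (mat_gens b A) (sum g S) = 0" if "finite S" "\<And>x. x \<in> S \<Longrightarrow> lin (mat_gens b A) (g x) = 0"
      for g and S :: "int set" using lin_zero_graded(1)[OF hA that] .
    show "lin (mat_gens b A) (fcomp b x f) = 0" if "lin (mat_gens b A) f = 0" for f x
      using lin_zero_graded(2)[OF hA that] by simp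
  qed
  ultimately show ?thesis
    using exact_mat_iff[OF B', where Z = "\<lambda>f. lin (mat_gens b A) f = 0" and V = V]
    by (simp add: syz_def)
qed

text \<open>The columns of the matrices form a chain of minimal generators and syzygies, so
  \<open>gvan_chain\<close> applies. As it applies to every minimal resolution, the one picked by
  choice is covered.\<close>

lemma betti_iff_not_tor_van:
  assumes res: "minimal_graded_free_resolution V J D e d"
  shows "x \<in> set (D i) \<longleftrightarrow> \<not> tor_van V J i x"
proof -
  note R = res[unfolded minimal_graded_free_resolution_def graded_free_resolution_def]
  have dim_e: "dim_vec e = length (D 0)" using R by (auto simp: free_module_def)
  have e: "e $ c \<in> Sg V (D 0 ! c)" if "c < length (D 0)" for c
    using R that by (auto simp: free_module_def Sg_def)
  have d: "d (Suc k) \<in> graded_hom V (D (Suc k)) (D k)" for k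
  proof -
    have "\<forall>i\<ge>1. d i \<in> graded_hom V (D i) (D (i - 1))" using R by blast
    from this[rule_format, of "Suc k"] show ?thesis by simp
  qed
  have dc: "d (Suc k) \<in> carrier_mat (length (D k)) (length (D (Suc k)))" for k
    using d[of k] by (simp add: graded_hom_def)
  define X where "X k = mat_gens (D (Suc k)) (d (Suc k))" for k
  have onto: "\<exists>g\<in>Fu V (D 0). f - aug e g \<in> J" if f: "f \<in> carrier (mpoly_ring V)" for f
  proof -
    have "\<forall>f\<in>carrier (mpoly_ring V). \<exists>v\<in>free_module V (D 0). f - e \<bullet> v \<in> J"
      using R by (elim conjE)
    then obtain v where v: "v \<in> free_module V (D 0)" "f - e \<bullet> v \<in> J" using f by blast
    then have "aug e (fun_of_vec v) = e \<bullet> v" using dim_e by (intro aug_fun_of_vec) (simp add: free_module_def)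
    then show ?thesis using v free_module_Fu by force
  qed
  have "{v \<in> free_module V (D 0). e \<bullet> v \<in> J} = (\<lambda>w. d (Suc 0) *\<^sub>v w) ` free_module V (D (Suc 0))"
    using R by simp
  then have X0: "aug_ker (D 0) e y = lin_range V (X 0) y" for y
    unfolding X_def using exact_aug_iff[OF dim_e e dc d] by blast
  have "{v \<in> free_module V (D (Suc k)). d (Suc k) *\<^sub>v v = 0\<^sub>v (length (D k))}
      = (\<lambda>w. d (Suc (Suc k)) *\<^sub>v w) ` free_module V (D (Suc (Suc k)))" for k
  proof -
    have "\<forall>i\<ge>1. {v \<in> free_module V (D i). d i *\<^sub>v v = 0\<^sub>v (length (D (i - 1)))} =
              (\<lambda>w. d (i + 1) *\<^sub>v w) ` free_module V (D (i + 1))" using R by blast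
    from this[rule_format, of "Suc k"] show ?thesis by simp
  qed
  then have XS: "syz V (X k) y = lin_range V (X (Suc k)) y" for k y
    unfolding X_def using exact_lin_iff[OF d d] by blast
  have free: "const_free y" if zy: "(z, y) \<in> set (X k)" for k z y
  proof -
    have "\<forall>i\<ge>1. elements_mat (d i) \<subseteq> irrelevant_ideal V" using R by (elim conjE)
    then have el: "elements_mat (d (Suc k)) \<subseteq> irrelevant_ideal V" by simp
    obtain c where c: "c < length (D (Suc k))" "X k ! c = (z, y)"
      using zy by (auto simp: in_set_conv_nth X_def)
    have "Poly_Mapping.lookup (y r) 0 = 0" for r
    proof (cases "r < dim_row (d (Suc k))")
      case True
      then have "d (Suc k) $$ (r, c) \<in> elements_mat (d (Suc k))"
        using c(1) dc[of k] by (intro elements_matI[of _ _ _ r c]) auto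
      then have "Poly_Mapping.lookup (d (Suc k) $$ (r, c)) 0 = 0" using el irrelevant_ideal_iff by blast
      then show ?thesis using c True by (auto simp: X_def nth_mat_gens)
    qed (use c in \<open>auto simp: X_def nth_mat_gens\<close>)
    then show ?thesis by (simp add: const_free_def)
  qed
  have "gvan V (Fr V (D 0)) (aug_ker (D 0) e) i x \<longleftrightarrow> x \<notin> set (chain_degs (D 0) X i)"
    by (rule gvan_chain[OF V gmod_aug_ker[OF dim_e e] _ X0 XS free]) (auto simp: aug_ker_def)
  moreover have "chain_degs (D 0) X i = D i"
    by (cases i) (simp_all add: chain_degs_def X_def)
  ultimately show ?thesis using tor_van_iff_gvan[OF dim_e e onto] by simp
qed

text \<open>The ring itself, with 1 as augmentation, is the first free module; since elements of
  \<open>J\<close> have no constant term, this first step is already minimal.\<close>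

lemma minimal_resolution_exists:
  assumes J0: "\<And>f. f \<in> J \<Longrightarrow> Poly_Mapping.lookup f 0 = 0"
    and bound: "\<And>i. \<exists>B. \<forall>d\<ge>B. tor_van V J i d"
  shows "\<exists>D e d. minimal_graded_free_resolution V J D e d"
proof -
  define e :: "('v, 'k) mpoly vec" where "e = vec 1 (\<lambda>_. 1)"
  have dim_e: "dim_vec e = length [0::int]" by (simp add: e_def)
  have e: "e $ c \<in> Sg V ([0] ! c)" if "c < length [0::int]" for c
    using that by (simp add: e_def one_Sg)
  have onto: "\<exists>v\<in>free_module V [0]. f - e \<bullet> v \<in> J" if "f \<in> carrier (mpoly_ring V)" for f
    using that J_closed(2) by (intro bexI[of _ "vec 1 (\<lambda>_. f)"]) (simp_all add: e_def scalar_prod_def free_module_def)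
  have onto': "\<exists>g\<in>Fu V [0]. f - aug e g \<in> J" if f: "f \<in> carrier (mpoly_ring V)" for f
  proof -
    obtain v where v: "v \<in> free_module V [0]" "f - e \<bullet> v \<in> J" using onto[OF f] by blast
    then have "aug e (fun_of_vec v) = e \<bullet> v" using dim_e by (intro aug_fun_of_vec) (simp add: free_module_def)
    then show ?thesis using v free_module_Fu by force
  qed
  have sub: "aug_ker [0] e d \<subseteq> Fr V [0] d" for d by (auto simp: aug_ker_def)
  have "tor_bounded V [0] (aug_ker [0] e)"
    unfolding tor_bounded_def
  proof (intro conjI allI gmod_aug_ker[OF dim_e e] sub)
    fix i
    obtain B where B: "\<And>d. B \<le> d \<Longrightarrow> tor_van V J (Suc i) d" using bound[of "Suc i"] by blast
    \<comment> \<open>The bound 1 keeps \<open>d\<close> away from 0, the degree of the generator of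
      the ring.\<close>
    have "gvan V (aug_ker [0] e) (\<lambda>_. {0}) i d" if d: "max B 1 \<le> d" for d
    proof (rule gvan_shift_sub[OF V gmod_aug_ker[OF dim_e e] sub])
      show "gvan V (Fr V [0]) (aug_ker [0] e) (Suc i) d"
        using B d tor_van_iff_gvan[OF dim_e e onto'] by simp
      show "gvan V (Fr V [0] :: int \<Rightarrow> ('v, 'k) fvec set) (\<lambda>_. {0}) i d"
        using gvan_Fr_zero[OF V] gvan_Fr_zero_0[OF V, of d "[0]"] d by (cases i) auto
    qed
    then show "\<exists>D. \<forall>d\<ge>D. gvan V (aug_ker [0] e) (\<lambda>_. {0}) i d" by blast
  qed
  from minimal_chain_exists[OF V this]
  obtain X where X0: "\<And>d. aug_ker [0] e d = lin_range V (X 0) d"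
    and XS: "\<And>k d. syz V (X k) d = lin_range V (X (Suc k)) d"
    and free: "\<And>k d f. f \<in> syz V (X k) d \<Longrightarrow> const_free f"
    and mem: "\<And>x y. (x, y) \<in> set (X 0) \<Longrightarrow> y \<in> aug_ker [0] e x"
    by blast
  define D where "D = chain_degs [0] X"
  have D: "D 0 = [0]" "D (Suc k) = degs (X k)" for k by (simp_all add: D_def chain_degs_def)
  have ent: "snd (X k ! c) \<in> Fr V (D k) (fst (X k ! c)) \<and> const_free (snd (X k ! c))"
    if c: "c < length (X k)" for k c
  proof -
    have "(fst (X k ! c), snd (X k ! c)) \<in> set (X k)" using c by simp
    show ?thesis
    proof (cases k)
      case 0
      then have y: "snd (X k ! c) \<in> aug_ker [0] e (fst (X k ! c))" using mem c by simp
      have "const_free (snd (X k ! c))"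
        unfolding const_free_def
      proof
        fix r show "Poly_Mapping.lookup (snd (X k ! c) r) 0 = 0"
        proof (cases "r = 0")
          case True
          have "aug e (snd (X k ! c)) = snd (X k ! c) 0" by (simp add: aug_def e_def)
          then show ?thesis using J0 y True by (simp add: aug_ker_def)
        next
          case False
          then show ?thesis using FrD0[of "snd (X k ! c)" V "[0]" _ r] y by (auto simp: aug_ker_def)
        qed
      qed
      then show ?thesis using y 0 D(1) by (auto simp: aug_ker_def)
    next
      case (Suc l)
      have "snd (X k ! c) \<in> lin_range V (X (Suc l)) (fst (X k ! c))"
        by (rule lin_range_mem) (use c Suc in simp)
      then have "snd (X k ! c) \<in> syz V (X l) (fst (X k ! c))" using XS by simp
      then show ?thesis using free syz_subset_Fr Suc D(2) by fastforce
    qed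
  qed
  \<comment> \<open>The columns of \<open>d (Suc k)\<close> are the vectors of
    \<open>X k\<close>.\<close>
  define d where "d i = mat (length (D (i - 1))) (length (D i)) (\<lambda>(r, c). snd (X (i - 1) ! c) r)" for i
  have dc: "d (Suc k) \<in> carrier_mat (length (D k)) (length (D (Suc k)))" for k by (simp add: d_def)
  have gens: "mat_gens (D (Suc k)) (d (Suc k)) = X k" for k
  proof (rule nth_equalityI)
    fix c assume "c < length (mat_gens (D (Suc k)) (d (Suc k)))"
    then have c: "c < length (X k)" by (simp add: D)
    have "(\<lambda>r. if r < dim_row (d (Suc k)) then d (Suc k) $$ (r, c) else 0) = snd (X k ! c)"
      using FrD0[of "snd (X k ! c)" V "D k"] ent[OF c] c by (auto simp: d_def D(2) fun_eq_iff)
    then show "mat_gens (D (Suc k)) (d (Suc k)) ! c = X k ! c"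
      using c by (simp add: nth_mat_gens D(2))
  qed (simp add: D)
  have hom_d: "d (Suc k) \<in> graded_hom V (D (Suc k)) (D k)" for k
    unfolding homog_gens_iff[OF dc, symmetric] gens using ent by (simp add: homog_gens_def)
  have "graded_free_resolution V J D e d"
    unfolding graded_free_resolution_def
  proof (intro conjI allI impI ballI)
    show "e \<in> free_module V (D 0)" by (simp add: free_module_def D e_def)
    show "homogeneous (D 0 ! c) (e $ c)" if "c < length (D 0)" for c
      using e[of c] that by (simp add: D Sg_def)
    show "d i \<in> graded_hom V (D i) (D (i - 1))" if "1 \<le> i" for i
      using hom_d[of "i - 1"] that by simp
    show "\<exists>v\<in>free_module V (D 0). f - e \<bullet> v \<in> J" if "f \<in> carrier (mpoly_ring V)" for f
      using onto[OF that] by (simp add: D)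
    have "{v \<in> free_module V [0]. e \<bullet> v \<in> J} = (\<lambda>w. d (Suc 0) *\<^sub>v w) ` free_module V (D (Suc 0))"
      using exact_aug_iff[OF dim_e e, of "d (Suc 0)" "D (Suc 0)"] dc[of 0] hom_d[of 0] X0
      unfolding gens by (simp add: D(1))
    then show "{v \<in> free_module V (D 0). e \<bullet> v \<in> J} = (\<lambda>w. d 1 *\<^sub>v w) ` free_module V (D 1)"
      by (simp add: D(1))
    fix i :: nat assume "1 \<le> i"
    then obtain k where k: "i = Suc k" by (cases i) auto
    show "{v \<in> free_module V (D i). d i *\<^sub>v v = 0\<^sub>v (length (D (i - 1)))} =
        (\<lambda>w. d (i + 1) *\<^sub>v w) ` free_module V (D (i + 1))"
      using exact_lin_iff[OF hom_d[of k] hom_d[of "Suc k"]] XS unfolding gens k by simp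
  qed
  moreover have "elements_mat (d i) \<subseteq> irrelevant_ideal V" if "1 \<le> i" for i
  proof
    obtain k where k: "i = Suc k" using \<open>1 \<le> i\<close> by (cases i) auto
    fix f assume "f \<in> elements_mat (d i)"
    then obtain r c where rc: "r < length (D k)" "c < length (X k)" "f = snd (X k ! c) r"
      by (auto simp: k d_def D(2) elements_mat_def)
    have "f \<in> carrier (mpoly_ring V)"
      using FuD[OF Fr_subset_Fu[OF conjunct1[OF ent[OF rc(2)]]] rc(1)] rc(3) by simp
    moreover have "Poly_Mapping.lookup f 0 = 0" using ent[OF rc(2)] rc(3) by (simp add: const_free_def)
    ultimately show "f \<in> irrelevant_ideal V" using irrelevant_ideal_iff by blast
  qed
  ultimately show ?thesis unfolding minimal_graded_free_resolution_def by blast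
qed

end

text \<open>Rows range over all integers, so internal degrees may be negative; there the ring has no
  nonzero elements.\<close>

lemma tor_van_neg:
  assumes V: "finite V" and d: "d < 0" and J: "(0 :: ('v::linorder, 'k::field) mpoly) \<in> J"
    and sys: "koszul.csys V pact (\<lambda>A. J \<inter> Sg V (d - int (card A)))"
  shows "tor_van V J i d"
proof -
  interpret koszul V "pact :: 'v \<Rightarrow> ('v, 'k) mpoly \<Rightarrow> _" by (rule koszul_pact[OF V])
  have "f = 0" if f: "f \<in> Sg V (d - int (card A))" for f :: "('v, 'k) mpoly" and A :: "'v set"
  proof -
    have "Poly_Mapping.keys f = {}" using f d by (fastforce simp: Sg_alt)
    then show ?thesis by simp
  qed
  then show ?thesis unfolding tor_van_def
    by (intro van_zero sys) (auto simp: Sg_closed)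
qed

lemma G0_hom_ideal:
  "hom_ideal (xy_vars 17) (binomial_edge_ideal 17 G0 :: (xy_var, 'k::field) mpoly set)"
proof (rule hom_ideal.intro)
  show "hcomp d f \<in> binomial_edge_ideal 17 G0" if "f \<in> binomial_edge_ideal 17 G0"
    for f :: "(xy_var, 'k) mpoly" and d
    unfolding hcomp_def by (rule G0.restrict_J[OF _ that]) (simp add: G0.move_invariants(2))
qed (rule G0.finite_V G0.ideal_J)+

text \<open>The absence of rows beyond 5 bounds the degrees of Tor in each column, which is what the
  existence of a minimal resolution rests on.\<close>

lemma G0_betti_iff:
  "x \<in> set (resolution_degrees (xy_vars 17) (binomial_edge_ideal 17 G0 :: (xy_var, 'k::field) mpoly set) i)
    \<longleftrightarrow> \<not> tor_van (xy_vars 17) (binomial_edge_ideal 17 G0 :: (xy_var, 'k) mpoly set) i x"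
proof -
  interpret H: hom_ideal "xy_vars 17" "binomial_edge_ideal 17 G0 :: (xy_var, 'k) mpoly set"
    by (rule G0_hom_ideal)
  have "\<exists>D e d. minimal_graded_free_resolution (xy_vars 17) (binomial_edge_ideal 17 G0 :: (xy_var, 'k) mpoly set) D e d"
  proof (rule H.minimal_resolution_exists)
    fix f :: "(xy_var, 'k) mpoly" assume f: "f \<in> binomial_edge_ideal 17 G0"
    show "Poly_Mapping.lookup f 0 = 0"
    proof (rule ccontr)
      assume "Poly_Mapping.lookup f 0 \<noteq> 0"
      \<comment> \<open>The monomial 1 has weight 0, the least possible, so it would be nonstandard;
        but its support is empty.\<close>
      then have "G0.nonstd 0"
        by (intro G0.lowest_nonstd[OF f]) (simp_all add: in_keys_iff wsum_def)
      then show False by (simp add: G0.nonstd_def G0.indep_def)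
    qed
  next
    fix i
    have "tor_van (xy_vars 17) (binomial_edge_ideal 17 G0 :: (xy_var, 'k) mpoly set) i d" if "int i + 6 \<le> d" for d
    proof -
      have "i + 6 \<le> nat d" "int (nat d) = d" using that by arith+
      then show ?thesis using G0_tor_van[of i "nat d", where 'k = 'k] by simp
    qed
    then show "\<exists>B. \<forall>d\<ge>B. tor_van (xy_vars 17) (binomial_edge_ideal 17 G0 :: (xy_var, 'k) mpoly set) i d" by blast
  qed
  then have "\<exists>e d. minimal_graded_free_resolution (xy_vars 17) (binomial_edge_ideal 17 G0 :: (xy_var, 'k) mpoly set)
      (resolution_degrees (xy_vars 17) (binomial_edge_ideal 17 G0 :: (xy_var, 'k) mpoly set)) e d"
    unfolding resolution_degrees_def by (rule someI_ex)
  then show ?thesis using H.betti_iff_not_tor_van by blast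
qed

theorem theorem4p6:
  fixes J :: "(xy_var, 'k::field) mpoly set" and p :: nat
  assumes "J = binomial_edge_ideal 17 G0"
    and "p = proj_dim (xy_vars 17) J"
  shows "graded_betti (xy_vars 17) J p (int p + 5) = 0
    \<and> \<not> has_unique_extremal_betti (xy_vars 17) J"
proof -
  interpret H: hom_ideal "xy_vars 17" J unfolding assms(1) by (rule G0_hom_ideal)
  have betti: "graded_betti (xy_vars 17) J i x \<noteq> 0 \<longleftrightarrow> \<not> tor_van (xy_vars 17) J i x" for i x
    using G0_betti_iff[of x i, where 'k = 'k] unfolding graded_betti_def assms(1) count_list_0_iff by simp
  have zero: "graded_betti (xy_vars 17) J i (int i + l) = 0" if "6 \<le> l \<or> 26 \<le> i \<or> 24 \<le> i \<and> 5 \<le> l" for i l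
  proof -
    have "tor_van (xy_vars 17) J i (int i + l)"
    proof (cases "int i + l < 0")
      case True
      then show ?thesis
        \<comment> \<open>The augmentation is instantiated by the free module of rank 0.\<close>
        by (intro tor_van_neg H.V H.J_closed H.csys_J_Sg[of "0\<^sub>v 0" "[]"]) simp_all
    next
      case False
      define d where "d = nat (int i + l)"
      have d: "int d = int i + l" using False by (simp add: d_def)
      then have "i + 6 \<le> d \<or> 26 \<le> i \<or> 24 \<le> i \<and> i + 5 \<le> d" using that by linarith
      then show ?thesis using G0_tor_van[of i d, where 'k = 'k] unfolding assms(1) d by blast
    qed
    then show ?thesis using betti by blast
  qed
  have nz25: "graded_betti (xy_vars 17) J 25 (int 25 + 4) \<noteq> 0"
  proof -
    have "\<not> tor_van (xy_vars 17) J 25 (int 25 + 4)" unfolding assms(1) using G0_not_tor_van_25 by simp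
    then show ?thesis using betti by blast
  qed
  have nz5: "graded_betti (xy_vars 17) J 5 (int 5 + 5) \<noteq> 0"
  proof -
    have "\<not> tor_van (xy_vars 17) J 5 (int 5 + 5)" unfolding assms(1) using G0_not_tor_van_5 by simp
    then show ?thesis using betti by blast
  qed
  have "p = 25"
    unfolding assms(2) proj_dim_def
  proof (rule Greatest_equality)
    show "resolution_degrees (xy_vars 17) J 25 \<noteq> []"
      using nz25 by (auto simp: graded_betti_def)
    fix i assume "resolution_degrees (xy_vars 17) J i \<noteq> []"
    then obtain x where "x \<in> set (resolution_degrees (xy_vars 17) J i)" by (meson list.set_sel(1))
    then have "graded_betti (xy_vars 17) J i (int i + (x - int i)) \<noteq> 0"
      by (simp add: graded_betti_def count_list_0_iff)
    then show "i \<le> 25" using zero[of "x - int i" i] by (cases "26 \<le> i") auto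
  qed
  have ext25: "extremal_betti (xy_vars 17) J 25 4"
    unfolding extremal_betti_def
  proof (intro conjI allI impI nz25)
    fix k :: nat and l :: int assume kl: "25 \<le> k" "4 \<le> l" "(k, l) \<noteq> (25, 4)"
    then have "26 \<le> k \<or> 24 \<le> k \<and> 5 \<le> l" by (cases "k = 25") auto
    then show "graded_betti (xy_vars 17) J k (int k + l) = 0" using zero by blast
  qed
  \<comment> \<open>The last nonzero column of row 5. Since all later rows vanish, this position is
    extremal; it differs from (25, 4) already in its row.\<close>
  define q where "q = (GREATEST k. graded_betti (xy_vars 17) J k (int k + 5) \<noteq> 0)"
  have bound: "k \<le> 25" if "graded_betti (xy_vars 17) J k (int k + 5) \<noteq> 0" for k
    using zero[of 5 k] that by (cases "26 \<le> k") auto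
  have q: "graded_betti (xy_vars 17) J q (int q + 5) \<noteq> 0"
    unfolding q_def
    by (rule GreatestI_nat[where P = "\<lambda>k. graded_betti (xy_vars 17) J k (int k + 5) \<noteq> 0", OF nz5 bound])
  have "extremal_betti (xy_vars 17) J q 5"
    unfolding extremal_betti_def
  proof (intro conjI allI impI q)
    fix k :: nat and l :: int assume kl: "q \<le> k" "5 \<le> l" "(k, l) \<noteq> (q, 5)"
    show "graded_betti (xy_vars 17) J k (int k + l) = 0"
    proof (cases "l = 5")
      case True
      show ?thesis
      proof (rule ccontr)
        assume "graded_betti (xy_vars 17) J k (int k + l) \<noteq> 0"
        then have "graded_betti (xy_vars 17) J k (int k + 5) \<noteq> 0" using True by simp
        then have "k \<le> q" unfolding q_def
          by (rule Greatest_le_nat[where P = "\<lambda>k. graded_betti (xy_vars 17) J k (int k + 5) \<noteq> 0", OF _ bound])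
        then show False using kl True by simp
      qed
    next
      case False
      then show ?thesis using kl zero[of l k] by simp
    qed
  qed
  note ext5 = this
  have "\<not> has_unique_extremal_betti (xy_vars 17) J"
  proof
    assume "has_unique_extremal_betti (xy_vars 17) J"
    then have "ij = ij'" if "extremal_betti (xy_vars 17) J (fst ij) (snd ij)"
      "extremal_betti (xy_vars 17) J (fst ij') (snd ij')" for ij ij'
      using that unfolding has_unique_extremal_betti_def by blast
    from this[of "(q, 5)" "(25, 4)"] show False using ext5 ext25 by simp
  qed
  moreover have "graded_betti (xy_vars 17) J p (int p + 5) = 0"
    using zero[of 5 25] \<open>p = 25\<close> by simp
  ultimately show ?thesis by blast
qed

end
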